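(* Assume the Set Cover Conjecture. Then for every $c > 0$ and every $\varepsilon > 0$ there exists $k \in \mathbb{N}$ such that the $k$-Orthogonal Vectors problem cannot be solved in time $\mathcal{O}(2^{(1-\varepsilon)d} \cdot n^c)$.
   Context: The $k$-Orthogonal Vectors problem: given families $A_1,\ldots,A_k$ of subsets of $\{1,\ldots,d\}$, each of size $n$, decide whether there exist $a_1\in A_1,\ldots,a_k\in A_k$ with $a_1\cap\cdots\cap a_k=\emptyset$. The Set Cover problem: given a finite universe $U$, a family $F$ of subsets of $U$ and a positive integer $t$, decide whether there exist $t$ sets in $F$ whose union is $U$. The Set Cover Conjecture asserts that there is no $\varepsilon>0$ for which Set Cover can be solved in time $2^{(1-\varepsilon)|U|}\cdot \mathrm{poly}(|U|,|F|)$. *)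

theory Defs
  imports
    Complex_Main
    "HOL-Library.Log_Nat"
    "HOL-Computational_Algebra.Polynomial"
begin

section \<open>Model of computation: random access machines with logarithmic cost\<close>

text \<open>
  The memory consists of cells numbered by natural numbers, each holding a natural number.
  Programs are deterministic while-programs with indirect addressing; \<open>Mem e\<close> denotes the
  content of the cell whose number is the value of \<open>e\<close>, so the cells with constant
  numbers play the part of registers. Subtraction is truncated at \<open>0\<close>.

  The cost criterion is the logarithmic one: each value that is computed, used as an address,
  read or written is charged its number of binary digits. Up to factors polylogarithmic in the
  running time and in the input numbers this agrees with a unit-cost machine on words of
  logarithmic length, whereas unit cost with unbounded numbers would be unrealistically powerful.
\<close>

datatype binop = Plus | Minus | Times | Div

datatype expr = Const nat | Mem expr | Bin binop expr expr

datatype prog =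
    Skip
  | Assign expr expr  \<comment> \<open>\<open>Assign a e\<close>: store the value of \<open>e\<close> in the cell numbered by the value of \<open>a\<close>\<close>
  | Seq prog prog
  | If expr prog prog  \<comment> \<open>a condition holds if its value is nonzero\<close>
  | While expr prog

type_synonym memory = "nat \<Rightarrow> nat"

fun binop_val :: "binop \<Rightarrow> nat \<Rightarrow> nat \<Rightarrow> nat" where
  "binop_val Plus x y = x + y"
| "binop_val Minus x y = x - y"
| "binop_val Times x y = x * y"
| "binop_val Div x y = x div y"

fun val :: "expr \<Rightarrow> memory \<Rightarrow> nat" where
  "val (Const n) m = n"
| "val (Mem e) m = m (val e m)"
| "val (Bin f e1 e2) m = binop_val f (val e1 m) (val e2 m)"

text \<open>\<open>floorlog 2 n\<close> is the number of binary digits of \<open>n\<close>, except that it is \<open>0\<close> for \<open>n = 0\<close>.\<close>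

definition bit_length :: "nat \<Rightarrow> nat" where
  "bit_length n = max 1 (floorlog 2 n)"

fun cost :: "expr \<Rightarrow> memory \<Rightarrow> nat" where
  "cost (Const n) m = bit_length n"
| "cost (Mem e) m = cost e m + bit_length (m (val e m))"
| "cost (Bin f e1 e2) m =
     cost e1 m + cost e2 m + bit_length (binop_val f (val e1 m) (val e2 m))"

text \<open>\<open>exec P m \<tau> m'\<close>: started in memory \<open>m\<close>, the program \<open>P\<close> halts after time \<open>\<tau>\<close>
  in memory \<open>m'\<close>.\<close>

inductive exec :: "prog \<Rightarrow> memory \<Rightarrow> nat \<Rightarrow> memory \<Rightarrow> bool" where
  Skip: "exec Skip m 1 m"
| Assign: "exec (Assign a e) m (cost a m + cost e m) (m(val a m := val e m))"
| Seq: "exec P m \<tau>1 m1 \<Longrightarrow> exec Q m1 \<tau>2 m2 \<Longrightarrow> exec (Seq P Q) m (\<tau>1 + \<tau>2) m2"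
| IfTrue: "val e m \<noteq> 0 \<Longrightarrow> exec P m \<tau> m' \<Longrightarrow> exec (If e P Q) m (cost e m + \<tau>) m'"
| IfFalse: "val e m = 0 \<Longrightarrow> exec Q m \<tau> m' \<Longrightarrow> exec (If e P Q) m (cost e m + \<tau>) m'"
| WhileFalse: "val e m = 0 \<Longrightarrow> exec (While e P) m (cost e m) m"
| WhileTrue: "val e m \<noteq> 0 \<Longrightarrow> exec P m \<tau>1 m1 \<Longrightarrow> exec (While e P) m1 \<tau>2 m2 \<Longrightarrow>
    exec (While e P) m (cost e m + \<tau>1 + \<tau>2) m2"

definition load :: "nat list \<Rightarrow> memory" where
  "load xs = (\<lambda>i. if i < length xs then xs ! i else 0)"

text \<open>\<open>answers P xs b \<beta>\<close>: on input \<open>xs\<close> the program \<open>P\<close> halts within time \<open>\<beta>\<close>, leaving the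
  truth value \<open>b\<close> in cell \<open>0\<close>.\<close>

definition answers :: "prog \<Rightarrow> nat list \<Rightarrow> bool \<Rightarrow> real \<Rightarrow> bool" where
  "answers P xs b \<beta> \<longleftrightarrow>
     (\<exists>\<tau> m. exec P (load xs) \<tau> m \<and> real \<tau> \<le> \<beta> \<and> m 0 = of_bool b)"

text \<open>Subsets of \<open>{1..d}\<close> are given to programs as characteristic vectors.\<close>

definition char_vector :: "nat \<Rightarrow> nat set \<Rightarrow> nat list" where
  "char_vector d S = map (\<lambda>i. of_bool (i \<in> S)) [1..<Suc d]"


section \<open>Set Cover\<close>

definition set_cover :: "'a set \<Rightarrow> 'a set set \<Rightarrow> nat \<Rightarrow> bool" where
  "set_cover U F t \<longleftrightarrow> (\<exists>C \<subseteq> F. card C = t \<and> \<Union>C = U)"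

text \<open>
  As an input, the universe is \<open>{1..u}\<close> and the family \<open>F\<close> is listed, without repetitions and
  in any order, as \<open>Fs\<close>. The number \<open>t\<close> comes last and in unary: a time bound that depends
  on \<open>u\<close> and \<open>|F|\<close> only would not suffice, at logarithmic cost, for reading an arbitrarily
  large \<open>t\<close> in binary, while here \<open>t > |F|\<close> is detected by looking at a single cell.
\<close>

definition set_cover_input :: "nat \<Rightarrow> nat set list \<Rightarrow> nat \<Rightarrow> nat list" where
  "set_cover_input u Fs t =
     [u, length Fs] @ concat (map (char_vector u) Fs) @ replicate t 1"

definition set_cover_solvable_in :: "(nat \<Rightarrow> nat \<Rightarrow> real) \<Rightarrow> bool" where
  "set_cover_solvable_in T \<longleftrightarrow>
     (\<exists>P. \<forall>u F Fs t.
        F \<subseteq> Pow {1..u} \<longrightarrow> distinct Fs \<longrightarrow> set Fs = F \<longrightarrow> t \<ge> 1 \<longrightarrow>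
        answers P (set_cover_input u Fs t) (set_cover {1..u} F t) (T u (card F)))"

text \<open>The factor \<open>poly(|U|,|F|)\<close> is a bivariate polynomial \<open>p\<close>, evaluated at \<open>(|U|,|F|)\<close>.\<close>

definition Set_Cover_Conjecture :: bool where
  "Set_Cover_Conjecture \<longleftrightarrow>
     \<not> (\<exists>\<epsilon>::real. \<epsilon> > 0 \<and>
         (\<exists>p :: real poly poly. set_cover_solvable_in
            (\<lambda>u f. 2 powr ((1 - \<epsilon>) * real u) * poly (poly p [:real u:]) (real f))))"


section \<open>\<open>k\<close>-Orthogonal Vectors\<close>

text \<open>The families are numbered from \<open>0\<close> instead of \<open>1\<close>; only \<open>k \<ge> 1\<close> is of interest.\<close>

definition orthogonal_vectors :: "nat \<Rightarrow> (nat \<Rightarrow> 'a set set) \<Rightarrow> bool" where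
  "orthogonal_vectors k A \<longleftrightarrow>
     (\<exists>a. (\<forall>i<k. a i \<in> A i) \<and> (\<Inter>i<k. a i) = {})"

text \<open>The list \<open>As ! i\<close> enumerates the family \<open>A i\<close>, without repetitions and in any order.\<close>

definition ov_input :: "nat \<Rightarrow> nat \<Rightarrow> nat set list list \<Rightarrow> nat list" where
  "ov_input d n As = [d, n] @ concat (map (char_vector d) (concat As))"

text \<open>Empty families are excluded, since time bounds such as \<open>n powr c\<close> vanish at \<open>n = 0\<close>.\<close>

definition ov_solvable_in :: "nat \<Rightarrow> (nat \<Rightarrow> nat \<Rightarrow> real) \<Rightarrow> bool" where
  "ov_solvable_in k T \<longleftrightarrow>
     (\<exists>P. \<forall>d n A As.
        n \<ge> 1 \<longrightarrow> (\<forall>i<k. A i \<subseteq> Pow {1..d} \<and> card (A i) = n) \<longrightarrow>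
        length As = k \<longrightarrow> (\<forall>i<k. distinct (As ! i) \<and> set (As ! i) = A i) \<longrightarrow>
        answers P (ov_input d n As) (orthogonal_vectors k A) (T d n))"

definition ov_solvable_in_bigo :: "nat \<Rightarrow> (nat \<Rightarrow> nat \<Rightarrow> real) \<Rightarrow> bool" where
  "ov_solvable_in_bigo k f \<longleftrightarrow> (\<exists>K::real. ov_solvable_in k (\<lambda>d n. K * f d n))"

end

theory Submission
  imports Defs "HOL-Library.Nat_Bijection"
begin

text \<open>
  Given a cover of a universe of size \<open>u\<close> by \<open>t\<close> sets, assign every element to one set containing
  it and sort the sets by the number of elements that they receive. The \<open>k\<close> first ones are kept
  apart, and the others are dealt out to \<open>k\<close> groups; then every group receives at most \<open>u / k\<close>
  elements. So a cover amounts to \<open>2k\<close> parts, each of which is a member of the family or one of the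
  \<open>2 ^ (\<delta> u)\<close> sets of size at most \<open>u / k\<close>, where the number of members of the family needed for
  a small part is found by dynamic programming. The parts cover the universe if and only if their
  complements have empty intersection, and \<open>2k\<close> additional coordinates make sure that the \<open>i\<close>-th
  part uses at most as many members of the family as the \<open>i\<close>-th group contains. This is an instance
  of \<open>2k\<close>-Orthogonal Vectors of dimension \<open>u + 2k\<close> with \<open>n \<le> |F| + 2 ^ (\<delta> u)\<close>, and the factor
  \<open>n ^ c\<close> is absorbed by choosing \<open>\<delta>\<close> small.

  The random access machine leaves its input untouched and keeps all arrays, one of them being the
  memory of the program for Orthogonal Vectors, interleaved in the cells above.
\<close>

section \<open>Running times of programs\<close>

text \<open>The first k sets are kept apart because any one of them may receive most of the
  universe. In the sorted list, the set at position l * k + g with l \<ge> 1 receives at most the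
  average over the k positions that end there. These blocks are disjoint for different l, so a group
  without its first set receives at most u / k elements. Merging forgets how many sets are used, and
  Orthogonal Vectors cannot add up numbers over the chosen vectors; but the group sizes depend on t
  and k alone, so the bound t splits into 2k local bounds, each tested by one coordinate. The
  constants are fixed in the order c and \<epsilon>, \<delta>, k. The condition \<delta> * c \<le>
  \<epsilon> / 2 leaves a saving of \<epsilon> / 2 in spite of the factor n ^ c, and 3 * \<delta>
  \<le> 1 / 2 pays for the reduction, whose time is at most cubic in n up to polynomial factors. A
  suitable k exists for every \<delta> because the number of sets of size at most u / k is
  exponential in u at a rate that vanishes as k grows. The solver is an arbitrary program that
  expects its input from cell 0 on and blank memory behind it, so all its memory accesses are
  redirected into one array.\<close>

lemma bit_length_ge_1: "1 \<le> bit_length n"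
  by (simp add: bit_length_def)

lemma bit_length_le:
  assumes "v \<le> 2 ^ k"
  shows "bit_length v \<le> k + 1"
proof -
  have "v < 2 ^ (k + 1)"
    using assms by (simp add: less_le_trans le_less_trans)
  then have "floorlog 2 v \<le> k + 1"
    by (intro floorlog_leI) auto
  then show ?thesis by (simp add: bit_length_def)
qed

lemma bit_length_bounds: "n < 2 ^ bit_length n"
proof (cases "n = 0")
  case False
  then have "n < 2 ^ floorlog 2 n"
    using floorlog_bounds[of n 2] by auto
  also have "(2::nat) ^ floorlog 2 n \<le> 2 ^ bit_length n"
    by (intro power_increasing) (auto simp: bit_length_def)
  finally show ?thesis .
qed simp

lemma bit_length_mono: "m \<le> n \<Longrightarrow> bit_length m \<le> bit_length n"
  by (auto simp: bit_length_def intro: floorlog_mono max.coboundedI2)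

lemma bit_length_lt:
  assumes "v < 2 ^ k" "1 \<le> k"
  shows "bit_length v \<le> k"
  using assms floorlog_leI[of v 2 k] by (simp add: bit_length_def)

lemma bit_length_mult: "bit_length (x * y) \<le> bit_length x + bit_length y"
  using bit_length_bounds[of x] bit_length_bounds[of y] bit_length_ge_1[of x]
  by (intro bit_length_lt) (auto simp: power_add intro: mult_strict_mono)

lemma bit_length_add: "bit_length (x + y) \<le> bit_length x + bit_length y"
proof (intro bit_length_lt)
  have "x + 1 \<le> 2 ^ bit_length x" "y + 1 \<le> 2 ^ bit_length y"
    using bit_length_bounds[of x] bit_length_bounds[of y] by auto
  then have "(x + 1) * (y + 1) \<le> 2 ^ bit_length x * 2 ^ bit_length y"
    by (rule mult_mono) auto
  moreover have "x + y < (x + 1) * (y + 1)" by simp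
  ultimately show "x + y < 2 ^ (bit_length x + bit_length y)"
    unfolding power_add by linarith
qed (use bit_length_ge_1[of x] in simp)

text \<open>Numbers up to 2 ^ b combine to values up to \<open>2 ^ (b * expr_size e)\<close>:
  multiplication adds the exponents, and the node of the operator itself pays for the doubling that
  a sum may cause.\<close>

fun expr_size :: "expr \<Rightarrow> nat" where
  "expr_size (Const n) = 1"
| "expr_size (Mem e) = expr_size e + 1"
| "expr_size (Bin f e1 e2) = expr_size e1 + expr_size e2 + 1"

text \<open>Measured in units of b. Each node is charged twice the size of its value because a
  number up to 2 ^ m may have m + 1 digits.\<close>

fun expr_cost :: "expr \<Rightarrow> nat" where
  "expr_cost (Const n) = 2"
| "expr_cost (Mem e) = expr_cost e + 2"
| "expr_cost (Bin f e1 e2) = expr_cost e1 + expr_cost e2 + 2 * expr_size (Bin f e1 e2)"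

fun expr_consts_le :: "nat \<Rightarrow> expr \<Rightarrow> bool" where
  "expr_consts_le M (Const n) \<longleftrightarrow> n \<le> M"
| "expr_consts_le M (Mem e) \<longleftrightarrow> expr_consts_le M e"
| "expr_consts_le M (Bin f e1 e2) \<longleftrightarrow> expr_consts_le M e1 \<and> expr_consts_le M e2"

fun consts_le :: "nat \<Rightarrow> prog \<Rightarrow> bool" where
  "consts_le M Skip \<longleftrightarrow> True"
| "consts_le M (Assign a e) \<longleftrightarrow> expr_consts_le M a \<and> expr_consts_le M e"
| "consts_le M (Seq P Q) \<longleftrightarrow> consts_le M P \<and> consts_le M Q"
| "consts_le M (If e P Q) \<longleftrightarrow> expr_consts_le M e \<and> consts_le M P \<and> consts_le M Q"
| "consts_le M (While e P) \<longleftrightarrow> expr_consts_le M e \<and> consts_le M P"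

text \<open>The running time, in units of the bit length of the numbers, if every execution of a loop
  has at most \<open>Z\<close> iterations.\<close>

fun steps :: "nat \<Rightarrow> prog \<Rightarrow> nat" where
  "steps Z Skip = 1"
| "steps Z (Assign a e) = expr_cost a + expr_cost e"
| "steps Z (Seq P Q) = steps Z P + steps Z Q"
| "steps Z (If e P Q) = expr_cost e + steps Z P + steps Z Q"
| "steps Z (While e P) = expr_cost e + Z * (expr_cost e + steps Z P)"

fun loop_depth :: "prog \<Rightarrow> nat" where
  "loop_depth Skip = 0"
| "loop_depth (Assign a e) = 0"
| "loop_depth (Seq P Q) = max (loop_depth P) (loop_depth Q)"
| "loop_depth (If e P Q) = max (loop_depth P) (loop_depth Q)"
| "loop_depth (While e P) = Suc (loop_depth P)"

text \<open>Every level of nesting contributes at most one factor Z, and Z = 1 gives the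
  coefficient. The exponent matters: it decides how small \<delta> has to be in the end.\<close>

lemma steps_le:
  assumes "1 \<le> Z" "loop_depth P \<le> D"
  shows "steps Z P \<le> steps 1 P * Z ^ D"
  using assms(2)
proof (induction P arbitrary: D)
  have Z: "1 \<le> Z ^ D" for D
    using assms(1) by simp
  have le: "x \<le> x * Z ^ D" for x D
    using mult_le_mono2[OF Z, of x D] by simp
  {
    case Skip
    then show ?case using Z by simp
  next
    case (Assign a e)
    show ?case unfolding steps.simps by (rule le)
  next
    case (Seq P Q)
    then have "steps Z P \<le> steps 1 P * Z ^ D" "steps Z Q \<le> steps 1 Q * Z ^ D" by auto
    then show ?case by (simp add: algebra_simps)
  next
    case (If e P Q)
    then have "steps Z P \<le> steps 1 P * Z ^ D" "steps Z Q \<le> steps 1 Q * Z ^ D" by auto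
    with le[of "expr_cost e" D] show ?case
      unfolding steps.simps distrib_right by linarith
  next
    case (While e P)
    then obtain D' where D: "D = Suc D'" "loop_depth P \<le> D'"
      by (cases D) auto
    have "steps Z P \<le> steps 1 P * Z ^ D'" using D While by auto
    with le[of "expr_cost e" D'] have "expr_cost e + steps Z P \<le> (expr_cost e + steps 1 P) * Z ^ D'"
      unfolding distrib_right by linarith
    then have "Z * (expr_cost e + steps Z P) \<le> (expr_cost e + steps 1 P) * Z ^ D"
      using mult_le_mono2[of _ _ Z] D by (simp add: ac_simps)
    with le[of "expr_cost e" D] show ?case
      unfolding steps.simps distrib_right mult_1 by linarith
  }
qed

definition bounded :: "nat \<Rightarrow> memory \<Rightarrow> bool" where
  "bounded b m \<longleftrightarrow> (\<forall>i. m i \<le> 2 ^ b)"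

lemma expr_size_pos: "1 \<le> expr_size e"
  by (induction e) auto

lemma val_le:
  assumes "bounded b m" "expr_consts_le (2 ^ b) e" "1 \<le> b"
  shows "val e m \<le> 2 ^ (b * expr_size e)"
  using assms(2)
proof (induction e)
  case (Const n)
  then show ?case by simp
next
  case (Mem e)
  have "m (val e m) \<le> 2 ^ b" using assms(1) by (simp add: bounded_def)
  also have "(2::nat) ^ b \<le> 2 ^ (b * expr_size (Mem e))"
    by (intro power_increasing) auto
  finally show ?case by simp
next
  case (Bin f e1 e2)
  let ?s = "b * (expr_size e1 + expr_size e2)"
  have 1: "val e1 m \<le> 2 ^ (b * expr_size e1)" "val e2 m \<le> 2 ^ (b * expr_size e2)"
    using Bin by auto
  have p: "(2::nat) ^ (b * expr_size e1) \<le> 2 ^ ?s" "(2::nat) ^ (b * expr_size e2) \<le> 2 ^ ?s"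
    by (auto intro!: power_increasing)
  have v: "val e1 m \<le> 2 ^ ?s" "val e2 m \<le> 2 ^ ?s"
    using 1 p by linarith+
  have "val (Bin f e1 e2) m \<le> 2 ^ ?s * 2"
  proof (cases f)
    case Times
    have "val e1 m * val e2 m \<le> 2 ^ (b * expr_size e1) * 2 ^ (b * expr_size e2)"
      using 1 by (rule mult_mono) auto
    then show ?thesis using Times by (simp add: algebra_simps power_add)
  next
    case Div
    have "val e1 m div val e2 m \<le> val e1 m" by (rule div_le_dividend)
    also have "\<dots> \<le> 2 ^ ?s" using v by linarith
    finally show ?thesis using Div by simp
  qed (use v in auto)
  also have "\<dots> = 2 ^ (?s + 1)" by simp
  also have "\<dots> \<le> 2 ^ (b * expr_size (Bin f e1 e2))"
    using assms(3) by (intro power_increasing) (auto simp: algebra_simps)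
  finally show ?case .
qed

lemma bit_length_val_le:
  assumes "bounded b m" "expr_consts_le (2 ^ b) e" "1 \<le> b"
  shows "bit_length (val e m) \<le> b * (2 * expr_size e)"
proof -
  have "bit_length (val e m) \<le> b * expr_size e + 1"
    by (rule bit_length_le[OF val_le[OF assms]])
  also have "\<dots> \<le> b * (2 * expr_size e)"
    using assms(3) expr_size_pos[of e] mult_le_mono[of 1 b 1 "expr_size e"] by simp
  finally show ?thesis .
qed

lemma cost_le:
  assumes "bounded b m" "expr_consts_le (2 ^ b) e" "1 \<le> b"
  shows "cost e m \<le> b * expr_cost e"
  using assms(2)
proof (induction e)
  case (Const n)
  then show ?case
    using bit_length_val_le[OF assms(1), of "Const n"] assms(3) by simp
next
  case (Mem e)
  have "bit_length (m (val e m)) \<le> b + 1"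
    using assms(1) by (intro bit_length_le) (simp add: bounded_def)
  then show ?case using Mem assms(3) by (simp add: algebra_simps)
next
  case (Bin f e1 e2)
  then show ?case
    using bit_length_val_le[OF assms(1), of "Bin f e1 e2"] assms(3) by (simp add: algebra_simps)
qed

text \<open>Total correctness with the running time built in. Boundedness of the memory is assumed
  and re-established inside the definition, so that specifications have to speak about contents
  only; time does not occur in postconditions because \<open>steps\<close> depends on the program
  and on Z alone.\<close>

definition wp :: "nat \<Rightarrow> nat \<Rightarrow> prog \<Rightarrow> (memory \<Rightarrow> bool) \<Rightarrow> memory \<Rightarrow> bool" where
  "wp b Z P Q m \<longleftrightarrow> (1 \<le> b \<and> consts_le (2 ^ b) P \<and> bounded b m \<longrightarrow>
     (\<exists>\<tau> m'. exec P m \<tau> m' \<and> \<tau> \<le> b * steps Z P \<and> bounded b m' \<and> Q m'))"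

lemma wp_mono:
  assumes "wp b Z P Q m" "\<And>m. bounded b m \<Longrightarrow> Q m \<Longrightarrow> R m"
  shows "wp b Z P R m"
  using assms unfolding wp_def by blast

lemma wp_Skip: "Q m \<Longrightarrow> wp b Z Skip Q m"
  unfolding wp_def using exec.Skip by fastforce

lemma wp_Assign:
  assumes "bounded b m \<Longrightarrow> val e m \<le> 2 ^ b" "Q (m(val a m := val e m))"
  shows "wp b Z (Assign a e) Q m"
  unfolding wp_def
proof (intro impI exI conjI)
  assume *: "1 \<le> b \<and> consts_le (2 ^ b) (Assign a e) \<and> bounded b m"
  show "exec (Assign a e) m (cost a m + cost e m) (m(val a m := val e m))"
    by (rule exec.Assign)
  show "cost a m + cost e m \<le> b * steps Z (Assign a e)"
    using cost_le[of b m a] cost_le[of b m e] * by (simp add: algebra_simps)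
  show "bounded b (m(val a m := val e m))"
    using * assms(1) by (auto simp: bounded_def)
qed (rule assms)

lemma wp_Seq:
  assumes "wp b Z P (wp b Z Q R) m"
  shows "wp b Z (Seq P Q) R m"
  unfolding wp_def
proof (intro impI)
  assume *: "1 \<le> b \<and> consts_le (2 ^ b) (Seq P Q) \<and> bounded b m"
  then obtain \<tau>1 m1 where 1: "exec P m \<tau>1 m1" "\<tau>1 \<le> b * steps Z P" "bounded b m1" "wp b Z Q R m1"
    using assms unfolding wp_def[of b Z P] by auto
  with * obtain \<tau>2 m2 where 2: "exec Q m1 \<tau>2 m2" "\<tau>2 \<le> b * steps Z Q" "bounded b m2" "R m2"
    unfolding wp_def by auto
  show "\<exists>\<tau> m'. exec (Seq P Q) m \<tau> m' \<and> \<tau> \<le> b * steps Z (Seq P Q) \<and> bounded b m' \<and> R m'"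
    using exec.Seq[OF 1(1) 2(1)] 1(2) 2(2-) by (fastforce simp: algebra_simps)
qed

lemma wp_If:
  assumes "val e m \<noteq> 0 \<Longrightarrow> wp b Z P R m" "val e m = 0 \<Longrightarrow> wp b Z Q R m"
  shows "wp b Z (If e P Q) R m"
  unfolding wp_def
proof (intro impI)
  assume *: "1 \<le> b \<and> consts_le (2 ^ b) (If e P Q) \<and> bounded b m"
  then have c: "cost e m \<le> b * expr_cost e" by (intro cost_le) auto
  let ?P = "if val e m \<noteq> 0 then P else Q"
  have "wp b Z ?P R m" using assms by auto
  then obtain \<tau> m' where t: "exec ?P m \<tau> m'" "\<tau> \<le> b * steps Z ?P" "bounded b m'" "R m'"
    using * unfolding wp_def by (auto split: if_splits)
  have "exec (If e P Q) m (cost e m + \<tau>) m'"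
    using t(1) by (auto split: if_splits intro: exec.intros)
  moreover have "cost e m + \<tau> \<le> b * steps Z (If e P Q)"
    using c t(2) by (auto simp: algebra_simps split: if_splits)
  ultimately show "\<exists>\<tau> m'. exec (If e P Q) m \<tau> m' \<and> \<tau> \<le> b * steps Z (If e P Q) \<and> bounded b m' \<and> R m'"
    using t by blast
qed

text \<open>The invariant is indexed by the number of completed iterations; knowing in advance that
  there are n of them yields termination and the time bound at once.\<close>

lemma wp_While:
  assumes "n \<le> Z" "I 0 m"
    and step: "\<And>i m. i < n \<Longrightarrow> I i m \<Longrightarrow> val e m \<noteq> 0 \<and> wp b Z P (I (Suc i)) m"
    and final: "\<And>m. I n m \<Longrightarrow> val e m = 0 \<and> Q m"
  shows "wp b Z (While e P) Q m"
  unfolding wp_def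
proof (intro impI)
  assume *: "1 \<le> b \<and> consts_le (2 ^ b) (While e P) \<and> bounded b m"
  \<comment> \<open>Induction on the number j of iterations still to come, so that the first of them
    is peeled off.\<close>
  have "\<exists>\<tau> m'. exec (While e P) m \<tau> m' \<and> \<tau> \<le> b * (expr_cost e + j * (expr_cost e + steps Z P))
        \<and> bounded b m' \<and> Q m'"
    if "j \<le> n" "I (n - j) m" "bounded b m" for j m
    using that
  proof (induction j arbitrary: m)
    case 0
    then have "val e m = 0" "Q m" using final by auto
    moreover have "cost e m \<le> b * expr_cost e" using * 0 by (intro cost_le) auto
    ultimately show ?case
      using exec.WhileFalse[of e m P] 0 by (intro exI[of _ "cost e m"] exI[of _ m]) auto
  next
    case (Suc j)
    have v: "val e m \<noteq> 0" "wp b Z P (I (Suc (n - Suc j))) m"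
      using step[of "n - Suc j" m] Suc.prems by auto
    moreover have "Suc (n - Suc j) = n - j" using Suc.prems by auto
    ultimately obtain \<tau>1 m1 where 1: "exec P m \<tau>1 m1" "\<tau>1 \<le> b * steps Z P" "bounded b m1" "I (n - j) m1"
      using * Suc.prems unfolding wp_def by auto
    then obtain \<tau>2 m2 where 2: "exec (While e P) m1 \<tau>2 m2"
        "\<tau>2 \<le> b * (expr_cost e + j * (expr_cost e + steps Z P))" "bounded b m2" "Q m2"
      using Suc.IH[of m1] Suc.prems by auto
    have "cost e m \<le> b * expr_cost e" using * Suc.prems by (intro cost_le) auto
    then have "cost e m + \<tau>1 + \<tau>2 \<le> b * (expr_cost e + Suc j * (expr_cost e + steps Z P))"
      using 1(2) 2(2) by (simp add: algebra_simps)
    then show ?case using exec.WhileTrue[OF v(1) 1(1) 2(1)] 2 by blast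
  qed
  from this[of n m] * assms(2)
  obtain \<tau> m' where t: "exec (While e P) m \<tau> m'" "\<tau> \<le> b * (expr_cost e + n * (expr_cost e + steps Z P))"
      "bounded b m'" "Q m'" by auto
  have "b * (expr_cost e + n * (expr_cost e + steps Z P)) \<le> b * steps Z (While e P)"
    using assms(1) by (simp add: mult_le_mono)
  then show "\<exists>\<tau> m'. exec (While e P) m \<tau> m' \<and> \<tau> \<le> b * steps Z (While e P) \<and> bounded b m' \<and> Q m'"
    using t by (meson order_trans)
qed

section \<open>Arrays above the input, and relocation of programs\<close>

text \<open>The set \<open>X c\<close> has its mask \<open>set_encode (X c)\<close> in entry \<open>c\<close> of \<open>Masks\<close>, but its weight in entry
  \<open>set_encode (X c)\<close> of \<open>Weights\<close>. Only entry \<open>0\<close> of the arrays \<open>RU\<close>, \<open>RF\<close>, ... is used.\<close>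

datatype arr = Masks | Sizes | Weights | OvMem
  | RU | RF | RT | RS | RN | RI | RC | RJ | RPow | RAcc | RLen | RBit | RPos | RThr

definition arrs :: "arr list" where
  "arrs = [Masks, Sizes, Weights, OvMem, RU, RF, RT, RS, RN, RI, RC, RJ, RPow, RAcc, RLen, RBit, RPos, RThr]"

primrec arr_num :: "arr \<Rightarrow> nat" where
  "arr_num Masks = 0"
| "arr_num Sizes = 1"
| "arr_num Weights = 2"
| "arr_num OvMem = 3"
| "arr_num RU = 4"
| "arr_num RF = 5"
| "arr_num RT = 6"
| "arr_num RS = 7"
| "arr_num RN = 8"
| "arr_num RI = 9"
| "arr_num RC = 10"
| "arr_num RJ = 11"
| "arr_num RPow = 12"
| "arr_num RAcc = 13"
| "arr_num RLen = 14"
| "arr_num RBit = 15"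
| "arr_num RPos = 16"
| "arr_num RThr = 17"

lemma arr_num_less: "arr_num r < 18"
  by (cases r) auto

lemma arrs_nth_arr_num: "arrs ! arr_num r = r"
  by (cases r) (auto simp: arrs_def eval_nat_numeral)

lemma arr_num_arrs_nth:
  assumes "i < 18"
  shows "arr_num (arrs ! i) = i"
proof -
  have "map arr_num arrs = [0..<18]" by (simp add: arrs_def upt_rec)
  then have "map arr_num arrs ! i = [0..<18] ! i" by (rule arg_cong)
  moreover have "length arrs = 18" by (simp add: arrs_def)
  ultimately show ?thesis using assms by (simp del: upt_Suc)
qed

lemma arrs_nth_eq_iff: "i < 18 \<Longrightarrow> arrs ! i = r \<longleftrightarrow> i = arr_num r"
  using arrs_nth_arr_num arr_num_arrs_nth by metis

section \<open>A language of named arrays and its translation into addresses\<close>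

datatype aexp = Num nat | Cell arr aexp | Op binop aexp aexp

abbreviation Reg :: "arr \<Rightarrow> aexp" where
  "Reg r \<equiv> Cell r (Num 0)"

abbreviation Add (infixl "\<oplus>" 65) where "a \<oplus> b \<equiv> Op Plus a b"
abbreviation Sub (infixl "\<ominus>" 65) where "a \<ominus> b \<equiv> Op Minus a b"
abbreviation Mul (infixl "\<otimes>" 70) where "a \<otimes> b \<equiv> Op Times a b"
abbreviation Quot (infixl "\<oslash>" 70) where "a \<oslash> b \<equiv> Op Div a b"

type_synonym store = "arr \<Rightarrow> nat \<Rightarrow> nat"

fun aval :: "aexp \<Rightarrow> store \<Rightarrow> nat" where
  "aval (Num n) \<sigma> = n"
| "aval (Cell r e) \<sigma> = \<sigma> r (aval e \<sigma>)"
| "aval (Op g e1 e2) \<sigma> = binop_val g (aval e1 \<sigma>) (aval e2 \<sigma>)"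

text \<open>With \<open>u\<close> and \<open>f\<close> in cells \<open>0\<close> and \<open>1\<close>, which are not overwritten before the end, this
  is the first cell beyond any input for Set Cover with \<open>t \<le> f\<close>.\<close>

definition base_expr :: expr where
  "base_expr = Bin Plus (Bin Plus (Const 2) (Bin Times (Mem (Const 0)) (Mem (Const 1)))) (Mem (Const 1))"

text \<open>The arrays are interleaved above the input, so that each of them is unbounded.\<close>

definition address :: "arr \<Rightarrow> expr \<Rightarrow> expr" where
  "address r e = Bin Plus (Bin Plus base_expr (Const (arr_num r))) (Bin Times (Const 18) e)"

fun compile :: "aexp \<Rightarrow> expr" where
  "compile (Num n) = Const n"
| "compile (Cell r e) = Mem (address r (compile e))"
| "compile (Op g e1 e2) = Bin g (compile e1) (compile e2)"

definition assign :: "arr \<Rightarrow> aexp \<Rightarrow> aexp \<Rightarrow> prog" where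
  "assign r i e = Assign (address r (compile i)) (compile e)"

text \<open>The only access to cells outside the arrays. Both \<open>assign\<close> and
  \<open>read_input\<close> write to arrays alone, so the input survives and every phase can read it
  again.\<close>

definition read_input :: "arr \<Rightarrow> aexp \<Rightarrow> prog" where
  "read_input r e = Assign (address r (Const 0)) (Mem (compile e))"

abbreviation set_reg :: "arr \<Rightarrow> aexp \<Rightarrow> prog" where
  "set_reg r e \<equiv> assign r (Num 0) e"

definition cond :: "aexp \<Rightarrow> prog \<Rightarrow> prog \<Rightarrow> prog" where
  "cond e P Q = If (compile e) P Q"

text \<open>By truncated subtraction the condition holds exactly while the counter is below the
  bound. The bound is evaluated anew before each iteration, so it must not change in the body; this
  is why a growing list is traversed up to a copy of its old length.\<close>

definition for_loop :: "arr \<Rightarrow> aexp \<Rightarrow> prog \<Rightarrow> prog" where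
  "for_loop r e P = Seq (set_reg r (Num 0))
     (While (compile (e \<ominus> Reg r)) (Seq P (set_reg r (Reg r \<oplus> Num 1))))"

definition upd :: "store \<Rightarrow> arr \<Rightarrow> nat \<Rightarrow> nat \<Rightarrow> store" where
  "upd \<sigma> r i v = \<sigma>(r := (\<sigma> r)(i := v))"

lemma upd_apply [simp]: "upd \<sigma> r i v r' = (if r' = r then (\<sigma> r)(i := v) else \<sigma> r')"
  by (simp add: upd_def)

locale layout =
  fixes u f :: nat and inp :: memory
  assumes inp_0: "inp 0 = u" and inp_1: "inp 1 = f"
begin

definition base :: nat where
  "base = 2 + u * f + f"

text \<open>Quotient and remainder modulo 18, the number of arrays, recover the entry and the array
  from an address. Since the cells below \<open>base\<close> are fixed, the intact input needs no
  invariant: every memory of the form \<open>mem \<sigma>\<close> contains it.\<close>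

definition mem :: "store \<Rightarrow> memory" where
  "mem \<sigma> a = (if a < base then inp a else \<sigma> (arrs ! ((a - base) mod 18)) ((a - base) div 18))"

lemma mem_low [simp]: "mem \<sigma> 0 = u" "mem \<sigma> (Suc 0) = f"
  using inp_0 inp_1 by (auto simp: mem_def base_def)

lemma val_base_expr [simp]: "val base_expr (mem \<sigma>) = base"
  by (simp add: base_expr_def base_def)

lemma val_address: "val (address r e) (mem \<sigma>) = base + arr_num r + 18 * val e (mem \<sigma>)"
  by (simp add: address_def)

lemma mem_cell [simp]: "mem \<sigma> (base + arr_num r + 18 * i) = \<sigma> r i"
  using arr_num_less[of r] by (simp add: mem_def arrs_nth_arr_num)

lemma mem_upd: "(mem \<sigma>)(base + arr_num r + 18 * i := v) = mem (upd \<sigma> r i v)"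
proof
  fix a
  show "((mem \<sigma>)(base + arr_num r + 18 * i := v)) a = mem (upd \<sigma> r i v) a"
  proof (cases "a < base")
    case True
    then show ?thesis by (simp add: mem_def)
  next
    case False
    have eq: "a = base + arr_num r + 18 * i \<longleftrightarrow>
        arr_num r = (a - base) mod 18 \<and> i = (a - base) div 18"
      using False arr_num_less[of r] by auto
    show ?thesis
      using False arrs_nth_eq_iff[of "(a - base) mod 18" r]
      unfolding fun_upd_apply eq by (auto simp: mem_def)
  qed
qed

lemma val_compile [simp]: "val (compile e) (mem \<sigma>) = aval e \<sigma>"
  by (induction e) (auto simp: val_address)

definition hoare :: "nat \<Rightarrow> nat \<Rightarrow> prog \<Rightarrow> (store \<Rightarrow> bool) \<Rightarrow> store \<Rightarrow> bool" where
  "hoare b Z P Q \<sigma> \<longleftrightarrow> wp b Z P (\<lambda>m. \<exists>\<sigma>'. m = mem \<sigma>' \<and> Q \<sigma>') (mem \<sigma>)"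

lemma hoare_mono: "hoare b Z P Q \<sigma> \<Longrightarrow> (\<And>\<sigma>. Q \<sigma> \<Longrightarrow> R \<sigma>) \<Longrightarrow> hoare b Z P R \<sigma>"
  unfolding hoare_def by (erule wp_mono) blast

lemma hoare_Skip: "Q \<sigma> \<Longrightarrow> hoare b Z Skip Q \<sigma>"
  unfolding hoare_def by (rule wp_Skip) blast

lemma bounded_mem: "bounded b (mem \<sigma>) \<Longrightarrow> \<sigma> r i \<le> 2 ^ b"
  unfolding bounded_def using mem_cell by metis

lemma hoare_assign:
  assumes "(\<And>r i. \<sigma> r i \<le> 2 ^ b) \<Longrightarrow> aval e \<sigma> \<le> 2 ^ b" "Q (upd \<sigma> r (aval i \<sigma>) (aval e \<sigma>))"
  shows "hoare b Z (assign r i e) Q \<sigma>"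
  unfolding hoare_def assign_def
  by (rule wp_Assign) (use assms bounded_mem[of b \<sigma>] mem_upd in \<open>auto simp: val_address\<close>)

lemma hoare_read_input:
  assumes "aval e \<sigma> < base" "Q (upd \<sigma> r 0 (inp (aval e \<sigma>)))"
  shows "hoare b Z (read_input r e) Q \<sigma>"
proof -
  have *: "mem \<sigma> (aval e \<sigma>) = inp (aval e \<sigma>)" using assms(1) by (simp add: mem_def)
  show ?thesis
    unfolding hoare_def read_input_def
  proof (rule wp_Assign)
    assume "bounded b (mem \<sigma>)"
    then show "val (Mem (compile e)) (mem \<sigma>) \<le> 2 ^ b" unfolding bounded_def by simp
  next
    show "\<exists>\<sigma>'. (mem \<sigma>)(val (address r (Const 0)) (mem \<sigma>) := val (Mem (compile e)) (mem \<sigma>)) = mem \<sigma>' \<and> Q \<sigma>'"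
      using * assms(2) mem_upd[of \<sigma> r 0] by (auto simp: val_address)
  qed
qed

lemma hoare_Seq:
  assumes "hoare b Z P (hoare b Z Q R) \<sigma>"
  shows "hoare b Z (Seq P Q) R \<sigma>"
  unfolding hoare_def
proof (rule wp_Seq)
  show "wp b Z P (wp b Z Q (\<lambda>m. \<exists>\<sigma>'. m = mem \<sigma>' \<and> R \<sigma>')) (mem \<sigma>)"
    using assms unfolding hoare_def by (rule wp_mono) auto
qed

lemma hoare_cond:
  assumes "aval e \<sigma> \<noteq> 0 \<Longrightarrow> hoare b Z P R \<sigma>" "aval e \<sigma> = 0 \<Longrightarrow> hoare b Z Q R \<sigma>"
  shows "hoare b Z (cond e P Q) R \<sigma>"
  using assms unfolding hoare_def cond_def by (intro wp_If) auto

lemma hoare_for: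
  assumes n: "n \<le> Z" "n \<le> 2 ^ b"
    and init: "I 0 (upd \<sigma> r 0 0)"
    and bound: "\<And>i \<sigma>. i \<le> n \<Longrightarrow> I i \<sigma> \<Longrightarrow> aval e \<sigma> = n"
    and counter: "\<And>i \<sigma>. i \<le> n \<Longrightarrow> I i \<sigma> \<Longrightarrow> \<sigma> r 0 = i"
    and step: "\<And>i \<sigma>. i < n \<Longrightarrow> I i \<sigma> \<Longrightarrow>
      hoare b Z P (\<lambda>\<sigma>'. \<sigma>' r 0 = i \<and> I (Suc i) (upd \<sigma>' r 0 (Suc i))) \<sigma>"
    and final: "\<And>\<sigma>. I n \<sigma> \<Longrightarrow> Q \<sigma>"
  shows "hoare b Z (for_loop r e P) Q \<sigma>"
  unfolding for_loop_def
proof (intro hoare_Seq hoare_assign)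
  show "hoare b Z (While (compile (e \<ominus> Reg r)) (Seq P (set_reg r (Reg r \<oplus> Num 1)))) Q
     (upd \<sigma> r (aval (Num 0) \<sigma>) (aval (Num 0) \<sigma>))"
    unfolding hoare_def
  proof (rule wp_While[where n = n and I = "\<lambda>i m. \<exists>\<sigma>'. m = mem \<sigma>' \<and> I i \<sigma>'"], goal_cases)
    case (3 i m)
    then obtain \<sigma>' where s: "m = mem \<sigma>'" "I i \<sigma>'" by blast
    have "hoare b Z (Seq P (set_reg r (Reg r \<oplus> Num 1))) (I (Suc i)) \<sigma>'"
      by (rule hoare_Seq, rule hoare_mono[OF step[OF 3(1) s(2)]], rule hoare_assign)
        (use n 3 in auto)
    moreover have "val (compile (e \<ominus> Reg r)) m = n - i"
      using s bound[of i \<sigma>'] counter[of i \<sigma>'] 3 by (simp del: compile.simps)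
    ultimately show ?case
      using s 3 unfolding hoare_def by (simp del: compile.simps)
  next
    case (4 m)
    then obtain \<sigma>' where s: "m = mem \<sigma>'" "I n \<sigma>'" by blast
    then show ?case using bound[of n \<sigma>'] counter[of n \<sigma>'] final by (auto simp del: compile.simps)
  qed (use n init in auto)
qed auto

end

section \<open>Simulation of an arbitrary program inside one array\<close>

fun relocate_expr :: "arr \<Rightarrow> expr \<Rightarrow> expr" where
  "relocate_expr r (Const n) = Const n"
| "relocate_expr r (Mem e) = Mem (address r (relocate_expr r e))"
| "relocate_expr r (Bin g e1 e2) = Bin g (relocate_expr r e1) (relocate_expr r e2)"

text \<open>Cell i of the simulated machine is entry i of the array. Addresses are translated at run
  time because of indirect addressing, whereas values are left as they are.\<close>

fun relocate :: "arr \<Rightarrow> prog \<Rightarrow> prog" where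
  "relocate r Skip = Skip"
| "relocate r (Assign a e) = Assign (address r (relocate_expr r a)) (relocate_expr r e)"
| "relocate r (Seq P Q) = Seq (relocate r P) (relocate r Q)"
| "relocate r (If e P Q) = If (relocate_expr r e) (relocate r P) (relocate r Q)"
| "relocate r (While e P) = While (relocate_expr r e) (relocate r P)"

context layout
begin

lemma val_relocate [simp]: "val (relocate_expr r e) (mem \<sigma>) = val e (\<sigma> r)"
  by (induction e) (auto simp: val_address)

text \<open>The price of one address computation apart from the entry number: evaluating
  \<open>base_expr\<close>, the digits contributed by constants up to 18, at most five each, and two
  sums that contain \<open>base\<close>. It depends on the input only, not on the store, and so
  becomes a constant factor of the simulation.\<close>

definition overhead :: nat where
  "overhead = cost base_expr inp + 25 + 2 * bit_length (base + 18)"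

lemma cost_base_expr: "cost base_expr (mem \<sigma>) = cost base_expr inp"
  using inp_0 inp_1 by (simp add: base_expr_def)

lemma bit_length_small: "n \<le> 18 \<Longrightarrow> bit_length n \<le> 5"
  by (rule bit_length_lt) auto

lemma cost_address:
  "cost (address r e) (mem \<sigma>) \<le> cost e (mem \<sigma>) + 2 * bit_length (val e (mem \<sigma>)) + overhead"
proof -
  let ?v = "val e (mem \<sigma>)" and ?c = "base + arr_num r"
  have "bit_length (18 * ?v) \<le> 5 + bit_length ?v"
    using bit_length_mult[of 18 ?v] bit_length_small[of 18] by linarith
  moreover have "bit_length (?c + 18 * ?v) \<le> bit_length ?c + bit_length (18 * ?v)"
    by (rule bit_length_add)
  moreover have "bit_length ?c \<le> bit_length (base + 18)"
    using arr_num_less[of r] by (intro bit_length_mono) auto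
  moreover have "bit_length (arr_num r) \<le> 5" "bit_length 18 \<le> 5"
    using arr_num_less[of r] by (auto intro: bit_length_small)
  ultimately show ?thesis
    unfolding address_def overhead_def cost.simps cost_base_expr val.simps binop_val.simps
      val_base_expr by linarith
qed

text \<open>The second summand on the left pays for the address computation in an enclosing \<open>Mem\<close>.\<close>

lemma cost_relocate:
  "cost (relocate_expr r e) (mem \<sigma>) + 2 * bit_length (val e (\<sigma> r)) \<le> (overhead + 3) * cost e (\<sigma> r)"
proof (induction e)
  case (Const n)
  then show ?case by (simp add: algebra_simps)
next
  case (Mem e)
  let ?l = "bit_length (\<sigma> r (val e (\<sigma> r)))"
  have "overhead + 3 * ?l \<le> (overhead + 3) * ?l"
    using bit_length_ge_1[of "\<sigma> r (val e (\<sigma> r))"] by (simp add: algebra_simps)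
  then show ?case
    using Mem cost_address[of r "relocate_expr r e" \<sigma>]
    by (simp add: val_address distrib_left)
next
  case (Bin g e1 e2)
  then show ?case by (simp add: algebra_simps)
qed

lemma cost_ge_1: "1 \<le> cost e m"
  by (induction e) (use bit_length_ge_1 in \<open>auto intro: trans_le_add2\<close>)

text \<open>An expression becomes more expensive by the factor \<open>overhead + 3\<close>. The
  factor 2 is due to assignments, whose target needs one more address computation; this costs at
  most as much again, because every expression has cost at least 1.\<close>

lemma exec_relocate:
  assumes "exec P m \<tau> m'" "\<sigma> r = m"
  shows "\<exists>\<tau>'. exec (relocate r P) (mem \<sigma>) \<tau>' (mem (\<sigma>(r := m'))) \<and> \<tau>' \<le> 2 * (overhead + 3) * \<tau>"
  using assms
proof (induction arbitrary: \<sigma>)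
  let ?k = "overhead + 3"
  have c: "cost (relocate_expr r e) (mem \<sigma>) \<le> 2 * ?k * cost e (\<sigma> r)" for e \<sigma>
    using cost_relocate[of r e \<sigma>] unfolding mult.assoc by linarith
  {
    case (Skip m)
    then have "\<sigma>(r := m) = \<sigma>" by auto
    then show ?case using exec.Skip by fastforce
  next
    case (Assign a e m)
    have "cost (address r (relocate_expr r a)) (mem \<sigma>) \<le> ?k * cost a m + overhead"
      using cost_address[of r "relocate_expr r a" \<sigma>] cost_relocate[of r a \<sigma>] Assign by simp
    moreover have "overhead \<le> ?k * cost a m"
      using mult_le_mono[OF le_add1[of overhead 3] cost_ge_1[of a m]] by simp
    moreover have "cost (relocate_expr r e) (mem \<sigma>) \<le> ?k * cost e m"
      using cost_relocate[of r e \<sigma>] Assign by simp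
    ultimately have "cost (address r (relocate_expr r a)) (mem \<sigma>) + cost (relocate_expr r e) (mem \<sigma>)
        \<le> 2 * ?k * (cost a m + cost e m)"
      by (simp add: algebra_simps)
    moreover have "(mem \<sigma>)(val (address r (relocate_expr r a)) (mem \<sigma>) := val (relocate_expr r e) (mem \<sigma>))
        = mem (\<sigma>(r := m(val a m := val e m)))"
      using Assign by (simp add: val_address mem_upd) (simp add: upd_def)
    ultimately show ?case
      using exec.Assign[of "address r (relocate_expr r a)" "relocate_expr r e" "mem \<sigma>"]
      unfolding relocate.simps by metis
  next
    case (Seq P m \<tau>1 m1 Q \<tau>2 m2)
    obtain t1 where 1: "exec (relocate r P) (mem \<sigma>) t1 (mem (\<sigma>(r := m1)))" "t1 \<le> 2 * ?k * \<tau>1"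
      using Seq by blast
    obtain t2 where 2: "exec (relocate r Q) (mem (\<sigma>(r := m1))) t2 (mem (\<sigma>(r := m2)))" "t2 \<le> 2 * ?k * \<tau>2"
      using Seq.IH(2)[of "\<sigma>(r := m1)"] unfolding fun_upd_same fun_upd_upd by blast
    have "t1 + t2 \<le> 2 * ?k * (\<tau>1 + \<tau>2)" using 1(2) 2(2) by (simp add: distrib_left)
    then show ?case using exec.Seq[OF 1(1) 2(1)] unfolding relocate.simps by blast
  next
    case (IfTrue e m P \<tau> m' Q)
    obtain t where t: "exec (relocate r P) (mem \<sigma>) t (mem (\<sigma>(r := m')))" "t \<le> 2 * ?k * \<tau>"
      using IfTrue by blast
    have "exec (relocate r (If e P Q)) (mem \<sigma>) (cost (relocate_expr r e) (mem \<sigma>) + t) (mem (\<sigma>(r := m')))"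
      using IfTrue t by (auto intro: exec.IfTrue)
    moreover have "cost (relocate_expr r e) (mem \<sigma>) + t \<le> 2 * ?k * (cost e m + \<tau>)"
      using c[of e \<sigma>] t(2) IfTrue.prems by (simp add: distrib_left)
    ultimately show ?case by blast
  next
    case (IfFalse e m Q \<tau> m' P)
    obtain t where t: "exec (relocate r Q) (mem \<sigma>) t (mem (\<sigma>(r := m')))" "t \<le> 2 * ?k * \<tau>"
      using IfFalse by blast
    have "exec (relocate r (If e P Q)) (mem \<sigma>) (cost (relocate_expr r e) (mem \<sigma>) + t) (mem (\<sigma>(r := m')))"
      using IfFalse t by (auto intro: exec.IfFalse)
    moreover have "cost (relocate_expr r e) (mem \<sigma>) + t \<le> 2 * ?k * (cost e m + \<tau>)"
      using c[of e \<sigma>] t(2) IfFalse.prems by (simp add: distrib_left)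
    ultimately show ?case by blast
  next
    case (WhileFalse e m P)
    then have "\<sigma>(r := m) = \<sigma>" by auto
    moreover have "exec (relocate r (While e P)) (mem \<sigma>) (cost (relocate_expr r e) (mem \<sigma>)) (mem \<sigma>)"
      using WhileFalse by (auto intro: exec.WhileFalse)
    moreover have "cost (relocate_expr r e) (mem \<sigma>) \<le> 2 * ?k * cost e m"
      using c[of e \<sigma>] WhileFalse by simp
    ultimately show ?case by auto
  next
    case (WhileTrue e m P \<tau>1 m1 \<tau>2 m2)
    obtain t1 where 1: "exec (relocate r P) (mem \<sigma>) t1 (mem (\<sigma>(r := m1)))" "t1 \<le> 2 * ?k * \<tau>1"
      using WhileTrue by blast
    obtain t2 where 2: "exec (relocate r (While e P)) (mem (\<sigma>(r := m1))) t2 (mem (\<sigma>(r := m2)))" "t2 \<le> 2 * ?k * \<tau>2"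
      using WhileTrue.IH(2)[of "\<sigma>(r := m1)"] unfolding fun_upd_same fun_upd_upd by blast
    have "exec (relocate r (While e P)) (mem \<sigma>) (cost (relocate_expr r e) (mem \<sigma>) + t1 + t2) (mem (\<sigma>(r := m2)))"
      using WhileTrue 1 2 by (auto intro: exec.WhileTrue)
    moreover have "cost (relocate_expr r e) (mem \<sigma>) + t1 + t2 \<le> 2 * ?k * (cost e m + \<tau>1 + \<tau>2)"
      using c[of e \<sigma>] 1(2) 2(2) WhileTrue.prems by (simp add: distrib_left)
    ultimately show ?case by blast
  }
qed

end

section \<open>Covering by a bounded number of parts\<close>

text \<open>The number of sets among the first \<open>i\<close> that are needed to cover \<open>X\<close>, with \<open>f + 1\<close> for infinity.\<close>

primrec weight :: "(nat \<Rightarrow> nat set) \<Rightarrow> nat \<Rightarrow> nat \<Rightarrow> nat set \<Rightarrow> nat" where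
  "weight T f 0 X = (if X = {} then 0 else f + 1)"
| "weight T f (Suc i) X = min (weight T f i X) (1 + weight T f i (X - T i))"

lemma weight_le: "weight T f i X \<le> f + 1"
  by (induction i arbitrary: X) (auto intro: min.coboundedI1)

lemma weight_empty [simp]: "weight T f i {} = 0"
  by (induction i) auto

text \<open>Hence the table of weights can be updated in place, in any order of the sets.\<close>

lemma weight_Suc_diff: "weight T f (Suc i) (X - T i) = weight T f i (X - T i)"
  by simp

text \<open>Either the last set is used, which leaves \<open>X - T i\<close> to one set less, or it
  is not. The restriction to q \<le> f keeps q below the value f + 1 that stands for
  infinity.\<close>

lemma weight_le_iff:
  assumes "q \<le> f"
  shows "weight T f i X \<le> q \<longleftrightarrow> (\<exists>I \<subseteq> {..<i}. card I \<le> q \<and> X \<subseteq> \<Union>(T ` I))"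
  using assms
proof (induction i arbitrary: X q)
  case 0
  then show ?case by auto
next
  case (Suc i)
  show ?case
  proof
    assume "weight T f (Suc i) X \<le> q"
    then consider "weight T f i X \<le> q" | q' where "q = Suc q'" "weight T f i (X - T i) \<le> q'"
      unfolding weight.simps min_le_iff_disj by (metis Suc_le_D Suc_le_mono plus_1_eq_Suc)
    then show "\<exists>I \<subseteq> {..<Suc i}. card I \<le> q \<and> X \<subseteq> \<Union>(T ` I)"
    proof cases
      case 1
      then obtain I where "I \<subseteq> {..<i}" "card I \<le> q" "X \<subseteq> \<Union>(T ` I)"
        using Suc.IH[of q X] Suc.prems by blast
      then show ?thesis by (intro exI[of _ I]) auto
    next
      case 2
      then obtain I where I: "I \<subseteq> {..<i}" "card I \<le> q'" "X - T i \<subseteq> \<Union>(T ` I)"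
        using Suc.IH[of q' "X - T i"] Suc.prems by auto
      have "card (insert i I) \<le> q"
        using I 2 finite_subset[OF I(1)] by (simp add: card_insert_if)
      then show ?thesis using I by (intro exI[of _ "insert i I"]) auto
    qed
  next
    assume "\<exists>I \<subseteq> {..<Suc i}. card I \<le> q \<and> X \<subseteq> \<Union>(T ` I)"
    then obtain I where I: "I \<subseteq> {..<Suc i}" "card I \<le> q" "X \<subseteq> \<Union>(T ` I)" by blast
    have fin: "finite I" using I finite_subset by blast
    show "weight T f (Suc i) X \<le> q"
    proof (cases "i \<in> I")
      case True
      have "card (I - {i}) = card I - 1" "0 < card I" using True fin by (auto simp: card_gt_0_iff)
      then have "card (I - {i}) \<le> q - 1" "0 < q" using I by auto
      moreover have "I - {i} \<subseteq> {..<i}" "X - T i \<subseteq> \<Union>(T ` (I - {i}))" using I by auto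
      ultimately have "weight T f i (X - T i) \<le> q - 1"
        using Suc.IH[of "q - 1" "X - T i"] Suc.prems by auto
      then show ?thesis using \<open>0 < q\<close> by (simp add: min_le_iff_disj) linarith
    next
      case False
      then have "I \<subseteq> {..<i}" using I by (auto simp: less_Suc_eq)
      then have "weight T f i X \<le> q" using Suc.IH[of q X] Suc.prems I by blast
      then show ?thesis by (simp add: min_le_iff_disj)
    qed
  qed
qed

section \<open>Dealing a cover to groups\<close>

definition small_sets :: "nat \<Rightarrow> nat \<Rightarrow> nat set set" where
  "small_sets u s = {X. X \<subseteq> {..<u} \<and> card X \<le> s}"

text \<open>Members of size at most s are small sets already. Leaving them out makes the two
  collections disjoint, so that all candidates can be listed without repetition.\<close>

definition large_sets :: "(nat \<Rightarrow> nat set) \<Rightarrow> nat \<Rightarrow> nat \<Rightarrow> nat set set" where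
  "large_sets T f s = {X. \<exists>i<f. X = T i \<and> s < card X}"

definition part_weight :: "(nat \<Rightarrow> nat set) \<Rightarrow> nat \<Rightarrow> nat \<Rightarrow> nat set \<Rightarrow> nat" where
  "part_weight T f s X = (if card X \<le> s then weight T f f X else 1)"

text \<open>A cover by \<open>t\<close> sets, listed by decreasing size, is dealt to \<open>k\<close> groups; the first set of a
  group is kept apart as the \<open>i\<close>-th part, the others are merged into the \<open>(k + i)\<close>-th part.
  With truncated subtraction, \<open>1 - (1 - x)\<close> is \<open>min 1 x\<close>.\<close>

definition quota :: "nat \<Rightarrow> nat \<Rightarrow> nat \<Rightarrow> nat" where
  "quota k t i = (if i < k then 1 - (1 - (t - i)) else (t - 1 - (i - k)) div k)"

text \<open>The auxiliary \<open>h t g\<close> is the size of group g, that is, the number of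
  positions a < t with a mod k = g, the one kept apart included. Going from t to t + 1 enlarges only
  the group t mod k.\<close>

lemma sum_quota:
  assumes "1 \<le> k"
  shows "(\<Sum>i<2 * k. quota k t i) = t"
proof -
  define h where "h t g = (1 - (1 - (t - g))) + (t - 1 - g) div k" for t g
  have step: "h (Suc t) g = h t g + of_bool (g = t mod k)" if "g < k" for t g
  proof -
    consider "t < g" | "t = g" | d where "t = g + Suc d"
      using less_imp_Suc_add linorder_neqE_nat by (metis add_Suc_right)
    then show ?thesis
    proof cases
      case 3
      have "g = t mod k \<longleftrightarrow> Suc d mod k = 0"
      proof -
        have "g = t mod k \<longleftrightarrow> g mod k = t mod k" using that by simp
        also have "\<dots> \<longleftrightarrow> k dvd t - g"
          using 3 mod_eq_dvd_iff_nat[of g t k] by (metis le_add1)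
        finally show ?thesis using 3 by (simp add: dvd_eq_mod_eq_0)
      qed
      then show ?thesis using 3 by (simp add: h_def div_Suc)
    qed (use that in \<open>auto simp: h_def\<close>)
  qed
  have sum: "(\<Sum>g<k. h t g) = t"
  proof (induction t)
    case 0
    then show ?case by (simp add: h_def)
  next
    case (Suc t)
    have "(\<Sum>g<k. h (Suc t) g) = (\<Sum>g<k. h t g + of_bool (g = t mod k))"
      by (rule sum.cong) (auto simp: step)
    also have "\<dots> = t + 1" using Suc assms by (simp add: sum.distrib)
    finally show ?case by simp
  qed
  have "(\<Sum>i<2 * k. quota k t i) = (\<Sum>i<k. quota k t i) + (\<Sum>i<k. quota k t (i + k))"
    using sum.atLeastLessThan_concat[of 0 k "k + k" "quota k t"] sum.shift_bounds_nat_ivl[of "quota k t" 0 k k]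
    by (simp add: mult_2 lessThan_atLeast0)
  also have "\<dots> = (\<Sum>g<k. h t g)"
    unfolding h_def sum.distrib by (intro arg_cong2[of _ _ _ _ "(+)"] sum.cong) (auto simp: quota_def)
  finally show ?thesis using sum by simp
qed

lemma quota_le: "1 \<le> k \<Longrightarrow> i < 2 * k \<Longrightarrow> quota k t i \<le> t"
  using member_le_sum[of i "{..<2 * k}" "quota k t"] sum_quota[of k t] by simp

text \<open>The term at position l * k + g is the smallest of the k terms that end there, so k
  copies of it are bounded by this block; the blocks for l = 1, ..., q are consecutive. Position g
  itself has no full block before it, which is why the first set of a group needs separate
  treatment.\<close>

lemma sum_stride_le:
  fixes v :: "nat \<Rightarrow> nat"
  assumes "\<And>a b. a \<le> b \<Longrightarrow> b < n \<Longrightarrow> v b \<le> v a" "q * k + g < n"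
  shows "k * (\<Sum>l\<in>{1..q}. v (l * k + g)) \<le> (\<Sum>a<q * k + g + 1. v a)"
  using assms(2)
proof (induction q)
  case (Suc q)
  let ?m = "q * k + g + 1"
  have "k * v (Suc q * k + g) = (\<Sum>a\<in>{?m..<?m + k}. v (Suc q * k + g))" by simp
  also have "\<dots> \<le> (\<Sum>a\<in>{?m..<?m + k}. v a)"
    using Suc.prems by (intro sum_mono assms(1)) auto
  finally have 1: "k * v (Suc q * k + g) \<le> (\<Sum>a\<in>{?m..<?m + k}. v a)" .
  have "(\<Sum>a<Suc q * k + g + 1. v a) = (\<Sum>a<?m + k. v a)" by (simp add: ac_simps)
  also have "\<dots> = (\<Sum>a<?m. v a) + (\<Sum>a\<in>{?m..<?m + k}. v a)"
    using sum.atLeastLessThan_concat[of 0 ?m "?m + k" v] unfolding lessThan_atLeast0 by simp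
  finally show ?case
    using 1 Suc by (simp add: distrib_left)
qed simp

definition parts_exist :: "nat \<Rightarrow> (nat \<Rightarrow> nat set) \<Rightarrow> nat \<Rightarrow> nat \<Rightarrow> nat \<Rightarrow> bool" where
  "parts_exist u T f t k \<longleftrightarrow> (\<exists>X. (\<forall>i<2 * k. X i \<in> small_sets u (u div k) \<union> large_sets T f (u div k) \<and>
     part_weight T f (u div k) (X i) \<le> quota k t i) \<and> {..<u} \<subseteq> (\<Union>i<2 * k. X i))"

text \<open>Each part is covered by as many sets as its quota allows, and the quotas add up to t;
  overlaps between the index sets only lower the total.\<close>

lemma cover_if_parts:
  assumes "1 \<le> k" "t \<le> f" "parts_exist u T f t k"
  shows "\<exists>I \<subseteq> {..<f}. card I \<le> t \<and> {..<u} \<subseteq> \<Union>(T ` I)"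
proof -
  let ?s = "u div k"
  obtain X where X: "\<And>i. i < 2 * k \<Longrightarrow> X i \<in> small_sets u ?s \<union> large_sets T f ?s"
      "\<And>i. i < 2 * k \<Longrightarrow> part_weight T f ?s (X i) \<le> quota k t i" "{..<u} \<subseteq> (\<Union>i<2 * k. X i)"
    using assms(3) unfolding parts_exist_def by blast
  have "\<exists>I \<subseteq> {..<f}. card I \<le> quota k t i \<and> X i \<subseteq> \<Union>(T ` I)" if i: "i < 2 * k" for i
  proof (cases "card (X i) \<le> ?s")
    case True
    then show ?thesis
      using X(2)[OF i] quota_le[OF assms(1) i, of t] assms(2) weight_le_iff[of "quota k t i" f T f "X i"]
      by (simp add: part_weight_def)
  next
    case False
    then obtain j where "j < f" "X i = T j"
      using X(1)[OF i] by (auto simp: small_sets_def large_sets_def)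
    then show ?thesis
      using X(2)[OF i] False by (intro exI[of _ "{j}"]) (auto simp: part_weight_def)
  qed
  then obtain J where J: "\<And>i. i < 2 * k \<Longrightarrow> J i \<subseteq> {..<f} \<and> card (J i) \<le> quota k t i \<and> X i \<subseteq> \<Union>(T ` J i)"
    by metis
  have "card (\<Union>i<2 * k. J i) \<le> (\<Sum>i<2 * k. card (J i))"
    by (rule card_UN_le) simp
  also have "\<dots> \<le> (\<Sum>i<2 * k. quota k t i)" using J by (intro sum_mono) auto
  finally have "card (\<Union>i<2 * k. J i) \<le> t" using sum_quota[OF assms(1), of t] by simp
  moreover have "{..<u} \<subseteq> \<Union>(T ` (\<Union>i<2 * k. J i))" 
  proof
    fix e assume "e \<in> {..<u}"
    then obtain i where "i < 2 * k" "e \<in> X i" using X(3) by blast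
    then show "e \<in> \<Union>(T ` (\<Union>i<2 * k. J i))" using J[of i] by blast
  qed
  moreover have "(\<Union>i<2 * k. J i) \<subseteq> {..<f}" using J by blast
  ultimately show ?thesis by blast
qed

lemma parts_if_cover:
  assumes "1 \<le> k" "t \<le> f" "\<And>i. i < f \<Longrightarrow> T i \<subseteq> {..<u}"
    and "I0 \<subseteq> {..<f}" "card I0 \<le> t" "{..<u} \<subseteq> \<Union>(T ` I0)"
  shows "parts_exist u T f t k"
proof -
  let ?s = "u div k"
  \<comment> \<open>Padding to exactly t indices makes the positions in the list match the
    quotas.\<close>
  obtain I where I: "I0 \<subseteq> I" "I \<subseteq> {..<f}" "card I = t"
    using exists_subset_between[of I0 t "{..<f}"] assms by auto
  have fin: "finite I" using I finite_subset by blast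
  have "\<forall>e\<in>{..<u}. \<exists>i\<in>I. e \<in> T i" using I assms(6) by blast
  then obtain h where h: "\<And>e. e < u \<Longrightarrow> h e \<in> I \<and> e \<in> T (h e)"
    by (metis lessThan_iff)
  define p where "p i = {e. e < u \<and> h e = i}" for i
  have p_fin: "finite (p i)" for i unfolding p_def by auto
  have p_sub: "p i \<subseteq> T i" for i unfolding p_def using h by auto
  \<comment> \<open>The order is by assigned elements, not by the sizes of the sets: only the former
    are disjoint and add up to at most u.\<close>
  define xs where "xs = rev (sort_key (\<lambda>i. card (p i)) (sorted_list_of_set I))"
  have xs: "set xs = I" "distinct xs" "length xs = t"
    using fin I by (auto simp: xs_def)
  define v where "v a = card (p (xs ! a))" for a
  have anti: "v b \<le> v a" if "a \<le> b" "b < t" for a b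
  proof -
    have "sorted (rev (map (\<lambda>i. card (p i)) xs))"
      by (simp add: xs_def rev_map)
    then have "map (\<lambda>i. card (p i)) xs ! b \<le> map (\<lambda>i. card (p i)) xs ! a"
      using that xs(3) by (intro sorted_rev_nth_mono) auto
    then show ?thesis using that xs(3) by (simp add: v_def)
  qed
  have "(\<Sum>a<t. v a) = (\<Sum>i\<in>I. card (p i))"
    using sum.reindex_bij_betw[OF bij_betw_nth[OF xs(2) refl refl], of "\<lambda>i. card (p i)"] xs
    by (simp add: v_def)
  also have "\<dots> = card (\<Union>i\<in>I. p i)"
    using fin p_fin by (subst card_UN_disjoint) (auto simp: p_def)
  also have "\<dots> \<le> u"
    using card_mono[of "{..<u}" "\<Union>i\<in>I. p i"] by (auto simp: p_def)
  finally have total: "(\<Sum>a<t. v a) \<le> u" .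
  define q where "q g = (t - 1 - g) div k" for g
  have q: "l * k + g < t" if "l \<in> {1..q g}" for l g
  proof -
    have "l * k \<le> t - 1 - g"
      using that assms(1) by (auto simp: q_def less_eq_div_iff_mult_less_eq)
    moreover have "1 \<le> l * k" using that assms(1) by auto
    ultimately show ?thesis by linarith
  qed
  \<comment> \<open>A set that is kept apart enters in full, because a large part has to be a member
    of the family. A merged group takes only the assigned elements, whose number is under
    control.\<close>
  define X where "X i = (if i < k then if i < t then T (xs ! i) else {}
      else \<Union>l\<in>{1..q (i - k)}. p (xs ! (l * k + (i - k))))" for i
  have "X i \<in> small_sets u ?s \<union> large_sets T f ?s \<and> part_weight T f ?s (X i) \<le> quota k t i" for i
  proof (cases "i < k")
    case True
    show ?thesis
    proof (cases "i < t")
      case it: True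
      then have X: "X i = T (xs ! i)" and j: "xs ! i < f"
        using True xs I nth_mem[of i xs] by (auto simp: X_def)
      have "weight T f f (T (xs ! i)) \<le> 1"
        using j it assms(2) by (subst weight_le_iff) (auto intro!: exI[of _ "{xs ! i}"])
      moreover have "quota k t i = 1" using True it by (simp add: quota_def)
      moreover have "T (xs ! i) \<in> small_sets u ?s \<union> large_sets T f ?s"
        using j assms(3)[OF j] by (auto simp: small_sets_def large_sets_def not_le)
      ultimately show ?thesis unfolding X by (simp add: part_weight_def)
    next
      case False
      then show ?thesis using True by (simp add: X_def small_sets_def part_weight_def)
    qed
  next
    case False
    define g where "g = i - k"
    have X: "X i = (\<Union>l\<in>{1..q g}. p (xs ! (l * k + g)))" using False by (simp add: X_def g_def)
    have quota: "quota k t i = q g" using False by (simp add: quota_def q_def g_def)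
    have "card (X i) \<le> ?s"
    proof (cases "q g = 0")
      case False
      then have lt: "q g * k + g < t" by (intro q) auto
      have "card (X i) \<le> (\<Sum>l\<in>{1..q g}. v (l * k + g))"
        unfolding X v_def by (rule card_UN_le) simp
      moreover have "k * (\<Sum>l\<in>{1..q g}. v (l * k + g)) \<le> (\<Sum>a<q g * k + g + 1. v a)"
        using anti lt by (rule sum_stride_le)
      moreover have "(\<Sum>a<q g * k + g + 1. v a) \<le> (\<Sum>a<t. v a)"
        using lt by (intro sum_mono2) auto
      ultimately have "k * card (X i) \<le> u"
        using total mult_le_mono2[of "card (X i)" _ k] by (meson order_trans)
      then show ?thesis using assms(1) by (simp add: less_eq_div_iff_mult_less_eq mult.commute)
    qed (simp add: X)
    moreover have "X i \<subseteq> {..<u}" unfolding X by (auto simp: p_def)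
    moreover have "weight T f f (X i) \<le> q g"
    proof (subst weight_le_iff)
      let ?J = "(\<lambda>l. xs ! (l * k + g)) ` {1..q g}"
      have "?J \<subseteq> {..<f}" using q[of _ g] xs I nth_mem by fastforce
      moreover have "card ?J \<le> q g" using card_image_le[of "{1..q g}"] by fastforce
      moreover have "X i \<subseteq> \<Union>(T ` ?J)" unfolding X using p_sub by fastforce
      ultimately show "\<exists>I\<subseteq>{..<f}. card I \<le> q g \<and> X i \<subseteq> \<Union>(T ` I)" by blast
      have "q g \<le> t" unfolding q_def by (rule order_trans[OF div_le_dividend]) simp
      then show "q g \<le> f" using assms(2) by simp
    qed
    ultimately show ?thesis using quota by (simp add: small_sets_def part_weight_def)
  qed
  moreover have "{..<u} \<subseteq> (\<Union>i<2 * k. X i)"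
  proof
    fix e assume "e \<in> {..<u}"
    then have e: "h e \<in> set xs" "e \<in> p (h e)" using h xs by (auto simp: p_def)
    then obtain a where a: "a < t" "xs ! a = h e" using xs by (metis in_set_conv_nth)
    show "e \<in> (\<Union>i<2 * k. X i)"
    proof (cases "a < k")
      case True
      then have "e \<in> X a" using a e p_sub by (auto simp: X_def)
      then show ?thesis using True by auto
    next
      case False
      \<comment> \<open>Position a holds the \<open>?l\<close>-th set of group \<open>?g\<close>
        behind the one kept apart; \<open>?l\<close> is positive since a \<ge> k.\<close>
      let ?l = "a div k" and ?g = "a mod k"
      have "?l * k \<le> t - 1 - ?g" using a(1) div_mult_mod_eq[of a k] by linarith
      then have "?l \<in> {1..q ?g}"
        using False assms(1) by (auto simp: q_def less_eq_div_iff_mult_less_eq)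
      moreover have "?l * k + ?g = a" by simp
      ultimately have "e \<in> X (k + ?g)" using e a by (auto simp: X_def intro!: bexI[of _ ?l])
      moreover have "k + ?g < 2 * k" using assms(1) by (simp add: mult_2)
      ultimately show ?thesis by blast
    qed
  qed
  ultimately show ?thesis unfolding parts_exist_def by blast
qed

text \<open>Exactly t members are demanded, but a smaller cover can be padded with further members
  as long as t does not exceed the size of the family, so an upper bound will do. Elements are
  shifted by one to become bit positions.\<close>

lemma set_cover_iff:
  assumes "set Fs \<subseteq> Pow {1..u}" "distinct Fs"
  defines "T \<equiv> \<lambda>i. {j. Suc j \<in> Fs ! i}"
  shows "set_cover {1..u} (set Fs) t \<longleftrightarrow>
    t \<le> length Fs \<and> (\<exists>I \<subseteq> {..<length Fs}. card I \<le> t \<and> {..<u} \<subseteq> \<Union>(T ` I))"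
proof
  assume "set_cover {1..u} (set Fs) t"
  then obtain C where C: "C \<subseteq> set Fs" "card C = t" "\<Union>C = {1..u}"
    unfolding set_cover_def by blast
  define I where "I = {i. i < length Fs \<and> Fs ! i \<in> C}"
  have img: "(!) Fs ` I = C" using C(1) unfolding I_def by (force simp: in_set_conv_nth subset_iff image_iff)
  have "inj_on ((!) Fs) I" using assms(2) by (auto simp: I_def inj_on_def nth_eq_iff_index_eq)
  then have cI: "card I = t" using C(2) img card_image by fastforce
  moreover have "{..<u} \<subseteq> \<Union>(T ` I)"
  proof
    fix j assume "j \<in> {..<u}"
    then have "Suc j \<in> \<Union>C" using C(3) by auto
    then show "j \<in> \<Union>(T ` I)" using img unfolding T_def by blast
  qed
  moreover have "t \<le> length Fs"
    using C card_mono[OF _ C(1)] distinct_card[OF assms(2)] by simp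
  ultimately show "t \<le> length Fs \<and> (\<exists>I \<subseteq> {..<length Fs}. card I \<le> t \<and> {..<u} \<subseteq> \<Union>(T ` I))"
    using cI I_def by (intro conjI exI[of _ I]) auto
next
  assume "t \<le> length Fs \<and> (\<exists>I \<subseteq> {..<length Fs}. card I \<le> t \<and> {..<u} \<subseteq> \<Union>(T ` I))"
  then obtain I0 where I0: "I0 \<subseteq> {..<length Fs}" "card I0 \<le> t" "{..<u} \<subseteq> \<Union>(T ` I0)"
    and t: "t \<le> length Fs" by blast
  obtain I where I: "I0 \<subseteq> I" "I \<subseteq> {..<length Fs}" "card I = t"
    using exists_subset_between[of I0 t "{..<length Fs}"] I0(1,2) t by auto
  have "inj_on ((!) Fs) I" using assms(2) I by (intro inj_on_nth) auto
  then have "card ((!) Fs ` I) = t" using I by (simp add: card_image)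
  moreover have sub: "(!) Fs ` I \<subseteq> set Fs" using I by auto
  moreover have "\<Union>((!) Fs ` I) = {1..u}"
  proof
    show "\<Union>((!) Fs ` I) \<subseteq> {1..u}" using sub assms(1) by blast
    show "{1..u} \<subseteq> \<Union>((!) Fs ` I)"
    proof
      fix e assume e: "e \<in> {1..u}"
      then have "e - 1 \<in> {..<u}" by auto
      then have "e - 1 \<in> \<Union>(T ` I)" using I0(3) I(1) by blast
      then show "e \<in> \<Union>((!) Fs ` I)" using e by (auto simp: T_def)
    qed
  qed
  ultimately show "set_cover {1..u} (set Fs) t" unfolding set_cover_def by blast
qed

text \<open>Among the coordinates beyond \<open>u\<close>, the intersection contains the \<open>i\<close>-th one unless
  the vector chosen from the \<open>i\<close>-th family is good.\<close>

definition tagged :: "nat \<Rightarrow> nat \<Rightarrow> nat \<Rightarrow> bool \<Rightarrow> nat set \<Rightarrow> nat set" where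
  "tagged u K i good X = {e \<in> {1..u + K}. if e \<le> u then e - 1 \<notin> X else e - 1 - u \<noteq> i \<or> \<not> good}"

text \<open>The first u coordinates determine X, whatever the tags are. Hence all 2k families have
  the same size, as an instance requires.\<close>

lemma tagged_inj: "X \<subseteq> {..<u} \<Longrightarrow> Y \<subseteq> {..<u} \<Longrightarrow> tagged u K i a X = tagged u K i b Y \<Longrightarrow> X = Y"
proof -
  have "X = {j. j < u \<and> Suc j \<notin> tagged u K i a X}" if "X \<subseteq> {..<u}" for X a
    using that by (auto simp: tagged_def)
  then show "X \<subseteq> {..<u} \<Longrightarrow> Y \<subseteq> {..<u} \<Longrightarrow> tagged u K i a X = tagged u K i b Y \<Longrightarrow> X = Y"
    by metis
qed

text \<open>Coordinate u + i + 1 belongs to all vectors of the other families, so only the i-th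
  choice can remove it from the intersection, and it does so exactly if it is good. On the first u
  coordinates an empty intersection of complements is a cover.\<close>

lemma orthogonal_tagged:
  assumes "1 \<le> K"
  shows "orthogonal_vectors K (\<lambda>i. (\<lambda>X. tagged u K i (g i X) X) ` C) \<longleftrightarrow>
    (\<exists>X. (\<forall>i<K. X i \<in> C \<and> g i (X i)) \<and> {..<u} \<subseteq> (\<Union>i<K. X i))"
proof
  assume "orthogonal_vectors K (\<lambda>i. (\<lambda>X. tagged u K i (g i X) X) ` C)"
  then obtain a where a: "\<And>i. i < K \<Longrightarrow> a i \<in> (\<lambda>X. tagged u K i (g i X) X) ` C" "(\<Inter>i<K. a i) = {}"
    unfolding orthogonal_vectors_def by blast
  then obtain X where X: "\<And>i. i < K \<Longrightarrow> X i \<in> C \<and> a i = tagged u K i (g i (X i)) (X i)"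
    unfolding image_iff by metis
  have "g i (X i)" if i: "i < K" for i
  proof (rule ccontr)
    assume "\<not> g i (X i)"
    then have "u + Suc i \<in> a j" if "j < K" for j
      using X[OF that] i by (auto simp: tagged_def)
    then show False using a(2) by blast
  qed
  moreover have "{..<u} \<subseteq> (\<Union>i<K. X i)"
  proof
    fix e assume e: "e \<in> {..<u}"
    then obtain i where "i < K" "Suc e \<notin> a i" using a(2) by blast
    then show "e \<in> (\<Union>i<K. X i)" using e X[of i] by (auto simp: tagged_def)
  qed
  ultimately show "\<exists>X. (\<forall>i<K. X i \<in> C \<and> g i (X i)) \<and> {..<u} \<subseteq> (\<Union>i<K. X i)" using X by blast
next
  assume "\<exists>X. (\<forall>i<K. X i \<in> C \<and> g i (X i)) \<and> {..<u} \<subseteq> (\<Union>i<K. X i)"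
  then obtain X where X: "\<And>i. i < K \<Longrightarrow> X i \<in> C \<and> g i (X i)" "{..<u} \<subseteq> (\<Union>i<K. X i)" by blast
  let ?a = "\<lambda>i. tagged u K i (g i (X i)) (X i)"
  have "e \<notin> (\<Inter>i<K. ?a i)" for e
  proof
    assume e: "e \<in> (\<Inter>i<K. ?a i)"
    then have "e \<in> ?a 0" using assms by auto
    then have r: "1 \<le> e" "e \<le> u + K" by (auto simp: tagged_def)
    show False
    proof (cases "e \<le> u")
      case True
      then have "e - 1 \<in> (\<Union>i<K. X i)" using X(2) r by fastforce
      then obtain i where "i < K" "e - 1 \<in> X i" by blast
      then show False using e True by (auto simp: tagged_def)
    next
      case False
      then have i: "e - 1 - u < K" using r by linarith
      then have "e \<in> ?a (e - 1 - u)" using e by blast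
      then show False using False X(1)[OF i] by (simp add: tagged_def)
    qed
  qed
  then have "(\<Inter>i<K. ?a i) = {}" by blast
  then show "orthogonal_vectors K (\<lambda>i. (\<lambda>X. tagged u K i (g i X) X) ` C)"
    using X(1) unfolding orthogonal_vectors_def by (intro exI[of _ ?a]) blast
qed

section \<open>Counting small sets\<close>

lemma sum_Pow_power_card:
  fixes x :: real
  assumes "finite A"
  shows "(\<Sum>X\<in>Pow A. x ^ card X) = (1 + x) ^ card A"
  using assms
proof induction
  case (insert a A)
  have "(\<Sum>X\<in>Pow (insert a A). x ^ card X) = (\<Sum>X\<in>Pow A. x ^ card X) + (\<Sum>X\<in>insert a ` Pow A. x ^ card X)"
    using insert unfolding Pow_insert by (intro sum.union_disjoint) auto
  also have "(\<Sum>X\<in>insert a ` Pow A. x ^ card X) = (\<Sum>X\<in>Pow A. x ^ card (insert a X))"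
    using insert by (intro sum.reindex_cong[of "insert a"]) (auto intro!: inj_onI)
  also have "\<dots> = (\<Sum>X\<in>Pow A. x * x ^ card X)"
    using insert by (intro sum.cong) (auto simp: card_insert_if finite_subset)
  finally show ?case using insert by (simp add: algebra_simps flip: sum_distrib_left)
qed simp

lemma finite_small_sets: "finite (small_sets u s)"
  by (rule finite_subset[of _ "Pow {..<u}"]) (auto simp: small_sets_def)

text \<open>Give X the weight x ^ |X|. For x \<le> 1 every small set weighs at least x ^ s, while
  all subsets together weigh (1 + x) ^ u by the binomial theorem.\<close>

lemma card_small_sets_le:
  fixes x :: real
  assumes "0 < x" "x \<le> 1"
  shows "card (small_sets u s) * x ^ s \<le> (1 + x) ^ u"
proof -
  have "card (small_sets u s) * x ^ s = (\<Sum>X\<in>small_sets u s. x ^ s)" by simp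
  also have "\<dots> \<le> (\<Sum>X\<in>small_sets u s. x ^ card X)"
    using assms by (intro sum_mono power_decreasing) (auto simp: small_sets_def)
  also have "\<dots> \<le> (\<Sum>X\<in>Pow {..<u}. x ^ card X)"
    using assms by (intro sum_mono2) (auto simp: small_sets_def)
  finally show ?thesis by (simp add: sum_Pow_power_card)
qed

text \<open>The exponent is spent in two halves: x is chosen so small that (1 + x) ^ u stays below 2
  ^ (\<delta> u / 2), and then k so large that the factor x ^ - (u / k) does so too.\<close>

lemma card_small_sets_powr:
  assumes "\<delta> > 0"
  shows "\<exists>k\<ge>1. \<forall>u. real (card (small_sets u (u div k))) \<le> 2 powr (\<delta> * real u)"
proof -
  define x where "x = min 1 (2 powr (\<delta> / 2) - 1)"
  have x: "0 < x" "x \<le> 1" "1 + x \<le> 2 powr (\<delta> / 2)"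
    using assms by (auto simp: x_def)
  define y where "y = - log 2 x"
  have xy: "x = 2 powr (- y)" using x by (simp add: y_def)
  have y: "0 \<le> y" using x by (simp add: y_def)
  \<comment> \<open>The bound 2 * y / \<delta> gives y / k \<le> \<delta> / 2, and the summand 1
    makes k positive.\<close>
  obtain k :: nat where k: "2 * y / \<delta> + 1 \<le> k" using real_arch_simple by blast
  have "0 \<le> 2 * y / \<delta>" using y assms by simp
  then have k1: "1 \<le> k" using k by linarith
  have ky: "y / k \<le> \<delta> / 2"
  proof -
    have "2 * y / \<delta> \<le> k" using k by simp
    then show ?thesis using assms k1 by (simp add: field_simps)
  qed
  have "real (card (small_sets u (u div k))) \<le> 2 powr (\<delta> * real u)" for u
  proof -
    let ?s = "u div k"
    have "real (card (small_sets u ?s)) * x ^ ?s \<le> (1 + x) ^ u" by (rule card_small_sets_le[OF x(1,2)])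
    also have "\<dots> \<le> (2 powr (\<delta> / 2)) ^ u" using x by (intro power_mono) auto
    also have "\<dots> = 2 powr (\<delta> / 2 * u)" by (simp add: powr_powr flip: powr_realpow)
    finally have 1: "real (card (small_sets u ?s)) * x ^ ?s \<le> 2 powr (\<delta> / 2 * u)" .
    have xs: "x ^ ?s = 2 powr (- y * ?s)" unfolding xy by (simp add: powr_powr flip: powr_realpow)
    have "real (card (small_sets u ?s)) = (real (card (small_sets u ?s)) * x ^ ?s) * 2 powr (y * ?s)"
      unfolding xs by (simp add: mult.assoc flip: powr_add)
    also have "\<dots> \<le> 2 powr (\<delta> / 2 * u) * 2 powr (y * ?s)"
      using 1 by (intro mult_right_mono) auto
    also have "\<dots> = 2 powr (\<delta> / 2 * u + y * ?s)" by (simp add: powr_add)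
    also have "\<dots> \<le> 2 powr (\<delta> * u)"
    proof (rule powr_mono)
      have "y * ?s \<le> y * (u / k)"
        using y by (intro mult_left_mono) (simp_all add: of_nat_div_le_of_nat)
      also have "\<dots> = y / k * u" by simp
      also have "\<dots> \<le> \<delta> / 2 * u" using ky by (intro mult_right_mono) auto
      finally show "\<delta> / 2 * u + y * ?s \<le> \<delta> * u" by (simp add: field_simps)
    qed simp
    finally show ?thesis .
  qed
  then show ?thesis using k1 by blast
qed

section \<open>The reduction as a program\<close>

fun block :: "prog list \<Rightarrow> prog" where
  "block [] = Skip"
| "block (P # Ps) = Seq P (block Ps)"

text \<open>The position is passed as the power p = 2 ^ j. Parity is a number minus twice its half,
  since the machine divides but has no remainder operation.\<close>

abbreviation bit_at :: "aexp \<Rightarrow> aexp \<Rightarrow> aexp" where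
  "bit_at e p \<equiv> (e \<oslash> p) \<ominus> Num 2 \<otimes> (e \<oslash> p \<oslash> Num 2)"

text \<open>For t \<le> f, the f cells behind the family consist of the t ones of the unary number
  and blanks, so their sum is t.\<close>

definition setup_prog :: "nat \<Rightarrow> prog" where
  "setup_prog k = block
    [read_input RU (Num 0),
     read_input RF (Num 1),
     set_reg RS (Reg RU \<oslash> Num k),
     for_loop RI (Reg RF) (block
      [read_input RBit (Num 2 \<oplus> Reg RU \<otimes> Reg RF \<oplus> Reg RI),
       set_reg RT (Reg RT \<oplus> Reg RBit)])]"

text \<open>A newly recorded set is nonempty and starts with weight f + 1, that is, infinity. As the
  new element exceeds all elements of the old set, adding its power of two to the mask inserts
  it.\<close>

definition extend_prog :: prog where
  "extend_prog = cond (Reg RS \<ominus> Cell Sizes (Reg RC)) (block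
    [assign Masks (Reg RN) (Cell Masks (Reg RC) \<oplus> Reg RPow),
     assign Sizes (Reg RN) (Cell Sizes (Reg RC) \<oplus> Num 1),
     assign Weights (Cell Masks (Reg RN)) (Reg RF \<oplus> Num 1),
     set_reg RN (Reg RN \<oplus> Num 1)]) Skip"

text \<open>Running through all 2 ^ u masks would be too slow. Instead the list grows element by
  element, and no larger set is ever created, since subsets of small sets are small. The list starts
  with the empty set, whose mask, size and weight 0 are found in blank memory.\<close>

definition small_prog :: prog where
  "small_prog = block
    [set_reg RN (Num 1),
     set_reg RPow (Num 1),
     for_loop RI (Reg RU) (block
      [set_reg RLen (Reg RN),
       for_loop RC (Reg RLen) extend_prog,
       set_reg RPow (Num 2 \<otimes> Reg RPow)])]"

text \<open>Computes the mask of X - T i bit by bit, as the machine has no bitwise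
  operations.\<close>

definition diff_prog :: prog where
  "diff_prog = block
    [set_reg RAcc (Num 0),
     set_reg RPow (Num 1),
     for_loop RJ (Reg RU) (block
      [read_input RBit (Num 2 \<oplus> Reg RI \<otimes> Reg RU \<oplus> Reg RJ),
       set_reg RAcc (Reg RAcc \<oplus> Reg RPow \<otimes> bit_at (Cell Masks (Reg RC)) (Reg RPow) \<otimes> (Num 1 \<ominus> Reg RBit)),
       set_reg RPow (Num 2 \<otimes> Reg RPow)])]"

text \<open>Removing a member from a small set leaves a small set, so the entry that is looked up
  has been initialised. Because \<open>Weights\<close> is indexed by masks, finding it takes one
  access and no search, which keeps the nesting of loops at three.\<close>

definition weight_prog :: prog where
  "weight_prog = for_loop RI (Reg RF) (for_loop RC (Reg RN) (block
    [diff_prog,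
     cond (Cell Weights (Cell Masks (Reg RC)) \<ominus> (Cell Weights (Reg RAcc) \<oplus> Num 1))
       (assign Weights (Cell Masks (Reg RC)) (Cell Weights (Reg RAcc) \<oplus> Num 1)) Skip]))"

definition mask_prog :: prog where
  "mask_prog = block
    [set_reg RAcc (Num 0),
     set_reg RLen (Num 0),
     set_reg RPow (Num 1),
     for_loop RJ (Reg RU) (block
      [read_input RBit (Num 2 \<oplus> Reg RI \<otimes> Reg RU \<oplus> Reg RJ),
       set_reg RAcc (Reg RAcc \<oplus> Reg RPow \<otimes> Reg RBit),
       set_reg RLen (Reg RLen \<oplus> Reg RBit),
       set_reg RPow (Num 2 \<otimes> Reg RPow)])]"

definition large_prog :: prog where
  "large_prog = for_loop RI (Reg RF) (block
    [mask_prog,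
     cond (Reg RLen \<ominus> Reg RS) (block
      [assign Masks (Reg RN) (Reg RAcc),
       assign Weights (Reg RAcc) (Num 1),
       set_reg RN (Reg RN \<oplus> Num 1)]) Skip])"

definition emit :: "aexp \<Rightarrow> prog" where
  "emit e = Seq (assign OvMem (Reg RPos) e) (set_reg RPos (Reg RPos \<oplus> Num 1))"

text \<open>Truncated arithmetic replaces logic: 1 - x is negation, the sum of the two differences
  is the distance of i and j, and a product is a conjunction. The second loop writes 0 exactly at
  coordinate i of a part within its quota.\<close>

definition vector_prog :: "nat \<Rightarrow> prog" where
  "vector_prog K = block
    [set_reg RPow (Num 1),
     for_loop RJ (Reg RU) (block
      [emit (Num 1 \<ominus> bit_at (Cell Masks (Reg RC)) (Reg RPow)),
       set_reg RPow (Num 2 \<otimes> Reg RPow)]),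
     for_loop RJ (Num K) (emit (Num 1 \<ominus>
       (Num 1 \<ominus> ((Reg RJ \<ominus> Reg RI) \<oplus> (Reg RI \<ominus> Reg RJ))) \<otimes>
       (Num 1 \<ominus> (Cell Weights (Cell Masks (Reg RC)) \<ominus> Reg RThr))))]"

definition quota_prog :: "nat \<Rightarrow> prog" where
  "quota_prog k = cond (Num k \<ominus> Reg RI)
     (set_reg RThr (Num 1 \<ominus> (Num 1 \<ominus> (Reg RT \<ominus> Reg RI))))
     (set_reg RThr ((Reg RT \<ominus> Num 1 \<ominus> (Reg RI \<ominus> Num k)) \<oslash> Num k))"

definition output_prog :: "nat \<Rightarrow> prog" where
  "output_prog k = block
    [emit (Reg RU \<oplus> Num (2 * k)),
     emit (Reg RN),
     for_loop RI (Num (2 * k)) (block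
      [quota_prog k,
       for_loop RC (Reg RN) (vector_prog (2 * k))])]"

definition reduction_prog :: "nat \<Rightarrow> prog" where
  "reduction_prog k = block
    [setup_prog k, small_prog, weight_prog, large_prog, output_prog k]"

section \<open>Frame conditions, masks and enumerations\<close>

definition agree :: "arr set \<Rightarrow> store \<Rightarrow> store \<Rightarrow> bool" where
  "agree R \<sigma> \<sigma>' \<longleftrightarrow> (\<forall>r. r \<notin> R \<longrightarrow> \<sigma>' r = \<sigma> r)"

lemma agree_refl [simp]: "agree R \<sigma> \<sigma>"
  by (simp add: agree_def)

lemma agree_upd [simp]: "r \<in> R \<Longrightarrow> agree R \<sigma> (upd \<sigma>' r i v) = agree R \<sigma> \<sigma>'"
  by (auto simp: agree_def)

lemma agree_trans: "agree R \<sigma> \<sigma>' \<Longrightarrow> agree R' \<sigma>' \<sigma>'' \<Longrightarrow> R \<union> R' \<subseteq> R'' \<Longrightarrow> agree R'' \<sigma> \<sigma>''"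
  unfolding agree_def by (metis UnI1 UnI2 subsetD)

lemma bit_set_encode: "finite A \<Longrightarrow> set_encode A div 2 ^ j mod 2 = of_bool (j \<in> A)"
  using set_encode_inverse[of A] by (auto simp: set_decode_def mod2_eq_if)

lemma set_encode_less:
  assumes "A \<subseteq> {..<u}"
  shows "set_encode A < 2 ^ u"
proof -
  have "set_encode A \<le> (\<Sum>i<u. 2 ^ i)"
    unfolding set_encode_def using assms by (intro sum_mono2) auto
  also have "\<dots> < 2 ^ u" by (simp add: sum_power2 lessThan_atLeast0)
  finally show ?thesis .
qed

lemma set_encode_restrict_Suc:
  "set_encode (A \<inter> {..<Suc j}) = set_encode (A \<inter> {..<j}) + 2 ^ j * of_bool (j \<in> A)"
proof (cases "j \<in> A")
  case True
  then have "A \<inter> {..<Suc j} = insert j (A \<inter> {..<j})" by auto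
  then show ?thesis using True by simp
next
  case False
  then have "A \<inter> {..<Suc j} = A \<inter> {..<j}" by (auto simp: less_Suc_eq)
  then show ?thesis using False by simp
qed

lemma card_restrict_Suc: "card (A \<inter> {..<Suc j}) = card (A \<inter> {..<j}) + of_bool (j \<in> A)"
proof (cases "j \<in> A")
  case True
  then have "A \<inter> {..<Suc j} = insert j (A \<inter> {..<j})" by auto
  then show ?thesis using True by simp
next
  case False
  then have "A \<inter> {..<Suc j} = A \<inter> {..<j}" by (auto simp: less_Suc_eq)
  then show ?thesis using False by simp
qed

lemma small_sets_Suc:
  "small_sets (Suc e) s = small_sets e s \<union> insert e ` {Y \<in> small_sets e s. card Y < s}"
proof (intro equalityI subsetI)
  fix X assume X: "X \<in> small_sets (Suc e) s"
  show "X \<in> small_sets e s \<union> insert e ` {Y \<in> small_sets e s. card Y < s}"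
  proof (cases "e \<in> X")
    case True
    have fin: "finite X" using X finite_subset by (auto simp: small_sets_def)
    have "X = insert e (X - {e})" using True by blast
    moreover have "card (X - {e}) < card X" using True fin by (rule card_Diff1_less[rotated])
    then have "X - {e} \<in> {Y \<in> small_sets e s. card Y < s}"
      using X by (auto simp: small_sets_def less_Suc_eq)
    ultimately show ?thesis by blast
  next
    case False
    then have "X \<in> small_sets e s" using X by (auto simp: small_sets_def less_Suc_eq)
    then show ?thesis by blast
  qed
next
  fix X assume "X \<in> small_sets e s \<union> insert e ` {Y \<in> small_sets e s. card Y < s}"
  then show "X \<in> small_sets (Suc e) s"
  proof
    assume "X \<in> insert e ` {Y \<in> small_sets e s. card Y < s}"
    then obtain Y where Y: "X = insert e Y" "Y \<subseteq> {..<e}" "card Y < s"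
      by (auto simp: small_sets_def)
    then have "card X \<le> s" using card_insert_le_m1[of s Y e] by simp
    then show ?thesis using Y by (auto simp: small_sets_def)
  qed (auto simp: small_sets_def)
qed

lemma small_sets_mono: "e \<le> u \<Longrightarrow> small_sets e s \<subseteq> small_sets u s"
  by (auto simp: small_sets_def)

lemma large_sets_Suc:
  "large_sets T (Suc i) s = (if s < card (T i) then insert (T i) (large_sets T i s) else large_sets T i s)"
  by (auto simp: large_sets_def less_Suc_eq)

lemma load_snoc: "(load xs)(length xs := v) = load (xs @ [v])"
  by (auto simp: load_def nth_append)

text \<open>Only the masks are in memory; X is a ghost variable that remembers the sets. The
  bijection excludes repetitions and identifies the length of the list with the size of C.\<close>

definition enumerates :: "(nat \<Rightarrow> nat set) \<Rightarrow> nat set set \<Rightarrow> store \<Rightarrow> bool" where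
  "enumerates X C \<sigma> \<longleftrightarrow> bij_betw X {..<\<sigma> RN 0} C \<and> (\<forall>c<\<sigma> RN 0. \<sigma> Masks c = set_encode (X c))"

lemma enumerates_card: "enumerates X C \<sigma> \<Longrightarrow> \<sigma> RN 0 = card C"
  unfolding enumerates_def using bij_betw_same_card by fastforce

lemma enumerates_in: "enumerates X C \<sigma> \<Longrightarrow> c < \<sigma> RN 0 \<Longrightarrow> X c \<in> C"
  unfolding enumerates_def by (auto simp: bij_betw_def)

lemma enumerates_insert:
  assumes "enumerates X C \<sigma>" "Y \<notin> C" "\<sigma>' RN 0 = Suc (\<sigma> RN 0)"
    "\<sigma>' Masks = (\<sigma> Masks)(\<sigma> RN 0 := set_encode Y)"
  shows "enumerates (X(\<sigma> RN 0 := Y)) (insert Y C) \<sigma>'"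
proof -
  let ?n = "\<sigma> RN 0"
  have "bij_betw (X(?n := Y)) {..<?n} C"
    using assms(1) by (subst bij_betw_cong[of _ _ X]) (auto simp: enumerates_def)
  then have "bij_betw (X(?n := Y)) (insert ?n {..<?n}) (insert Y C)"
    using assms(2) notIn_Un_bij_betw[of ?n "{..<?n}" "X(?n := Y)" C] by simp
  then show ?thesis
    using assms by (auto simp: enumerates_def lessThan_Suc less_Suc_eq)
qed

section \<open>Correctness of the reduction\<close>

declare weight.simps [simp del]

text \<open>Z dominates the lengths of all loops and 2 ^ b all numbers that are stored. The bounds
  on b take care of the dimension, the masks, the weights up to f + 1 and their successors, and the
  length of the instance that is written.\<close>

locale reduction = layout u f inp for u f inp +
  fixes T :: "nat \<Rightarrow> nat set" and t k b Z :: nat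
  assumes T_subset: "\<And>i. i < f \<Longrightarrow> T i \<subseteq> {..<u}"
    and T_inj: "inj_on T {..<f}"
    and inp_set: "\<And>i j. i < f \<Longrightarrow> j < u \<Longrightarrow> inp (2 + i * u + j) = of_bool (j \<in> T i)"
    and inp_t: "\<And>i. i < f \<Longrightarrow> inp (2 + u * f + i) = of_bool (i < t)"
    and t: "1 \<le> t" "t \<le> f" and k: "1 \<le> k"
    and Z: "u \<le> Z" "f \<le> Z" "2 * k \<le> Z"
      "card (small_sets u (u div k) \<union> large_sets T f (u div k)) \<le> Z"
    and b: "u + 2 * k \<le> 2 ^ b" "2 ^ u \<le> (2::nat) ^ b" "f + 2 \<le> 2 ^ b"
      "2 + 2 * k * card (small_sets u (u div k) \<union> large_sets T f (u div k)) * (u + 2 * k) \<le> 2 ^ b"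
begin

abbreviation "s \<equiv> u div k"
abbreviation "small \<equiv> small_sets u s"
abbreviation "large \<equiv> large_sets T f s"
abbreviation "hr \<equiv> hoare b Z"

lemmas hoare_intros = hoare_Seq hoare_assign hoare_read_input hoare_Skip hoare_cond

lemma finite_parts: "finite (small \<union> large)"
proof -
  have "large \<subseteq> T ` {..<f}" by (auto simp: large_sets_def)
  then have "finite large" by (rule finite_subset) simp
  then show ?thesis using finite_small_sets by simp
qed

lemma card_parts_le:
  assumes "C \<subseteq> small \<union> large"
  shows "card C \<le> Z" "card C \<le> 2 ^ b"
proof -
  have 1: "card C \<le> card (small \<union> large)" by (rule card_mono[OF finite_parts assms])
  then show "card C \<le> Z" using Z by simp
  have "card (small \<union> large) * 1 \<le> card (small \<union> large) * (2 * k * (u + 2 * k))"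
    using k by (intro mult_le_mono2) auto
  also have "\<dots> = 2 * k * card (small \<union> large) * (u + 2 * k)" by (simp add: ac_simps)
  finally show "card C \<le> 2 ^ b" using 1 b(4) by linarith
qed

lemma mask_le: "A \<subseteq> {..<u} \<Longrightarrow> set_encode A \<le> 2 ^ b"
  using set_encode_less[of A u] b(2) by linarith

lemma small_subset: "X \<in> small \<Longrightarrow> X \<subseteq> {..<u}"
  by (simp add: small_sets_def)

lemma parts_subset: "X \<in> small \<union> large \<Longrightarrow> X \<subseteq> {..<u}"
  using T_subset by (auto simp: small_sets_def large_sets_def)

lemma mask_eq_iff: "X \<subseteq> {..<u} \<Longrightarrow> Y \<subseteq> {..<u} \<Longrightarrow> set_encode X = set_encode Y \<longleftrightarrow> X = Y"
  by (meson finite_lessThan finite_subset set_encode_eq)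

lemma pow_le: "j \<le> u \<Longrightarrow> 2 ^ j \<le> (2::nat) ^ b"
  using b(2) power_increasing[of j u "2::nat"] by (meson one_le_numeral order_trans)

lemma setup_spec:
  "hr (setup_prog k) (\<lambda>\<sigma>. agree {RU, RF, RS, RI, RBit, RT} (\<lambda>_ _. 0) \<sigma> \<and> \<sigma> RU 0 = u \<and> \<sigma> RF 0 = f \<and>
     \<sigma> RS 0 = s \<and> \<sigma> RT 0 = t) (\<lambda>_ _. 0)"
proof -
  define I where "I i \<sigma> \<longleftrightarrow> \<sigma> RI 0 = i \<and> agree {RU, RF, RS, RI, RBit, RT} (\<lambda>_ _. 0) \<sigma> \<and> \<sigma> RU 0 = u \<and> \<sigma> RF 0 = f \<and>
     \<sigma> RS 0 = s \<and> \<sigma> RT 0 = min i t" for i \<sigma>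
  have loop: "hr (for_loop RI (Reg RF) (block
      [read_input RBit (Num 2 \<oplus> Reg RU \<otimes> Reg RF \<oplus> Reg RI),
       set_reg RT (Reg RT \<oplus> Reg RBit)])) (I f) \<sigma>"
    if "I 0 (upd \<sigma> RI 0 0)" for \<sigma>
  proof (rule hoare_for[where n = f and I = I])
    fix i \<sigma> assume i: "i < f" "I i \<sigma>"
    have "min i t + of_bool (i < t) = min (Suc i) t" by auto
    then show "hr (block [read_input RBit (Num 2 \<oplus> Reg RU \<otimes> Reg RF \<oplus> Reg RI),
       set_reg RT (Reg RT \<oplus> Reg RBit)]) (\<lambda>\<sigma>'. \<sigma>' RI 0 = i \<and> I (Suc i) (upd \<sigma>' RI 0 (Suc i))) \<sigma>"
      using i inp_t[of i] b(3) t unfolding block.simps I_def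
      by (intro hoare_intros) (auto simp: base_def)
  qed (use that Z b in \<open>auto simp: I_def\<close>)
  show ?thesis
    unfolding setup_prog_def block.simps
  proof (intro hoare_intros, goal_cases)
    case 4
    show ?case
      by (rule hoare_mono[OF loop[unfolded block.simps]]) (use t in \<open>auto simp: I_def inp_0 inp_1[unfolded One_nat_def] hoare_Skip\<close>)
  qed (use b k inp_0 inp_1 in \<open>auto simp: base_def intro: order_trans[OF div_le_dividend]\<close>)
qed

text \<open>C is a parameter because, while element e is being treated, it lies strictly between the
  collections before and after this round or equals one of them.\<close>

definition small_inv :: "store \<Rightarrow> nat \<Rightarrow> (nat \<Rightarrow> nat set) \<Rightarrow> nat set set \<Rightarrow> store \<Rightarrow> bool" where
  "small_inv \<sigma>0 e X C \<sigma> \<longleftrightarrow>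
     agree {RN, RPow, RI, RLen, RC, Masks, Sizes, Weights} \<sigma>0 \<sigma> \<and>
     \<sigma> RU 0 = u \<and> \<sigma> RF 0 = f \<and> \<sigma> RS 0 = s \<and> \<sigma> RI 0 = e \<and> \<sigma> RPow 0 = 2 ^ e \<and>
     enumerates X C \<sigma> \<and> (\<forall>c<\<sigma> RN 0. \<sigma> Sizes c = card (X c)) \<and>
     (\<forall>Y\<in>C. \<sigma> Weights (set_encode Y) = weight T f 0 Y)"

lemma extend_spec:
  assumes inv: "small_inv \<sigma>0 e X C \<sigma>" and "\<sigma> RC 0 = c" "\<sigma> RLen 0 = l" "c < \<sigma> RN 0"
    and e: "e < u" "X c \<subseteq> {..<e}" "C \<subseteq> small" "insert e (X c) \<notin> C"
  shows "hr extend_prog (\<lambda>\<sigma>'. \<sigma>' RC 0 = c \<and> \<sigma>' RLen 0 = l \<and>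
    (if card (X c) < s then small_inv \<sigma>0 e (X(\<sigma> RN 0 := insert e (X c))) (insert (insert e (X c)) C) \<sigma>'
     else \<sigma>' = \<sigma>)) \<sigma>"
proof -
  let ?Y = "insert e (X c)"
  have en: "enumerates X C \<sigma>" and sz: "\<And>c. c < \<sigma> RN 0 \<Longrightarrow> \<sigma> Sizes c = card (X c)"
    and wt: "\<And>Y. Y \<in> C \<Longrightarrow> \<sigma> Weights (set_encode Y) = weight T f 0 Y"
    and regs: "\<sigma> RF 0 = f" "\<sigma> RS 0 = s" "\<sigma> RPow 0 = 2 ^ e" "\<sigma> RU 0 = u" "\<sigma> RI 0 = e"
    using inv unfolding small_inv_def by auto
  \<comment> \<open>No carry occurs, since bit e is not yet set.\<close>
  have mask: "\<sigma> Masks c + 2 ^ e = set_encode ?Y"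
    using en assms(4) e(2) finite_subset[OF e(2)] by (subst set_encode_insert) (auto simp: enumerates_def)
  have Ysub: "?Y \<subseteq> {..<u}" using e by auto
  have cY: "card ?Y = Suc (card (X c))" using e(2) finite_subset[OF e(2)] by (subst card_insert_disjoint) auto
  show ?thesis
  proof (cases "card (X c) < s")
    case True
    have "insert ?Y C \<subseteq> small" using e(3) True cY Ysub by (auto simp: small_sets_def)
    then have "card (insert ?Y C) \<le> 2 ^ b" by (intro card_parts_le) auto
    moreover have "finite C" using e(3) finite_small_sets finite_subset by blast
    ultimately have N: "Suc (\<sigma> RN 0) \<le> 2 ^ b" using e(4) enumerates_card[OF en] by simp
    have sz_le: "Suc (card (X c)) \<le> 2 ^ b"
      using True b(1) div_le_dividend[of u k] by linarith
    define \<sigma>1 where "\<sigma>1 = upd (upd (upd (upd \<sigma> Masks (\<sigma> RN 0) (set_encode ?Y))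
        Sizes (\<sigma> RN 0) (Suc (card (X c)))) Weights (set_encode ?Y) (Suc f)) RN 0 (Suc (\<sigma> RN 0))"
    have "enumerates (X(\<sigma> RN 0 := ?Y)) (insert ?Y C) \<sigma>1"
      by (rule enumerates_insert[OF en e(4)]) (auto simp: \<sigma>1_def)
    moreover have "\<sigma>1 Weights (set_encode Y) = weight T f 0 Y" if "Y \<in> insert ?Y C" for Y
    proof (cases "Y = ?Y")
      case True
      then show ?thesis by (simp add: \<sigma>1_def weight.simps)
    next
      case False
      then have "Y \<in> C" using that by simp
      then have "set_encode Y \<noteq> set_encode ?Y"
        using False e(3) mask_eq_iff[OF _ Ysub, of Y] small_subset[of Y] by blast
      then show ?thesis using wt[OF \<open>Y \<in> C\<close>] by (simp add: \<sigma>1_def)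
    qed
    ultimately have "small_inv \<sigma>0 e (X(\<sigma> RN 0 := ?Y)) (insert ?Y C) \<sigma>1"
      using inv sz cY unfolding small_inv_def by (auto simp: \<sigma>1_def less_Suc_eq)
    then show ?thesis
      unfolding extend_prog_def block.simps
      using True regs sz[OF assms(4)] assms(2,3) N mask mask_le[OF Ysub] sz_le b(3)
      by (intro hoare_intros) (simp_all add: \<sigma>1_def)
  next
    case False
    then show ?thesis
      unfolding extend_prog_def using regs sz[OF assms(4)] assms(2,3)
      by (intro hoare_cond hoare_Skip) simp_all
  qed
qed

lemma small_loop_spec:
  assumes inv: "small_inv \<sigma>0 e X0 (small_sets e s) \<sigma>" and e: "e < u"
  shows "hr (block [set_reg RLen (Reg RN), for_loop RC (Reg RLen) extend_prog, set_reg RPow (Num 2 \<otimes> Reg RPow)])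
    (\<lambda>\<sigma>'. \<sigma>' RI 0 = e \<and> (\<exists>X. small_inv \<sigma>0 (Suc e) X (small_sets (Suc e) s) (upd \<sigma>' RI 0 (Suc e)))) \<sigma>"
proof -
  define l where "l = \<sigma> RN 0"
  have en0: "enumerates X0 (small_sets e s) \<sigma>" using inv by (simp add: small_inv_def)
  have sub: "small_sets e s \<subseteq> small" using e by (intro small_sets_mono) simp
  have l: "l \<le> Z" "l \<le> 2 ^ b"
    using card_parts_le[of "small_sets e s"] sub enumerates_card[OF en0] by (auto simp: l_def)
  have X0: "X0 c \<in> small_sets e s" if "c < l" for c
    using enumerates_in[OF en0] that by (simp add: l_def)
  have X0_inj: "X0 c = X0 d \<Longrightarrow> c < l \<Longrightarrow> d < l \<Longrightarrow> c = d" for c d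
    using en0 unfolding enumerates_def l_def bij_betw_def inj_on_def by auto
  have X0_img: "X0 ` {..<l} = small_sets e s"
    using en0 unfolding enumerates_def l_def bij_betw_def by auto
  \<comment> \<open>The collection after the first c of the l old entries have been treated.\<close>
  define D where "D c = small_sets e s \<union> insert e ` {Y \<in> X0 ` {..<c}. card Y < s}" for c
  have D_l: "D l = small_sets (Suc e) s" unfolding D_def X0_img small_sets_Suc ..
  have D_mono: "D c \<subseteq> small" if "c \<le> l" for c
  proof -
    have "D c \<subseteq> D l" using that unfolding D_def by auto
    then show ?thesis using D_l small_sets_mono[of "Suc e" u s] e by auto
  qed
  \<comment> \<open>New sets are appended behind the first l entries, so the entries still to be
    visited agree with \<open>X0\<close>.\<close>
  define I where "I c \<sigma> \<longleftrightarrow> (\<exists>X. small_inv \<sigma>0 e X (D c) \<sigma> \<and> (\<forall>c<l. X c = X0 c) \<and> l \<le> \<sigma> RN 0) \<and>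
      \<sigma> RC 0 = c \<and> \<sigma> RLen 0 = l" for c \<sigma>
  have loop: "hr (for_loop RC (Reg RLen) extend_prog) (I l) \<sigma>" if "I 0 (upd \<sigma> RC 0 0)" for \<sigma>
  proof (rule hoare_for[where n = l and I = I])
    fix c \<sigma> assume c: "c < l" "I c \<sigma>"
    then obtain X where X: "small_inv \<sigma>0 e X (D c) \<sigma>" "\<And>c. c < l \<Longrightarrow> X c = X0 c" "l \<le> \<sigma> RN 0"
      "\<sigma> RC 0 = c" "\<sigma> RLen 0 = l" by (auto simp: I_def)
    have Xc: "X c = X0 c" "X0 c \<subseteq> {..<e}" using X(2) X0 c by (auto simp: small_sets_def)
    have DSuc: "D (Suc c) = (if card (X c) < s then insert (insert e (X c)) (D c) else D c)"
      using Xc by (auto simp: D_def lessThan_Suc)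
    have new: "insert e (X c) \<notin> D c"
    proof
      assume "insert e (X c) \<in> D c"
      moreover have "insert e (X c) \<notin> small_sets e s" by (auto simp: small_sets_def)
      ultimately obtain d where d: "d < c" "insert e (X c) = insert e (X0 d)"
        by (auto simp: D_def)
      have "X0 d \<subseteq> {..<e}" using X0[of d] d c by (auto simp: small_sets_def)
      then have "X0 c = X0 d" using d Xc by (metis insert_ident lessThan_iff less_irrefl subsetD)
      then show False using X0_inj[of c d] d c by simp
    qed
    have "hr extend_prog (\<lambda>\<sigma>'. \<sigma>' RC 0 = c \<and> \<sigma>' RLen 0 = l \<and>
      (if card (X c) < s then small_inv \<sigma>0 e (X(\<sigma> RN 0 := insert e (X c))) (insert (insert e (X c)) (D c)) \<sigma>'
       else \<sigma>' = \<sigma>)) \<sigma>"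
      by (rule extend_spec[OF X(1)]) (use X c e Xc D_mono[of c] new in auto)
    then show "hr extend_prog (\<lambda>\<sigma>'. \<sigma>' RC 0 = c \<and> I (Suc c) (upd \<sigma>' RC 0 (Suc c))) \<sigma>"
    proof (rule hoare_mono)
      fix \<sigma>' assume *: "\<sigma>' RC 0 = c \<and> \<sigma>' RLen 0 = l \<and>
        (if card (X c) < s then small_inv \<sigma>0 e (X(\<sigma> RN 0 := insert e (X c))) (insert (insert e (X c)) (D c)) \<sigma>'
         else \<sigma>' = \<sigma>)"
      have upd: "small_inv \<sigma>0 e Y C (upd \<sigma>' RC 0 (Suc c)) = small_inv \<sigma>0 e Y C \<sigma>'" for Y C
        by (simp add: small_inv_def enumerates_def)
      have "\<exists>Y. small_inv \<sigma>0 e Y (D (Suc c)) \<sigma>' \<and> (\<forall>c<l. Y c = X0 c) \<and> l \<le> \<sigma>' RN 0"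
      proof (cases "card (X c) < s")
        case True
        then have inv': "small_inv \<sigma>0 e (X(\<sigma> RN 0 := insert e (X c))) (D (Suc c)) \<sigma>'"
          using * DSuc by simp
        then have "\<sigma>' RN 0 = card (D (Suc c))" "\<sigma> RN 0 = card (D c)"
          using X(1) enumerates_card unfolding small_inv_def by blast+
        moreover have "card (D c) \<le> card (D (Suc c))"
          using DSuc finite_subset[OF D_mono[of "Suc c"] finite_small_sets] c by (intro card_mono) auto
        ultimately show ?thesis using inv' X(2,3) by (intro exI[of _ "X(\<sigma> RN 0 := insert e (X c))"]) auto
      next
        case False
        then show ?thesis using * DSuc X by (intro exI[of _ X]) auto
      qed
      then show "\<sigma>' RC 0 = c \<and> I (Suc c) (upd \<sigma>' RC 0 (Suc c))"
        using * unfolding I_def upd by auto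
    qed
  qed (use that l in \<open>auto simp: I_def\<close>)
  have I0: "I 0 (upd (upd \<sigma> RLen 0 l) RC 0 0)"
    using inv unfolding I_def l_def by (auto simp: small_inv_def enumerates_def D_def intro!: exI[of _ X0])
  have pow: "2 * 2 ^ e \<le> (2::nat) ^ b" using pow_le[of "Suc e"] e by simp
  have fin: "\<sigma>' RI 0 = e \<and> (\<exists>X. small_inv \<sigma>0 (Suc e) X (small_sets (Suc e) s)
       (upd (upd \<sigma>' RPow 0 (2 * 2 ^ e)) RI 0 (Suc e)))" "\<sigma>' RPow 0 = 2 ^ e" if I: "I l \<sigma>'" for \<sigma>'
  proof -
    obtain X where X: "small_inv \<sigma>0 e X (small_sets (Suc e) s) \<sigma>'" using I D_l by (auto simp: I_def)
    then have "small_inv \<sigma>0 (Suc e) X (small_sets (Suc e) s) (upd (upd \<sigma>' RPow 0 (2 * 2 ^ e)) RI 0 (Suc e))"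
      by (simp add: small_inv_def enumerates_def)
    then show "\<sigma>' RI 0 = e \<and> (\<exists>X. small_inv \<sigma>0 (Suc e) X (small_sets (Suc e) s)
       (upd (upd \<sigma>' RPow 0 (2 * 2 ^ e)) RI 0 (Suc e)))" "\<sigma>' RPow 0 = 2 ^ e"
      using X by (auto simp: small_inv_def)
  qed
  show ?thesis
    unfolding block.simps
  proof (intro hoare_Seq hoare_assign hoare_mono[OF loop], goal_cases)
    case (3 \<sigma>')
    then show ?case using fin[OF 3(1)] pow by simp
  next
    case (4 \<sigma>')
    then show ?case using fin[OF 4(1)] by (intro hoare_Skip) simp
  qed (use I0 l in \<open>auto simp: l_def\<close>)
qed

lemma small_spec:
  assumes "\<sigma>0 RU 0 = u" "\<sigma>0 RF 0 = f" "\<sigma>0 RS 0 = s" "\<sigma>0 Masks 0 = 0" "\<sigma>0 Sizes 0 = 0" "\<sigma>0 Weights 0 = 0"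
  shows "hr small_prog (\<lambda>\<sigma>. agree {RN, RPow, RI, RLen, RC, Masks, Sizes, Weights} \<sigma>0 \<sigma> \<and>
    (\<exists>X. enumerates X small \<sigma>) \<and> (\<forall>Y\<in>small. \<sigma> Weights (set_encode Y) = weight T f 0 Y)) \<sigma>0"
proof -
  define I where "I e \<sigma> \<longleftrightarrow> (\<exists>X. small_inv \<sigma>0 e X (small_sets e s) \<sigma>)" for e \<sigma>
  have loop: "hr (for_loop RI (Reg RU) (block [set_reg RLen (Reg RN), for_loop RC (Reg RLen) extend_prog,
      set_reg RPow (Num 2 \<otimes> Reg RPow)])) (I u) \<sigma>" if "I 0 (upd \<sigma> RI 0 0)" for \<sigma>
  proof (rule hoare_for[where n = u and I = I])
    fix e \<sigma> assume "e < u" "I e \<sigma>"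
    then show "hr (block [set_reg RLen (Reg RN), for_loop RC (Reg RLen) extend_prog,
      set_reg RPow (Num 2 \<otimes> Reg RPow)]) (\<lambda>\<sigma>'. \<sigma>' RI 0 = e \<and> I (Suc e) (upd \<sigma>' RI 0 (Suc e))) \<sigma>"
      unfolding I_def using small_loop_spec by blast
  qed (use that Z b in \<open>auto simp: I_def small_inv_def\<close>)
  have "small_sets 0 s = {{}}" by (auto simp: small_sets_def)
  moreover have "bij_betw (\<lambda>_. {}) {..<Suc 0} {{}}"
    by (simp add: bij_betw_def lessThan_Suc)
  ultimately have "small_inv \<sigma>0 0 (\<lambda>_. {}) (small_sets 0 s) (upd (upd (upd \<sigma>0 RN 0 1) RPow 0 1) RI 0 0)"
    using assms by (simp add: small_inv_def enumerates_def weight.simps)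
  then have I0: "I 0 (upd (upd (upd \<sigma>0 RN 0 1) RPow 0 1) RI 0 0)"
    unfolding I_def by blast
  show ?thesis
    unfolding small_prog_def block.simps
  proof (intro hoare_Seq hoare_assign hoare_mono[OF loop[unfolded block.simps]], goal_cases)
    case (4 \<sigma>')
    then show ?case by (intro hoare_Skip) (auto simp: I_def small_inv_def)
  qed (use I0 b in auto)
qed

end

context reduction
begin

lemma diff_spec:
  assumes "\<sigma>0 RU 0 = u" "\<sigma>0 RI 0 = i" "i < f" "\<sigma>0 Masks (\<sigma>0 RC 0) = set_encode Y" "Y \<subseteq> {..<u}"
  shows "hr diff_prog (\<lambda>\<sigma>. agree {RJ, RPow, RAcc, RBit} \<sigma>0 \<sigma> \<and> \<sigma> RAcc 0 = set_encode (Y - T i)) \<sigma>0"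
proof -
  define I where "I j \<sigma> \<longleftrightarrow> agree {RJ, RPow, RAcc, RBit} \<sigma>0 \<sigma> \<and> \<sigma> RJ 0 = j \<and> \<sigma> RPow 0 = 2 ^ j \<and>
    \<sigma> RAcc 0 = set_encode ((Y - T i) \<inter> {..<j})" for j \<sigma>
  have finY: "finite Y" using assms(5) finite_subset by blast
  have loop: "hr (for_loop RJ (Reg RU) (block
      [read_input RBit (Num 2 \<oplus> Reg RI \<otimes> Reg RU \<oplus> Reg RJ),
       set_reg RAcc (Reg RAcc \<oplus> Reg RPow \<otimes> bit_at (Cell Masks (Reg RC)) (Reg RPow) \<otimes> (Num 1 \<ominus> Reg RBit)),
       set_reg RPow (Num 2 \<otimes> Reg RPow)])) (I u) \<sigma>" if "I 0 (upd \<sigma> RJ 0 0)" for \<sigma>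
  proof (rule hoare_for[where n = u and I = I])
    fix j \<sigma> assume j: "j < u" "I j \<sigma>"
    then have regs: "\<sigma> RU 0 = u" "\<sigma> RI 0 = i" "\<sigma> Masks (\<sigma> RC 0) = set_encode Y" "\<sigma> RJ 0 = j" "\<sigma> RPow 0 = 2 ^ j"
      "\<sigma> RAcc 0 = set_encode ((Y - T i) \<inter> {..<j})"
      using assms by (auto simp: I_def agree_def)
    have bit: "(set_encode Y div 2 ^ j - 2 * (set_encode Y div 2 ^ j div 2)) = of_bool (j \<in> Y)"
      unfolding minus_mult_div_eq_mod using bit_set_encode[OF finY] .
    have acc: "set_encode ((Y - T i) \<inter> {..<j}) + 2 ^ j * of_bool (j \<in> Y) * (Suc 0 - of_bool (j \<in> T i)) =
        set_encode ((Y - T i) \<inter> {..<Suc j})"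
      unfolding set_encode_restrict_Suc by auto
    have acc_le: "set_encode ((Y - T i) \<inter> {..<Suc j}) \<le> 2 ^ b"
      using assms(5) by (intro mask_le) auto
    have "i * u + j < f * u"
    proof -
      have "i * u + j < (i + 1) * u" using j by simp
      also have "\<dots> \<le> f * u" using assms(3) by (intro mult_le_mono1) auto
      finally show ?thesis .
    qed
    then have addr: "2 + i * u + j < base" by (simp add: base_def mult.commute)
    have "2 * 2 ^ j \<le> (2::nat) ^ b" using pow_le[of "Suc j"] j by simp
    then show "hr (block [read_input RBit (Num 2 \<oplus> Reg RI \<otimes> Reg RU \<oplus> Reg RJ),
       set_reg RAcc (Reg RAcc \<oplus> Reg RPow \<otimes> bit_at (Cell Masks (Reg RC)) (Reg RPow) \<otimes> (Num 1 \<ominus> Reg RBit)),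
       set_reg RPow (Num 2 \<otimes> Reg RPow)]) (\<lambda>\<sigma>'. \<sigma>' RJ 0 = j \<and> I (Suc j) (upd \<sigma>' RJ 0 (Suc j))) \<sigma>"
      using j(2) addr acc_le acc bit inp_set[OF assms(3) j(1)] unfolding block.simps
      by (cases "j \<in> Y"; cases "j \<in> T i"; intro hoare_intros) (simp_all add: regs I_def)
  qed (use that Z b assms(1) in \<open>auto simp: I_def agree_def\<close>)
  have fin: "(Y - T i) \<inter> {..<u} = Y - T i" using assms(5) by auto
  show ?thesis
    unfolding diff_prog_def block.simps
  proof (intro hoare_Seq hoare_assign hoare_mono[OF loop[unfolded block.simps]], goal_cases)
    case (4 \<sigma>')
    then show ?case by (intro hoare_Skip) (auto simp: I_def fin)
  qed (use b in \<open>auto simp: I_def\<close>)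
qed

lemma weight_spec:
  assumes "\<sigma>0 RU 0 = u" "\<sigma>0 RF 0 = f" "enumerates X small \<sigma>0"
    and wt0: "\<And>Y. Y \<in> small \<Longrightarrow> \<sigma>0 Weights (set_encode Y) = weight T f 0 Y"
  shows "hr weight_prog (\<lambda>\<sigma>. agree {RI, RC, RJ, RPow, RAcc, RBit, Weights} \<sigma>0 \<sigma> \<and>
    (\<forall>Y\<in>small. \<sigma> Weights (set_encode Y) = weight T f f Y)) \<sigma>0"
proof -
  define n where "n = \<sigma>0 RN 0"
  have n: "n \<le> Z" "n \<le> 2 ^ b"
    using card_parts_le[of small] enumerates_card[OF assms(3)] by (auto simp: n_def)
  have X_small: "X c \<in> small" if "c < n" for c
    using enumerates_in[OF assms(3)] that by (simp add: n_def)
  have X_img: "X ` {..<n} = small" and X_inj: "inj_on X {..<n}"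
    using assms(3) unfolding enumerates_def n_def bij_betw_def by auto
  \<comment> \<open>Within round i the entries before position c already have the weights of round i
    + 1.\<close>
  define J where "J i c \<sigma> \<longleftrightarrow> agree {RI, RC, RJ, RPow, RAcc, RBit, Weights} \<sigma>0 \<sigma> \<and> \<sigma> RI 0 = i \<and> \<sigma> RC 0 = c \<and>
    (\<forall>d<n. \<sigma> Weights (set_encode (X d)) = weight T f (if d < c then Suc i else i) (X d))" for i c \<sigma>
  define I where "I i \<sigma> \<longleftrightarrow> agree {RI, RC, RJ, RPow, RAcc, RBit, Weights} \<sigma>0 \<sigma> \<and> \<sigma> RI 0 = i \<and>
    (\<forall>d<n. \<sigma> Weights (set_encode (X d)) = weight T f i (X d))" for i \<sigma>
  let ?body = "block [diff_prog,
     cond (Cell Weights (Cell Masks (Reg RC)) \<ominus> (Cell Weights (Reg RAcc) \<oplus> Num 1))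
       (assign Weights (Cell Masks (Reg RC)) (Cell Weights (Reg RAcc) \<oplus> Num 1)) Skip]"
  have body: "hr ?body (\<lambda>\<sigma>'. \<sigma>' RC 0 = c \<and> J i (Suc c) (upd \<sigma>' RC 0 (Suc c))) \<sigma>"
    if i: "i < f" and c: "c < n" and J: "J i c \<sigma>" for i c \<sigma>
  proof -
    have agree: "agree {RI, RC, RJ, RPow, RAcc, RBit, Weights} \<sigma>0 \<sigma>" and regs: "\<sigma> RI 0 = i" "\<sigma> RC 0 = c"
      and wt: "\<And>d. d < n \<Longrightarrow> \<sigma> Weights (set_encode (X d)) = weight T f (if d < c then Suc i else i) (X d)"
      using J by (auto simp: J_def)
    have masks: "\<sigma> Masks c = set_encode (X c)" "\<sigma> RU 0 = u"
      using assms c agree by (auto simp: enumerates_def agree_def n_def)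
    have "X c - T i \<in> small"
      using X_small[OF c] card_mono[of "X c" "X c - T i"] finite_subset[of "X c" "{..<u}"]
      by (auto simp: small_sets_def)
    then have "X c - T i \<in> X ` {..<n}" unfolding X_img .
    then obtain d where d: "d < n" "X d = X c - T i" by (metis imageE lessThan_iff)
    \<comment> \<open>The entry that is read may or may not have been updated in this round,
      depending on the order of the list; both values coincide for a set that avoids
      \<open>T i\<close>.\<close>
    have wd: "\<sigma> Weights (set_encode (X c - T i)) = weight T f i (X c - T i)"
      using wt[OF d(1)] weight_Suc_diff[of T f i "X c"] unfolding d(2) by (simp split: if_splits)
    have wc: "\<sigma> Weights (set_encode (X c)) = weight T f i (X c)"
      using wt[OF c] by simp
    have upd_other: "set_encode (X d) = set_encode (X c) \<longleftrightarrow> d = c" if "d < n" for d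
      using mask_eq_iff[OF small_subset[OF X_small[OF that]] small_subset[OF X_small[OF c]]] X_inj that c
      by (auto simp: inj_on_def)
    have w_le: "Suc (weight T f i (X c - T i)) \<le> 2 ^ b"
      using weight_le[of T f i "X c - T i"] b(3) by linarith
    have final: "J i (Suc c) (upd \<sigma>' RC 0 (Suc c))"
      if "agree {RJ, RPow, RAcc, RBit, Weights} \<sigma> \<sigma>'"
        "\<sigma>' Weights = (\<sigma> Weights)(set_encode (X c) := weight T f (Suc i) (X c))" for \<sigma>'
    proof -
      have "agree {RI, RC, RJ, RPow, RAcc, RBit, Weights} \<sigma>0 \<sigma>'"
        using agree_trans[OF agree that(1)] by simp
      moreover have "\<sigma>' RI 0 = i" using that(1) regs by (auto simp: agree_def)
      moreover have "\<sigma>' Weights (set_encode (X d)) = weight T f (if d < Suc c then Suc i else i) (X d)"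
        if "d < n" for d
        using wt[OF that] upd_other[OF that] \<open>\<sigma>' Weights = _\<close> by (auto simp: less_Suc_eq)
      ultimately show ?thesis by (auto simp: J_def)
    qed
    have diff: "hr diff_prog (\<lambda>\<sigma>'. agree {RJ, RPow, RAcc, RBit} \<sigma> \<sigma>' \<and> \<sigma>' RAcc 0 = set_encode (X c - T i)) \<sigma>"
      by (rule diff_spec) (use masks regs i small_subset[OF X_small[OF c]] in auto)
    show ?thesis
      unfolding block.simps
    proof (rule hoare_Seq, rule hoare_mono[OF diff])
      fix \<sigma>' assume *: "agree {RJ, RPow, RAcc, RBit} \<sigma> \<sigma>' \<and> \<sigma>' RAcc 0 = set_encode (X c - T i)"
      then have ag: "agree {RJ, RPow, RAcc, RBit, Weights} \<sigma> \<sigma>'" by (auto simp: agree_def)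
      have e: "\<sigma>' RC 0 = c" "\<sigma>' Masks c = set_encode (X c)" "\<sigma>' Weights = \<sigma> Weights"
        "\<sigma>' RAcc 0 = set_encode (X c - T i)"
        using * regs masks by (auto simp: agree_def)
      have 1: "J i (Suc c) (upd \<sigma>' RC 0 (Suc c))" if "weight T f i (X c) \<le> Suc (weight T f i (X c - T i))"
      proof (rule final[OF ag])
        show "\<sigma>' Weights = (\<sigma> Weights)(set_encode (X c) := weight T f (Suc i) (X c))"
          using that e(3) wc by (auto simp: weight.simps)
      qed
      have 2: "J i (Suc c) (upd (upd \<sigma>' Weights (set_encode (X c)) (Suc (weight T f i (X c - T i)))) RC 0 (Suc c))"
        if "\<not> weight T f i (X c) \<le> Suc (weight T f i (X c - T i))"
      proof (rule final)
        show "agree {RJ, RPow, RAcc, RBit, Weights} \<sigma> (upd \<sigma>' Weights (set_encode (X c)) (Suc (weight T f i (X c - T i))))"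
          using ag by simp
        show "upd \<sigma>' Weights (set_encode (X c)) (Suc (weight T f i (X c - T i))) Weights =
            (\<sigma> Weights)(set_encode (X c) := weight T f (Suc i) (X c))"
          using that e(3) by (simp add: weight.simps)
      qed
      show "hr (Seq (cond (Cell Weights (Cell Masks (Reg RC)) \<ominus> (Cell Weights (Reg RAcc) \<oplus> Num 1))
       (assign Weights (Cell Masks (Reg RC)) (Cell Weights (Reg RAcc) \<oplus> Num 1)) Skip) Skip)
         (\<lambda>\<sigma>'. \<sigma>' RC 0 = c \<and> J i (Suc c) (upd \<sigma>' RC 0 (Suc c))) \<sigma>'"
        using 1 2 w_le e wc wd by (intro hoare_intros) (auto simp: not_le)
    qed
  qed
  have inner: "hr (for_loop RC (Reg RN) ?body) (\<lambda>\<sigma>'. \<sigma>' RI 0 = i \<and> I (Suc i) (upd \<sigma>' RI 0 (Suc i))) \<sigma>"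
    if i: "i < f" and I: "I i \<sigma>" for i \<sigma>
  proof (rule hoare_for[where n = n and I = "J i"])
    fix c \<sigma>' assume "c \<le> n" "J i c \<sigma>'"
    then show "aval (Reg RN) \<sigma>' = n" by (auto simp: J_def agree_def n_def)
  next
    fix \<sigma>' assume "J i n \<sigma>'"
    then show "\<sigma>' RI 0 = i \<and> I (Suc i) (upd \<sigma>' RI 0 (Suc i))" by (auto simp: J_def I_def)
  next
    show "J i 0 (upd \<sigma> RC 0 0)" using I by (auto simp: I_def J_def)
  qed (use n body[OF i] in \<open>auto simp: J_def\<close>)
  have post: "agree {RI, RC, RJ, RPow, RAcc, RBit, Weights} \<sigma>0 \<sigma> \<and>
      (\<forall>Y\<in>small. \<sigma> Weights (set_encode Y) = weight T f f Y)" if "I f \<sigma>" for \<sigma>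
    using that unfolding I_def X_img[symmetric] by auto
  show ?thesis
    unfolding weight_prog_def
  proof (rule hoare_for[where n = f and I = I])
    show "I 0 (upd \<sigma>0 RI 0 0)" using wt0 X_small by (auto simp: I_def)
    fix i \<sigma> assume "i \<le> f" "I i \<sigma>"
    then show "aval (Reg RF) \<sigma> = f" using assms by (auto simp: I_def agree_def)
  next
    fix \<sigma> assume "I f \<sigma>"
    then show "agree {RI, RC, RJ, RPow, RAcc, RBit, Weights} \<sigma>0 \<sigma> \<and>
      (\<forall>Y\<in>small. \<sigma> Weights (set_encode Y) = weight T f f Y)" by (rule post)
  next
    fix i \<sigma> assume "i < f" "I i \<sigma>"
    then show "hr (for_loop RC (Reg RN) ?body) (\<lambda>\<sigma>'. \<sigma>' RI 0 = i \<and> I (Suc i) (upd \<sigma>' RI 0 (Suc i))) \<sigma>"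
      by (rule inner)
  qed (use Z b in \<open>auto simp: I_def\<close>)
qed

lemma mask_spec:
  assumes "\<sigma>0 RU 0 = u" "\<sigma>0 RI 0 = i" "i < f"
  shows "hr mask_prog (\<lambda>\<sigma>. agree {RJ, RPow, RAcc, RLen, RBit} \<sigma>0 \<sigma> \<and> \<sigma> RAcc 0 = set_encode (T i) \<and>
    \<sigma> RLen 0 = card (T i)) \<sigma>0"
proof -
  define I where "I j \<sigma> \<longleftrightarrow> agree {RJ, RPow, RAcc, RLen, RBit} \<sigma>0 \<sigma> \<and> \<sigma> RJ 0 = j \<and> \<sigma> RPow 0 = 2 ^ j \<and>
    \<sigma> RAcc 0 = set_encode (T i \<inter> {..<j}) \<and> \<sigma> RLen 0 = card (T i \<inter> {..<j})" for j \<sigma>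
  have loop: "hr (for_loop RJ (Reg RU) (block
      [read_input RBit (Num 2 \<oplus> Reg RI \<otimes> Reg RU \<oplus> Reg RJ),
       set_reg RAcc (Reg RAcc \<oplus> Reg RPow \<otimes> Reg RBit),
       set_reg RLen (Reg RLen \<oplus> Reg RBit),
       set_reg RPow (Num 2 \<otimes> Reg RPow)])) (I u) \<sigma>" if "I 0 (upd \<sigma> RJ 0 0)" for \<sigma>
  proof (rule hoare_for[where n = u and I = I])
    fix j \<sigma> assume j: "j < u" "I j \<sigma>"
    then have regs: "\<sigma> RU 0 = u" "\<sigma> RI 0 = i" "\<sigma> RJ 0 = j" "\<sigma> RPow 0 = 2 ^ j"
      "\<sigma> RAcc 0 = set_encode (T i \<inter> {..<j})" "\<sigma> RLen 0 = card (T i \<inter> {..<j})"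
      using assms by (auto simp: I_def agree_def)
    have acc_le: "set_encode (T i \<inter> {..<Suc j}) \<le> 2 ^ b"
      using j by (intro mask_le) auto
    have card_le: "card (T i \<inter> {..<Suc j}) \<le> 2 ^ b"
      using card_mono[of "{..<Suc j}" "T i \<inter> {..<Suc j}"] j b(1) by simp
    have "i * u + j < f * u"
    proof -
      have "i * u + j < (i + 1) * u" using j by simp
      also have "\<dots> \<le> f * u" using assms(3) by (intro mult_le_mono1) auto
      finally show ?thesis .
    qed
    then have addr: "2 + i * u + j < base" by (simp add: base_def mult.commute)
    have "2 * 2 ^ j \<le> (2::nat) ^ b" using pow_le[of "Suc j"] j by simp
    then show "hr (block [read_input RBit (Num 2 \<oplus> Reg RI \<otimes> Reg RU \<oplus> Reg RJ),
       set_reg RAcc (Reg RAcc \<oplus> Reg RPow \<otimes> Reg RBit),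
       set_reg RLen (Reg RLen \<oplus> Reg RBit),
       set_reg RPow (Num 2 \<otimes> Reg RPow)]) (\<lambda>\<sigma>'. \<sigma>' RJ 0 = j \<and> I (Suc j) (upd \<sigma>' RJ 0 (Suc j))) \<sigma>"
      using j(2) addr acc_le card_le inp_set[OF assms(3) j(1)]
      unfolding block.simps set_encode_restrict_Suc card_restrict_Suc
      by (cases "j \<in> T i"; intro hoare_intros)
        (simp_all add: regs I_def set_encode_restrict_Suc card_restrict_Suc)
  qed (use that Z b assms(1) in \<open>auto simp: I_def agree_def\<close>)
  have fin: "T i \<inter> {..<u} = T i" using T_subset[OF assms(3)] by auto
  show ?thesis
    unfolding mask_prog_def block.simps
  proof (intro hoare_Seq hoare_assign hoare_mono[OF loop[unfolded block.simps]], goal_cases)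
    case (5 \<sigma>')
    then show ?case by (intro hoare_Skip) (auto simp: I_def fin)
  qed (use b in \<open>auto simp: I_def\<close>)
qed

text \<open>The weight 1 is written only under masks of large sets. They differ from the masks of
  all small sets, so the weights computed before survive; distinctness among the large sets comes
  from \<open>T_inj\<close>.\<close>

lemma large_spec:
  assumes "\<sigma>0 RU 0 = u" "\<sigma>0 RF 0 = f" "\<sigma>0 RS 0 = s" "enumerates X0 small \<sigma>0"
    and wt0: "\<And>Y. Y \<in> small \<Longrightarrow> \<sigma>0 Weights (set_encode Y) = weight T f f Y"
  shows "hr large_prog (\<lambda>\<sigma>. agree {RI, RN, RJ, RPow, RAcc, RLen, RBit, Masks, Weights} \<sigma>0 \<sigma> \<and>
    (\<exists>X. enumerates X (small \<union> large) \<sigma>) \<and>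
    (\<forall>Y\<in>small \<union> large. \<sigma> Weights (set_encode Y) = part_weight T f s Y)) \<sigma>0"
proof -
  define C where "C i = small \<union> large_sets T i s" for i
  define I where "I i \<sigma> \<longleftrightarrow> agree {RI, RN, RJ, RPow, RAcc, RLen, RBit, Masks, Weights} \<sigma>0 \<sigma> \<and> \<sigma> RI 0 = i \<and>
    (\<exists>X. enumerates X (C i) \<sigma>) \<and> (\<forall>Y\<in>C i. \<sigma> Weights (set_encode Y) = part_weight T f s Y)" for i \<sigma>
  have C_mono: "C i \<subseteq> small \<union> large" if "i \<le> f" for i
  proof -
    have "large_sets T i s \<subseteq> large"
    proof
      fix Y assume "Y \<in> large_sets T i s"
      then obtain j where "j < i" "Y = T j" "s < card Y" by (auto simp: large_sets_def)
      then show "Y \<in> large" using that by (auto simp: large_sets_def intro!: exI[of _ j])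
    qed
    then show ?thesis by (auto simp: C_def)
  qed
  let ?body = "block [mask_prog,
     cond (Reg RLen \<ominus> Reg RS) (block
      [assign Masks (Reg RN) (Reg RAcc),
       assign Weights (Reg RAcc) (Num 1),
       set_reg RN (Reg RN \<oplus> Num 1)]) Skip]"
  have body: "hr ?body (\<lambda>\<sigma>'. \<sigma>' RI 0 = i \<and> I (Suc i) (upd \<sigma>' RI 0 (Suc i))) \<sigma>"
    if i: "i < f" and I: "I i \<sigma>" for i \<sigma>
  proof -
    let ?A = "{RI, RN, RJ, RPow, RAcc, RLen, RBit, Masks, Weights}"
    obtain X where X: "enumerates X (C i) \<sigma>" using I unfolding I_def by blast
    have agree: "agree ?A \<sigma>0 \<sigma>" and wt: "\<And>Y. Y \<in> C i \<Longrightarrow> \<sigma> Weights (set_encode Y) = part_weight T f s Y"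
      and regs: "\<sigma> RI 0 = i" "\<sigma> RU 0 = u" "\<sigma> RS 0 = s"
      using I assms by (auto simp: I_def agree_def)
    have CSuc: "C (Suc i) = (if s < card (T i) then insert (T i) (C i) else C i)"
      by (auto simp: C_def large_sets_Suc)
    have mask: "hr mask_prog (\<lambda>\<sigma>'. agree {RJ, RPow, RAcc, RLen, RBit} \<sigma> \<sigma>' \<and> \<sigma>' RAcc 0 = set_encode (T i) \<and>
       \<sigma>' RLen 0 = card (T i)) \<sigma>"
      by (rule mask_spec) (use regs i in auto)
    show ?thesis
      unfolding block.simps
    proof (rule hoare_Seq, rule hoare_mono[OF mask])
      fix \<sigma>' assume *: "agree {RJ, RPow, RAcc, RLen, RBit} \<sigma> \<sigma>' \<and> \<sigma>' RAcc 0 = set_encode (T i) \<and>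
        \<sigma>' RLen 0 = card (T i)"
      have agree': "agree ?A \<sigma>0 \<sigma>'"
        using agree_trans[OF agree conjunct1[OF *]] by auto
      have regs': "\<sigma>' RI 0 = i" "\<sigma>' RU 0 = u" "\<sigma>' RS 0 = s" "\<sigma>' RN = \<sigma> RN" "\<sigma>' Masks = \<sigma> Masks"
        "\<sigma>' Weights = \<sigma> Weights" "\<sigma>' RAcc 0 = set_encode (T i)" "\<sigma>' RLen 0 = card (T i)"
        using * regs by (auto simp: agree_def)
      have X': "enumerates X (C i) \<sigma>'" using X regs' by (auto simp: enumerates_def)
      have small_case: "I (Suc i) (upd \<sigma>' RI 0 (Suc i))" if "\<not> s < card (T i)"
        using that CSuc X' agree' regs' wt by (auto simp: I_def enumerates_def)
      define \<sigma>1 where "\<sigma>1 = upd (upd (upd \<sigma>' Masks (\<sigma>' RN 0) (set_encode (T i))) Weights (set_encode (T i)) 1)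
          RN 0 (Suc (\<sigma>' RN 0))"
      have large_case: "I (Suc i) (upd \<sigma>1 RI 0 (Suc i))" "Suc (\<sigma>' RN 0) \<le> 2 ^ b" if s: "s < card (T i)"
      proof -
        have new: "T i \<notin> C i"
        proof
          assume "T i \<in> C i"
          then obtain j where j: "j < i" "T i = T j" using s by (auto simp: C_def small_sets_def large_sets_def)
          then show False using inj_onD[OF T_inj j(2)] i by simp
        qed
        have en: "enumerates (X(\<sigma>' RN 0 := T i)) (C (Suc i)) \<sigma>1"
          using enumerates_insert[OF X' new, of \<sigma>1] s CSuc by (simp add: \<sigma>1_def)
        then have "Suc (\<sigma>' RN 0) = card (C (Suc i))"
          using enumerates_card by (fastforce simp: \<sigma>1_def)
        then show "Suc (\<sigma>' RN 0) \<le> 2 ^ b" using card_parts_le(2)[OF C_mono[of "Suc i"]] i by simp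
        have "\<sigma>1 Weights (set_encode Y) = part_weight T f s Y" if "Y \<in> C (Suc i)" for Y
        proof (cases "Y = T i")
          case True
          then show ?thesis using s by (simp add: \<sigma>1_def part_weight_def)
        next
          case False
          then have Y: "Y \<in> C i" using that CSuc by (auto split: if_splits)
          then have "Y \<subseteq> {..<u}" using C_mono[of i] i parts_subset by auto
          then have "set_encode Y \<noteq> set_encode (T i)"
            using False mask_eq_iff[OF _ T_subset[OF i]] by blast
          then show ?thesis using wt[OF Y] regs' by (simp add: \<sigma>1_def)
        qed
        moreover have "enumerates (X(\<sigma>' RN 0 := T i)) (C (Suc i)) (upd \<sigma>1 RI 0 (Suc i))"
          using en by (simp add: enumerates_def)
        ultimately show "I (Suc i) (upd \<sigma>1 RI 0 (Suc i))"
          using agree' unfolding I_def by (auto simp: \<sigma>1_def)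
      qed
      have RI: "\<sigma>1 RI 0 = i" using regs' by (simp add: \<sigma>1_def)
      show "hr (Seq (cond (Reg RLen \<ominus> Reg RS) (Seq (assign Masks (Reg RN) (Reg RAcc))
       (Seq (assign Weights (Reg RAcc) (Num 1)) (Seq (set_reg RN (Reg RN \<oplus> Num 1)) Skip))) Skip) Skip)
       (\<lambda>\<sigma>'. \<sigma>' RI 0 = i \<and> I (Suc i) (upd \<sigma>' RI 0 (Suc i))) \<sigma>'"
        using small_case large_case regs' RI mask_le[OF T_subset[OF i]] unfolding \<sigma>1_def
        by (intro hoare_intros) auto
    qed
  qed
  have post: "agree {RI, RN, RJ, RPow, RAcc, RLen, RBit, Masks, Weights} \<sigma>0 \<sigma> \<and>
    (\<exists>X. enumerates X (small \<union> large) \<sigma>) \<and>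
    (\<forall>Y\<in>small \<union> large. \<sigma> Weights (set_encode Y) = part_weight T f s Y)" if "I f \<sigma>" for \<sigma>
    using that by (simp add: I_def C_def)
  have C0: "C 0 = small" by (auto simp: C_def large_sets_def)
  show ?thesis
    unfolding large_prog_def
  proof (rule hoare_for[where n = f and I = I])
    have "part_weight T f s Y = weight T f f Y" if "Y \<in> small" for Y
      using that by (simp add: small_sets_def part_weight_def)
    then show "I 0 (upd \<sigma>0 RI 0 0)"
      using wt0 assms(4) unfolding I_def C0 by (auto simp: enumerates_def)
    fix i \<sigma> assume "i \<le> f" "I i \<sigma>"
    then show "aval (Reg RF) \<sigma> = f" using assms by (auto simp: I_def agree_def)
  next
    fix i \<sigma> assume "i < f" "I i \<sigma>"
    then show "hr ?body (\<lambda>\<sigma>'. \<sigma>' RI 0 = i \<and> I (Suc i) (upd \<sigma>' RI 0 (Suc i))) \<sigma>"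
      by (rule body)
  next
    fix \<sigma> assume "I f \<sigma>"
    then show "agree {RI, RN, RJ, RPow, RAcc, RLen, RBit, Masks, Weights} \<sigma>0 \<sigma> \<and>
      (\<exists>X. enumerates X (small \<union> large) \<sigma>) \<and>
      (\<forall>Y\<in>small \<union> large. \<sigma> Weights (set_encode Y) = part_weight T f s Y)" by (rule post)
  qed (use Z b in \<open>auto simp: I_def\<close>)
qed

end

section \<open>Writing out the instance of Orthogonal Vectors\<close>

lemma char_vector_tagged:
  "char_vector (u + K) (tagged u K i g Y) =
    map (\<lambda>j. of_bool (j \<notin> Y)) [0..<u] @ map (\<lambda>j. of_bool (j \<noteq> i \<or> \<not> g)) [0..<K]"
  by (rule nth_equalityI) (auto simp: char_vector_def tagged_def nth_append simp del: upt_Suc)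

lemma length_char_vector [simp]: "length (char_vector d S) = d"
  by (simp add: char_vector_def)

lemma length_concat_const: "(\<And>x. x \<in> set xs \<Longrightarrow> length (g x) = d) \<Longrightarrow> length (concat (map g xs)) = length xs * d"
  by (induction xs) auto

lemma concat_concat_map: "concat (concat xsss) = concat (map concat xsss)"
  by (induction xsss) auto

text \<open>Equality with \<open>load xs\<close> on all cells says that the array is blank behind
  the output. So it is exactly an initial memory for the simulated solver.\<close>

definition holds_output :: "nat list \<Rightarrow> store \<Rightarrow> bool" where
  "holds_output xs \<sigma> \<longleftrightarrow> \<sigma> OvMem = load xs \<and> \<sigma> RPos 0 = length xs"

lemma holds_output_snoc:
  "holds_output xs \<sigma> \<Longrightarrow> holds_output (xs @ [v]) (upd (upd \<sigma> OvMem (length xs) v) RPos 0 (Suc (length xs)))"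
  by (simp add: holds_output_def load_snoc)

lemma holds_output_upd [simp]:
  "r \<noteq> OvMem \<Longrightarrow> r \<noteq> RPos \<Longrightarrow> holds_output xs (upd \<sigma> r i v) = holds_output xs \<sigma>"
  by (simp add: holds_output_def)

context reduction
begin

lemma hoare_emit:
  assumes "holds_output xs \<sigma>" "(\<And>r i. \<sigma> r i \<le> 2 ^ b) \<Longrightarrow> aval e \<sigma> \<le> 2 ^ b"
    and "Suc (length xs) \<le> 2 ^ b"
    and "\<And>\<sigma>'. agree {OvMem, RPos} \<sigma> \<sigma>' \<Longrightarrow> holds_output (xs @ [aval e \<sigma>]) \<sigma>' \<Longrightarrow> Q \<sigma>'"
  shows "hr (emit e) Q \<sigma>"
  unfolding emit_def
proof (intro hoare_Seq hoare_assign)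
  have pos: "\<sigma> RPos 0 = length xs" using assms(1) by (simp add: holds_output_def)
  then have "Q (upd (upd \<sigma> OvMem (length xs) (aval e \<sigma>)) RPos 0 (Suc (length xs)))"
    using holds_output_snoc[OF assms(1)] by (intro assms(4)) auto
  then show "Q (upd (upd \<sigma> OvMem (aval (Reg RPos) \<sigma>) (aval e \<sigma>)) RPos
     (aval (Num 0) (upd \<sigma> OvMem (aval (Reg RPos) \<sigma>) (aval e \<sigma>)))
     (aval (Reg RPos \<oplus> Num 1) (upd \<sigma> OvMem (aval (Reg RPos) \<sigma>) (aval e \<sigma>))))"
    using pos by simp
  show "aval (Reg RPos \<oplus> Num 1) (upd \<sigma> OvMem (aval (Reg RPos) \<sigma>) (aval e \<sigma>)) \<le> 2 ^ b"
    using assms(3) pos by simp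
qed (rule assms(2))

lemma vector_spec:
  assumes regs: "\<sigma>0 RU 0 = u" "\<sigma>0 RI 0 = i" "\<sigma>0 Masks (\<sigma>0 RC 0) = set_encode Y" "Y \<subseteq> {..<u}"
    and out: "holds_output xs \<sigma>0" "length xs + (u + K) \<le> 2 ^ b" and K: "K \<le> Z" "K \<le> 2 ^ b"
    and g: "g \<longleftrightarrow> \<sigma>0 Weights (set_encode Y) \<le> \<sigma>0 RThr 0"
  shows "hr (vector_prog K) (\<lambda>\<sigma>. agree {RPow, RJ, OvMem, RPos} \<sigma>0 \<sigma> \<and>
    holds_output (xs @ char_vector (u + K) (tagged u K i g Y)) \<sigma>) \<sigma>0"
proof -
  let ?A = "{RPow, RJ, OvMem, RPos}"
  define us where "us j = map (\<lambda>j. of_bool (j \<notin> Y) :: nat) [0..<j]" for j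
  define ks where "ks j = map (\<lambda>j. of_bool (j \<noteq> i \<or> \<not> g) :: nat) [0..<j]" for j
  have len [simp]: "length (us j) = j" "length (ks j) = j" for j by (auto simp: us_def ks_def)
  have finY: "finite Y" using regs(4) finite_subset by blast
  define I where "I j \<sigma> \<longleftrightarrow> agree ?A \<sigma>0 \<sigma> \<and> \<sigma> RJ 0 = j \<and> \<sigma> RPow 0 = 2 ^ j \<and> holds_output (xs @ us j) \<sigma>" for j \<sigma>
  define I' where "I' j \<sigma> \<longleftrightarrow> agree ?A \<sigma>0 \<sigma> \<and> \<sigma> RJ 0 = j \<and> holds_output (xs @ us u @ ks j) \<sigma>" for j \<sigma>
  let ?e = "Num 1 \<ominus> bit_at (Cell Masks (Reg RC)) (Reg RPow)"
  let ?body = "Seq (emit ?e) (Seq (set_reg RPow (Num 2 \<otimes> Reg RPow)) Skip)"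
  have body: "hr ?body (\<lambda>\<sigma>'. \<sigma>' RJ 0 = j \<and> I (Suc j) (upd \<sigma>' RJ 0 (Suc j))) \<sigma>" if j: "j < u" "I j \<sigma>" for j \<sigma>
  proof -
    have ag: "agree ?A \<sigma>0 \<sigma>" and r: "\<sigma> RJ 0 = j" "\<sigma> RPow 0 = 2 ^ j" and ho: "holds_output (xs @ us j) \<sigma>"
      using j by (auto simp: I_def)
    have m: "\<sigma> Masks (\<sigma> RC 0) = set_encode Y" using ag regs by (auto simp: agree_def)
    have bit: "set_encode Y div 2 ^ j - 2 * (set_encode Y div 2 ^ j div 2) = of_bool (j \<in> Y)"
      unfolding minus_mult_div_eq_mod using bit_set_encode[OF finY] .
    have e: "aval ?e \<sigma> = of_bool (j \<notin> Y)" using m r bit by simp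
    have us: "us (Suc j) = us j @ [of_bool (j \<notin> Y)]" by (simp add: us_def)
    have pow: "2 * 2 ^ j \<le> (2::nat) ^ b" using pow_le[of "Suc j"] j by simp
    show ?thesis
    proof (rule hoare_Seq, rule hoare_emit[OF ho])
      fix \<sigma>' assume *: "agree {OvMem, RPos} \<sigma> \<sigma>'" "holds_output ((xs @ us j) @ [aval ?e \<sigma>]) \<sigma>'"
      have "agree ?A \<sigma>0 \<sigma>'" using agree_trans[OF ag *(1)] by simp
      moreover have "\<sigma>' RJ 0 = j" "\<sigma>' RPow 0 = 2 ^ j" using *(1) r by (auto simp: agree_def)
      moreover have "holds_output (xs @ us (Suc j)) \<sigma>'" using *(2) unfolding e us by simp
      ultimately show "hr (Seq (set_reg RPow (Num 2 \<otimes> Reg RPow)) Skip)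
          (\<lambda>\<sigma>'. \<sigma>' RJ 0 = j \<and> I (Suc j) (upd \<sigma>' RJ 0 (Suc j))) \<sigma>'"
        using pow by (intro hoare_intros) (simp_all add: I_def)
    next
      show "aval ?e \<sigma> \<le> 2 ^ b" unfolding e by simp
      show "Suc (length (xs @ us j)) \<le> 2 ^ b" using out j by simp
    qed
  qed
  let ?e' = "Num 1 \<ominus> (Num 1 \<ominus> ((Reg RJ \<ominus> Reg RI) \<oplus> (Reg RI \<ominus> Reg RJ))) \<otimes>
       (Num 1 \<ominus> (Cell Weights (Cell Masks (Reg RC)) \<ominus> Reg RThr))"
  have body': "hr (emit ?e') (\<lambda>\<sigma>'. \<sigma>' RJ 0 = j \<and> I' (Suc j) (upd \<sigma>' RJ 0 (Suc j))) \<sigma>" if j: "j < K" "I' j \<sigma>" for j \<sigma>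
  proof -
    have ag: "agree ?A \<sigma>0 \<sigma>" and r: "\<sigma> RJ 0 = j" and ho: "holds_output (xs @ us u @ ks j) \<sigma>"
      using j by (auto simp: I'_def)
    have m: "\<sigma> Masks (\<sigma> RC 0) = set_encode Y" "\<sigma> RI 0 = i" "\<sigma> Weights = \<sigma>0 Weights" "\<sigma> RThr = \<sigma>0 RThr"
      using ag regs by (auto simp: agree_def)
    have "aval ?e' \<sigma> = 1 - (1 - ((j - i) + (i - j))) * (1 - (\<sigma>0 Weights (set_encode Y) - \<sigma>0 RThr 0))"
      using m r by simp
    also have "\<dots> = of_bool (j \<noteq> i \<or> \<not> g)" by (cases "j = i"; cases g) (use g in auto)
    finally have e: "aval ?e' \<sigma> = of_bool (j \<noteq> i \<or> \<not> g)" .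
    have ks: "ks (Suc j) = ks j @ [of_bool (j \<noteq> i \<or> \<not> g)]" by (simp add: ks_def)
    show ?thesis
    proof (rule hoare_emit[OF ho])
      fix \<sigma>' assume *: "agree {OvMem, RPos} \<sigma> \<sigma>'" "holds_output ((xs @ us u @ ks j) @ [aval ?e' \<sigma>]) \<sigma>'"
      have "agree ?A \<sigma>0 \<sigma>'" using agree_trans[OF ag *(1)] by simp
      moreover have "\<sigma>' RJ 0 = j" using *(1) r by (auto simp: agree_def)
      moreover have "holds_output (xs @ us u @ ks (Suc j)) \<sigma>'" using *(2) unfolding e ks by simp
      ultimately show "\<sigma>' RJ 0 = j \<and> I' (Suc j) (upd \<sigma>' RJ 0 (Suc j))" by (simp add: I'_def)
    next
      show "aval ?e' \<sigma> \<le> 2 ^ b" unfolding e by simp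
      show "Suc (length (xs @ us u @ ks j)) \<le> 2 ^ b" using out j by simp
    qed
  qed
  have loop: "hr (for_loop RJ (Reg RU) ?body) (I u) \<sigma>" if "I 0 (upd \<sigma> RJ 0 0)" for \<sigma>
    by (rule hoare_for[where n = u and I = I, OF _ _ _ _ _ body])
      (use that Z b regs in \<open>auto simp: I_def agree_def\<close>)
  have loop': "hr (for_loop RJ (Num K) (emit ?e')) (I' K) \<sigma>" if "I' 0 (upd \<sigma> RJ 0 0)" for \<sigma>
    by (rule hoare_for[where n = K and I = I', OF _ _ _ _ _ body'])
      (use that K in \<open>auto simp: I'_def\<close>)
  have cv: "char_vector (u + K) (tagged u K i g Y) = us u @ ks K"
    unfolding char_vector_tagged us_def ks_def ..
  show ?thesis
    unfolding vector_prog_def block.simps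
  proof (intro hoare_Seq hoare_assign hoare_mono[OF loop] hoare_mono[OF loop'], goal_cases)
    case 2
    show ?case using out by (simp add: I_def us_def)
  next
    case (3 \<sigma>)
    then show ?case by (simp add: I_def I'_def ks_def)
  next
    case (4 \<sigma> \<sigma>')
    then show ?case by (intro hoare_Skip) (simp add: I'_def cv)
  qed simp
qed

lemma quota_spec:
  assumes "\<sigma> RI 0 = i" "\<sigma> RT 0 = t" "i < 2 * k" "Q (upd \<sigma> RThr 0 (quota k t i))"
  shows "hr (quota_prog k) Q \<sigma>"
proof -
  have "quota k t i \<le> 2 ^ b" using quota_le[OF k assms(3), of t] t b by linarith
  then show ?thesis
    using assms unfolding quota_prog_def by (intro hoare_intros) (auto simp: quota_def)
qed

lemma output_spec:
  assumes regs: "\<sigma>0 RU 0 = u" "\<sigma>0 RT 0 = t" and X: "enumerates X (small \<union> large) \<sigma>0"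
    and wt: "\<And>Y. Y \<in> small \<union> large \<Longrightarrow> \<sigma>0 Weights (set_encode Y) = part_weight T f s Y"
    and out: "holds_output [] \<sigma>0"
  defines "V \<equiv> \<lambda>i Y. tagged u (2 * k) i (part_weight T f s Y \<le> quota k t i) Y"
  shows "hr (output_prog k) (holds_output (ov_input (u + 2 * k) (card (small \<union> large))
     (map (\<lambda>i. map (\<lambda>c. V i (X c)) [0..<card (small \<union> large)]) [0..<2 * k]))) \<sigma>0"
proof -
  define n where "n = card (small \<union> large)"
  let ?d = "u + 2 * k" and ?A = "{RI, RC, RThr, RPow, RJ, OvMem, RPos}"
  have RN: "\<sigma>0 RN 0 = n" using enumerates_card[OF X] by (simp add: n_def)
  have bound: "2 + 2 * k * n * ?d \<le> 2 ^ b" using b(4) by (simp add: n_def)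
  define row where "row i c = concat (map (\<lambda>c. char_vector ?d (V i (X c))) [0..<c])" for i c
  define rows where "rows i = concat (map (\<lambda>i. row i n) [0..<i])" for i
  have len_row: "length (row i c) = c * ?d" for i c
    unfolding row_def by (subst length_concat_const[where d = ?d]) auto
  have len_rows: "length (rows i) = i * (n * ?d)" for i
    unfolding rows_def by (subst length_concat_const[where d = "n * ?d"]) (auto simp: len_row)
  define I where "I i \<sigma> \<longleftrightarrow> agree ?A \<sigma>0 \<sigma> \<and> \<sigma> RI 0 = i \<and> holds_output (?d # n # rows i) \<sigma>" for i \<sigma>
  define J where "J i c \<sigma> \<longleftrightarrow> agree ?A \<sigma>0 \<sigma> \<and> \<sigma> RI 0 = i \<and> \<sigma> RC 0 = c \<and> \<sigma> RThr 0 = quota k t i \<and>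
    holds_output (?d # n # rows i @ row i c) \<sigma>" for i c \<sigma>
  have vec: "hr (vector_prog (2 * k)) (\<lambda>\<sigma>'. \<sigma>' RC 0 = c \<and> J i (Suc c) (upd \<sigma>' RC 0 (Suc c))) \<sigma>"
    if i: "i < 2 * k" and c: "c < n" and J: "J i c \<sigma>" for i c \<sigma>
  proof -
    have ag: "agree ?A \<sigma>0 \<sigma>" and r: "\<sigma> RI 0 = i" "\<sigma> RC 0 = c" "\<sigma> RThr 0 = quota k t i"
      and ho: "holds_output (?d # n # rows i @ row i c) \<sigma>"
      using J by (auto simp: J_def)
    have Xc: "X c \<in> small \<union> large" "\<sigma>0 Masks c = set_encode (X c)"
      using enumerates_in[OF X, of c] X c RN by (auto simp: enumerates_def)
    have eqs: "\<sigma> RU 0 = u" "\<sigma> Masks = \<sigma>0 Masks" "\<sigma> Weights = \<sigma>0 Weights"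
      using ag regs by (auto simp: agree_def)
    have "i * (n * ?d) + c * ?d + ?d \<le> 2 * k * n * ?d"
    proof -
      have "i * (n * ?d) + c * ?d + ?d = (i * n + Suc c) * ?d" by (simp add: algebra_simps)
      also have "\<dots> \<le> (Suc i * n) * ?d" using c by (intro mult_le_mono1) simp
      also have "\<dots> \<le> (2 * k * n) * ?d" using i by (intro mult_le_mono1) simp
      finally show ?thesis .
    qed
    then have len: "length (?d # n # rows i @ row i c) + (u + 2 * k) \<le> 2 ^ b"
      using bound by (simp add: len_row len_rows)
    have "hr (vector_prog (2 * k)) (\<lambda>\<sigma>'. agree {RPow, RJ, OvMem, RPos} \<sigma> \<sigma>' \<and>
      holds_output ((?d # n # rows i @ row i c) @ char_vector ?d (V i (X c))) \<sigma>') \<sigma>"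
      unfolding V_def
      by (rule vector_spec[OF _ _ _ _ ho len]) (use eqs r Xc parts_subset wt Z b in auto)
    then show ?thesis
    proof (rule hoare_mono)
      fix \<sigma>' assume *: "agree {RPow, RJ, OvMem, RPos} \<sigma> \<sigma>' \<and>
        holds_output ((?d # n # rows i @ row i c) @ char_vector ?d (V i (X c))) \<sigma>'"
      have "agree ?A \<sigma>0 \<sigma>'" using agree_trans[OF ag conjunct1[OF *]] by simp
      moreover have "\<sigma>' RI 0 = i" "\<sigma>' RC 0 = c" "\<sigma>' RThr 0 = quota k t i"
        using * r by (auto simp: agree_def)
      moreover have "row i (Suc c) = row i c @ char_vector ?d (V i (X c))" by (simp add: row_def)
      ultimately show "\<sigma>' RC 0 = c \<and> J i (Suc c) (upd \<sigma>' RC 0 (Suc c))"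
        using * by (simp add: J_def)
    qed
  qed
  have n_le: "n \<le> Z" "n \<le> 2 ^ b" using card_parts_le[of "small \<union> large"] by (auto simp: n_def)
  have inner: "hr (for_loop RC (Reg RN) (vector_prog (2 * k))) (J i n) \<sigma>"
    if "i < 2 * k" "J i 0 (upd \<sigma> RC 0 0)" for i \<sigma>
    by (rule hoare_for[where n = n and I = "J i", OF _ _ _ _ _ vec[OF that(1)]])
      (use that(2) n_le RN in \<open>auto simp: J_def agree_def\<close>)
  have outer: "hr (block [quota_prog k, for_loop RC (Reg RN) (vector_prog (2 * k))])
      (\<lambda>\<sigma>'. \<sigma>' RI 0 = i \<and> I (Suc i) (upd \<sigma>' RI 0 (Suc i))) \<sigma>" if i: "i < 2 * k" and I: "I i \<sigma>" for i \<sigma>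
    unfolding block.simps
  proof (rule hoare_Seq, rule quota_spec[OF _ _ i], goal_cases)
    case 3
    have "J i 0 (upd (upd \<sigma> RThr 0 (quota k t i)) RC 0 0)"
      using I by (simp add: I_def J_def row_def)
    then show ?case
    proof (intro hoare_Seq hoare_mono[OF inner[OF i]])
      fix \<sigma>' assume J: "J i n \<sigma>'"
      have "rows (Suc i) = rows i @ row i n" by (simp add: rows_def)
      then show "hr Skip (\<lambda>\<sigma>'. \<sigma>' RI 0 = i \<and> I (Suc i) (upd \<sigma>' RI 0 (Suc i))) \<sigma>'"
        using J by (intro hoare_Skip) (simp add: J_def I_def)
    qed
  qed (use I regs in \<open>auto simp: I_def agree_def\<close>)
  have loop: "hr (for_loop RI (Num (2 * k)) (block [quota_prog k, for_loop RC (Reg RN) (vector_prog (2 * k))]))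
      (I (2 * k)) \<sigma>" if "I 0 (upd \<sigma> RI 0 0)" for \<sigma>
    by (rule hoare_for[where n = "2 * k" and I = I, OF _ _ _ _ _ outer])
      (use that Z b in \<open>auto simp: I_def\<close>)
  have ov: "ov_input ?d n (map (\<lambda>i. map (\<lambda>c. V i (X c)) [0..<n]) [0..<2 * k]) = ?d # n # rows (2 * k)"
    by (simp add: ov_input_def rows_def row_def map_concat comp_def concat_concat_map)
  show ?thesis
    unfolding output_prog_def block.simps n_def[symmetric] ov
  proof (rule hoare_Seq, rule hoare_emit[OF out], goal_cases)
    case (3 \<sigma>1)
    note ag1 = 3(1)
    have h1: "holds_output [?d] \<sigma>1" using 3(2) regs by simp
    show ?case
    proof (rule hoare_Seq, rule hoare_emit[OF h1], goal_cases)
      case (3 \<sigma>2)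
      have "agree ?A \<sigma>0 \<sigma>2" using agree_trans[OF ag1 3(1)] by (auto simp: agree_def)
      moreover have "\<sigma>1 RN 0 = n" using ag1 RN by (auto simp: agree_def)
      ultimately have "I 0 (upd \<sigma>2 RI 0 0)" using 3(2) by (simp add: I_def rows_def)
      then show ?case
        by (intro hoare_Seq hoare_mono[OF loop[unfolded block.simps]] hoare_Skip) (auto simp: I_def)
    qed (use bound b in auto)
  qed (use bound b regs in auto)
qed

text \<open>The order X of the candidates remains unspecified, which is harmless since an instance
  may list its families in any order.\<close>

lemma reduction_spec:
  defines "V \<equiv> \<lambda>i Y. tagged u (2 * k) i (part_weight T f s Y \<le> quota k t i) Y"
  shows "hr (reduction_prog k) (\<lambda>\<sigma>. \<exists>X. bij_betw X {..<card (small \<union> large)} (small \<union> large) \<and>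
    holds_output (ov_input (u + 2 * k) (card (small \<union> large))
     (map (\<lambda>i. map (\<lambda>c. V i (X c)) [0..<card (small \<union> large)]) [0..<2 * k])) \<sigma>) (\<lambda>_ _. 0)"
  unfolding reduction_prog_def block.simps
proof (rule hoare_Seq, rule hoare_mono[OF setup_spec])
  fix \<sigma>1
  assume 1: "agree {RU, RF, RS, RI, RBit, RT} (\<lambda>_ _. 0) \<sigma>1 \<and> \<sigma>1 RU 0 = u \<and> \<sigma>1 RF 0 = f \<and>
     \<sigma>1 RS 0 = s \<and> \<sigma>1 RT 0 = t"
  then have 1: "\<sigma>1 RU 0 = u" "\<sigma>1 RF 0 = f" "\<sigma>1 RS 0 = s" "\<sigma>1 RT 0 = t"
    "\<sigma>1 Masks = (\<lambda>_. 0)" "\<sigma>1 Sizes = (\<lambda>_. 0)" "\<sigma>1 Weights = (\<lambda>_. 0)" "\<sigma>1 OvMem = (\<lambda>_. 0)" "\<sigma>1 RPos = (\<lambda>_. 0)"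
    by (auto simp: agree_def)
  show "hr (Seq small_prog (Seq weight_prog (Seq large_prog (Seq (output_prog k) Skip))))
     (\<lambda>\<sigma>. \<exists>X. bij_betw X {..<card (small \<union> large)} (small \<union> large) \<and>
    holds_output (ov_input (u + 2 * k) (card (small \<union> large))
     (map (\<lambda>i. map (\<lambda>c. V i (X c)) [0..<card (small \<union> large)]) [0..<2 * k])) \<sigma>) \<sigma>1"
  proof (rule hoare_Seq, rule hoare_mono[OF small_spec])
    fix \<sigma>2
    assume *: "agree {RN, RPow, RI, RLen, RC, Masks, Sizes, Weights} \<sigma>1 \<sigma>2 \<and>
      (\<exists>X. enumerates X small \<sigma>2) \<and> (\<forall>Y\<in>small. \<sigma>2 Weights (set_encode Y) = weight T f 0 Y)"
    then obtain X2 where X2: "enumerates X2 small \<sigma>2" by blast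
    have 2: "\<sigma>2 RU 0 = u" "\<sigma>2 RF 0 = f" "\<sigma>2 RS 0 = s" "\<sigma>2 RT 0 = t" "\<sigma>2 OvMem = (\<lambda>_. 0)" "\<sigma>2 RPos = (\<lambda>_. 0)"
      "\<And>Y. Y \<in> small \<Longrightarrow> \<sigma>2 Weights (set_encode Y) = weight T f 0 Y"
      using * 1 by (auto simp: agree_def)
    show "hr (Seq weight_prog (Seq large_prog (Seq (output_prog k) Skip)))
     (\<lambda>\<sigma>. \<exists>X. bij_betw X {..<card (small \<union> large)} (small \<union> large) \<and>
      holds_output (ov_input (u + 2 * k) (card (small \<union> large))
      (map (\<lambda>i. map (\<lambda>c. V i (X c)) [0..<card (small \<union> large)]) [0..<2 * k])) \<sigma>) \<sigma>2"
    proof (rule hoare_Seq, rule hoare_mono[OF weight_spec[OF 2(1,2) X2 2(7)]])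
      fix \<sigma>3
      assume *: "agree {RI, RC, RJ, RPow, RAcc, RBit, Weights} \<sigma>2 \<sigma>3 \<and>
        (\<forall>Y\<in>small. \<sigma>3 Weights (set_encode Y) = weight T f f Y)"
      then have 3: "\<sigma>3 RU 0 = u" "\<sigma>3 RF 0 = f" "\<sigma>3 RS 0 = s" "\<sigma>3 RT 0 = t" "\<sigma>3 OvMem = (\<lambda>_. 0)" "\<sigma>3 RPos = (\<lambda>_. 0)"
        "\<And>Y. Y \<in> small \<Longrightarrow> \<sigma>3 Weights (set_encode Y) = weight T f f Y" "enumerates X2 small \<sigma>3"
        using 2 X2 by (auto simp: agree_def enumerates_def)
      show "hr (Seq large_prog (Seq (output_prog k) Skip))
       (\<lambda>\<sigma>. \<exists>X. bij_betw X {..<card (small \<union> large)} (small \<union> large) \<and>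
        holds_output (ov_input (u + 2 * k) (card (small \<union> large))
        (map (\<lambda>i. map (\<lambda>c. V i (X c)) [0..<card (small \<union> large)]) [0..<2 * k])) \<sigma>) \<sigma>3"
      proof (rule hoare_Seq, rule hoare_mono[OF large_spec[OF 3(1-3,8,7)]])
        fix \<sigma>4
        assume *: "agree {RI, RN, RJ, RPow, RAcc, RLen, RBit, Masks, Weights} \<sigma>3 \<sigma>4 \<and>
          (\<exists>X. enumerates X (small \<union> large) \<sigma>4) \<and>
          (\<forall>Y\<in>small \<union> large. \<sigma>4 Weights (set_encode Y) = part_weight T f s Y)"
        then obtain X where X: "enumerates X (small \<union> large) \<sigma>4" by blast
        have 4: "\<sigma>4 RU 0 = u" "\<sigma>4 RT 0 = t" "holds_output [] \<sigma>4"
          "\<And>Y. Y \<in> small \<union> large \<Longrightarrow> \<sigma>4 Weights (set_encode Y) = part_weight T f s Y"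
          using * 3 by (auto simp: agree_def holds_output_def load_def)
        have "bij_betw X {..<card (small \<union> large)} (small \<union> large)"
          using X enumerates_card[OF X] by (simp add: enumerates_def)
        then show "hr (Seq (output_prog k) Skip)
         (\<lambda>\<sigma>. \<exists>X. bij_betw X {..<card (small \<union> large)} (small \<union> large) \<and>
          holds_output (ov_input (u + 2 * k) (card (small \<union> large))
          (map (\<lambda>i. map (\<lambda>c. V i (X c)) [0..<card (small \<union> large)]) [0..<2 * k])) \<sigma>) \<sigma>4"
          unfolding V_def
          by (intro hoare_Seq hoare_mono[OF output_spec[OF 4(1,2) X 4(4,3)]] hoare_Skip) blast+
      qed
    qed
  qed (use 1 in auto)
qed

end

section \<open>Solving Set Cover\<close>

lemma nth_concat_const:
  assumes "\<And>x. x \<in> set xs \<Longrightarrow> length x = d" "i < length xs" "j < d"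
  shows "concat xs ! (i * d + j) = xs ! i ! j"
  using assms
proof (induction xs arbitrary: i)
  case (Cons x xs)
  then show ?case by (cases i) (auto simp: nth_append)
qed simp

lemma length_set_cover_input: "length (set_cover_input u Fs t) = 2 + u * length Fs + t"
  unfolding set_cover_input_def by (simp add: length_concat_const[where d = u])

lemma load_set_cover_input_0: "load (set_cover_input u Fs t) 0 = u"
  and load_set_cover_input_1: "load (set_cover_input u Fs t) 1 = length Fs"
  by (auto simp: load_def set_cover_input_def)

lemma load_set_cover_input_set:
  assumes "i < length Fs" "j < u"
  shows "load (set_cover_input u Fs t) (2 + i * u + j) = of_bool (Suc j \<in> Fs ! i)"
proof -
  let ?c = "concat (map (char_vector u) Fs)"
  have len: "length ?c = length Fs * u" by (rule length_concat_const) simp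
  have "i * u + j < Suc i * u" using assms by simp
  also have "\<dots> \<le> length Fs * u" using assms by (intro mult_le_mono1) simp
  finally have lt: "i * u + j < length ?c" using len by simp
  have "?c ! (i * u + j) = map (char_vector u) Fs ! i ! j"
    using assms by (intro nth_concat_const) auto
  also have "\<dots> = of_bool (Suc j \<in> Fs ! i)"
    using assms by (simp add: char_vector_def del: upt_Suc)
  finally show ?thesis
    using lt by (simp add: load_def set_cover_input_def nth_append)
qed

lemma load_set_cover_input_t:
  "load (set_cover_input u Fs t) (2 + u * length Fs + i) = of_bool (i < t)"
proof -
  have "length (concat (map (char_vector u) Fs)) = u * length Fs"
    by (subst length_concat_const[where d = u]) auto
  then show ?thesis by (simp add: load_def set_cover_input_def nth_append)
qed

lemma bounded_set_cover_input:
  assumes "u \<le> 2 ^ b" "length Fs \<le> 2 ^ b"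
  shows "bounded b (load (set_cover_input u Fs t))"
proof -
  have "x \<le> 2 ^ b" if "x \<in> set (set_cover_input u Fs t)" for x
    using that assms by (auto simp: set_cover_input_def char_vector_def)
  then show ?thesis by (auto simp: bounded_def load_def)
qed

text \<open>The cell numbered by \<open>base_expr\<close> would hold the (f + 1)-st unary digit of
  t. If it is set, then t > f and the answer is negative; otherwise the memory from there on is
  blank and available for the arrays.\<close>

definition main_prog :: "nat \<Rightarrow> prog \<Rightarrow> prog" where
  "main_prog k P = If (Mem base_expr) (Assign (Const 0) (Const 0))
     (Seq (reduction_prog k) (Seq (relocate OvMem P) (Assign (Const 0) (Mem (address OvMem (Const 0))))))"

lemma loop_depth_simps [simp]:
  "loop_depth (assign r i e) = 0"
  "loop_depth (read_input r e) = 0"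
  "loop_depth (emit e) = 0"
  "loop_depth (cond e P Q) = max (loop_depth P) (loop_depth Q)"
  "loop_depth (for_loop r e P) = Suc (loop_depth P)"
  by (simp_all add: assign_def read_input_def emit_def cond_def for_loop_def)

lemma loop_depth_reduction_prog: "loop_depth (reduction_prog k) \<le> 3"
  by (simp add: reduction_prog_def setup_prog_def small_prog_def extend_prog_def weight_prog_def diff_prog_def
      large_prog_def mask_prog_def output_prog_def quota_prog_def vector_prog_def)

fun aexp_consts_le :: "nat \<Rightarrow> aexp \<Rightarrow> bool" where
  "aexp_consts_le M (Num n) \<longleftrightarrow> n \<le> M"
| "aexp_consts_le M (Cell r e) \<longleftrightarrow> aexp_consts_le M e"
| "aexp_consts_le M (Op g e1 e2) \<longleftrightarrow> aexp_consts_le M e1 \<and> aexp_consts_le M e2"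

lemma expr_consts_le_address: "18 \<le> M \<Longrightarrow> expr_consts_le M (address r e) = expr_consts_le M e"
  using arr_num_less[of r] by (simp add: address_def base_expr_def)

lemma expr_consts_le_compile: "18 \<le> M \<Longrightarrow> expr_consts_le M (compile e) = aexp_consts_le M e"
  by (induction e) (auto simp: expr_consts_le_address)

lemma consts_le_simps:
  assumes "18 \<le> M"
  shows "consts_le M (assign r i e) \<longleftrightarrow> aexp_consts_le M i \<and> aexp_consts_le M e"
    "consts_le M (read_input r e) \<longleftrightarrow> aexp_consts_le M e"
    "consts_le M (emit e) \<longleftrightarrow> aexp_consts_le M e"
    "consts_le M (cond e P Q) \<longleftrightarrow> aexp_consts_le M e \<and> consts_le M P \<and> consts_le M Q"
    "consts_le M (for_loop r e P) \<longleftrightarrow> aexp_consts_le M e \<and> consts_le M P"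
  using assms
  by (simp_all add: assign_def read_input_def emit_def cond_def for_loop_def
      expr_consts_le_address expr_consts_le_compile del: compile.simps)

lemma consts_le_reduction_prog: "18 \<le> M \<Longrightarrow> 2 * k \<le> M \<Longrightarrow> consts_le M (reduction_prog k)"
  by (simp add: reduction_prog_def setup_prog_def small_prog_def extend_prog_def weight_prog_def diff_prog_def
      large_prog_def mask_prog_def output_prog_def quota_prog_def vector_prog_def consts_le_simps)

text \<open>Linear in u and f, hence a polynomial factor in the running time. The part 2u + f + 4k
  comes from bounding the factors of 2k * N * (u + 2k) by 2 ^ (2k), 2 ^ (u + f) and 2 ^ (u + 2k);
  the constant 5 provides 2 ^ 5 \<ge> 18.\<close>

definition bits :: "nat \<Rightarrow> nat \<Rightarrow> nat \<Rightarrow> nat" where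
  "bits k u f = 2 * u + f + 4 * k + 5"

lemma bits_bounds:
  assumes "N \<le> 2 ^ u + f"
  shows "18 \<le> (2::nat) ^ bits k u f" "u + 2 * k \<le> 2 ^ bits k u f" "2 ^ u \<le> (2::nat) ^ bits k u f"
    "f + 2 \<le> 2 ^ bits k u f" "2 + 2 * k * N * (u + 2 * k) \<le> 2 ^ bits k u f"
proof -
  have le: "n \<le> 2 ^ n" for n :: nat by simp
  have pow2: "2 + 2 ^ n \<le> (2::nat) ^ (n + 2)" for n by (induction n) auto
  have mono: "x \<le> 2 ^ m \<Longrightarrow> m \<le> bits k u f \<Longrightarrow> x \<le> 2 ^ bits k u f" for x m :: nat
    using power_increasing[of m "bits k u f" "2::nat"] by linarith
  show "18 \<le> (2::nat) ^ bits k u f" by (rule mono[of _ 5]) (auto simp: bits_def)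
  show "u + 2 * k \<le> 2 ^ bits k u f" by (rule mono[OF le]) (auto simp: bits_def)
  show "2 ^ u \<le> (2::nat) ^ bits k u f" by (rule mono[OF order_refl]) (auto simp: bits_def)
  show "f + 2 \<le> 2 ^ bits k u f" by (rule mono[OF le]) (auto simp: bits_def)
  have "(2::nat) ^ u + f \<le> 2 ^ u * (1 + f)" by simp
  also have "\<dots> \<le> 2 ^ u * 2 ^ f" by (intro mult_le_mono2) (simp add: Suc_le_eq)
  finally have N: "N \<le> 2 ^ (u + f)" using assms by (simp add: power_add)
  have "2 * k * N * (u + 2 * k) \<le> 2 ^ (2 * k) * 2 ^ (u + f) * 2 ^ (u + 2 * k)"
    using N by (intro mult_le_mono le)
  also have "\<dots> = 2 ^ (2 * u + f + 4 * k)" by (simp flip: power_add add: algebra_simps)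
  finally have "2 + 2 * k * N * (u + 2 * k) \<le> 2 + 2 ^ (2 * u + f + 4 * k)" by simp
  also have "\<dots> \<le> 2 ^ (2 * u + f + 4 * k + 2)"
    by (rule pow2)
  finally show "2 + 2 * k * N * (u + 2 * k) \<le> 2 ^ bits k u f"
    by (rule mono) (simp add: bits_def)
qed

lemma card_parts_le_sum:
  "card (small_sets u s \<union> large_sets T f s) \<le> card (small_sets u s) + f"
proof -
  have "large_sets T f s \<subseteq> T ` {..<f}" by (auto simp: large_sets_def)
  then have "card (large_sets T f s) \<le> card (T ` {..<f})" by (rule card_mono[rotated]) simp
  also have "\<dots> \<le> f" using card_image_le[of "{..<f}" T] by simp
  finally show ?thesis using card_Un_le[of "small_sets u s" "large_sets T f s"] by linarith
qed

lemma card_small_sets_le_power: "card (small_sets u s) \<le> 2 ^ u"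
proof -
  have "card (small_sets u s) \<le> card (Pow {..<u})"
    by (rule card_mono) (auto simp: small_sets_def)
  then show ?thesis by (simp add: card_Pow)
qed

text \<open>The number 30 consists of the 25 in \<open>overhead\<close> and of 5 more for moving the
  answer to cell 0. Being independent of the input, this constant makes the simulation slower by a
  factor linear in b only.\<close>

definition overhead_const :: nat where
  "overhead_const = expr_cost base_expr + 30 + 4 * expr_size (Bin Plus base_expr (Const 18))"

lemma (in layout) overhead_le:
  assumes "bounded b inp" "18 \<le> (2::nat) ^ b" "1 \<le> b"
  shows "overhead + 5 \<le> b * overhead_const"
proof -
  have "expr_consts_le (2 ^ b) (Bin Plus base_expr (Const 18))"
    using assms(2) by (simp add: base_expr_def)
  moreover from this have "expr_consts_le (2 ^ b) base_expr" by simp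
  moreover have "val (Bin Plus base_expr (Const 18)) inp = base + 18"
    using inp_0 inp_1 by (simp add: base_expr_def base_def)
  ultimately have "cost base_expr inp \<le> b * expr_cost base_expr"
    "bit_length (base + 18) \<le> b * (2 * expr_size (Bin Plus base_expr (Const 18)))"
    using cost_le[OF assms(1) _ assms(3)] bit_length_val_le[OF assms(1) _ assms(3)] by metis+
  moreover have "30 \<le> b * 30" using assms(3) by simp
  ultimately show ?thesis
    unfolding overhead_def overhead_const_def distrib_left by linarith
qed

text \<open>The accounting before any asymptotics: the first summand pays for the test, the
  reduction and the transfer of the answer, the second one for the simulated solver.\<close>

lemma main_prog_answers:
  fixes \<tau> :: "nat \<Rightarrow> nat \<Rightarrow> real"
  assumes Fs: "set Fs \<subseteq> Pow {1..u}" "distinct Fs" and t: "1 \<le> t" and k: "1 \<le> k"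
    and P: "\<And>d n A As. 1 \<le> n \<Longrightarrow> (\<forall>i<2 * k. A i \<subseteq> Pow {1..d} \<and> card (A i) = n) \<Longrightarrow> length As = 2 * k \<Longrightarrow>
      (\<forall>i<2 * k. distinct (As ! i) \<and> set (As ! i) = A i) \<Longrightarrow>
      answers P (ov_input d n As) (orthogonal_vectors (2 * k) A) (\<tau> d n)"
    and \<tau>: "\<And>d n. 0 \<le> \<tau> d n"
  defines "f \<equiv> length Fs" and "b \<equiv> bits k u (length Fs)"
  defines "N \<equiv> card (small_sets u (u div k) \<union> large_sets (\<lambda>i. {j. Suc j \<in> Fs ! i}) f (u div k))"
  shows "answers (main_prog k P) (set_cover_input u Fs t) (set_cover {1..u} (set Fs) t)
    (real b * (expr_cost (Mem base_expr) + 2 + overhead_const + steps (u + f + 2 * k + N) (reduction_prog k)) +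
     real (b * (2 * overhead_const)) * \<tau> (u + 2 * k) N)"
proof -
  let ?m = "load (set_cover_input u Fs t)"
  define T where "T = (\<lambda>i. {j. Suc j \<in> Fs ! i})"
  define Z where "Z = u + f + 2 * k + N"
  let ?s = "u div k"
  have Fs_nth: "Fs ! i \<subseteq> {1..u}" if "i < f" for i
    using Fs(1) nth_mem[of i Fs] that unfolding f_def by blast
  have b1: "1 \<le> b" by (simp add: b_def bits_def)
  have N: "N = card (small_sets u ?s \<union> large_sets T f ?s)" by (simp add: N_def T_def)
  have "N \<le> 2 ^ u + f"
    unfolding N using card_parts_le_sum[of u ?s T f] card_small_sets_le_power[of u ?s] by linarith
  note bb = bits_bounds[OF this, of k, folded b_def[folded f_def]]
  have bnd: "bounded b ?m" by (rule bounded_set_cover_input) (use bb in \<open>auto simp: f_def\<close>)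
  have clim: "expr_consts_le (2 ^ b) (Mem base_expr)" using bb(1) by (simp add: base_expr_def)
  have test_cost: "cost (Mem base_expr) ?m \<le> b * expr_cost (Mem base_expr)"
    by (rule cost_le[OF bnd clim b1])
  have "val base_expr ?m = 2 + u * f + f"
    using load_set_cover_input_0[of u Fs t] load_set_cover_input_1[of u Fs t]
    by (simp add: base_expr_def f_def)
  then have test: "val (Mem base_expr) ?m = of_bool (f < t)"
    using load_set_cover_input_t[of u Fs t f] by (simp add: f_def)
  show ?thesis
  proof (cases "f < t")
    case True
    then have "\<not> set_cover {1..u} (set Fs) t"
      using set_cover_iff[OF Fs, of t] by (simp add: f_def)
    moreover have "exec (main_prog k P) ?m (cost (Mem base_expr) ?m + (cost (Const 0) ?m + cost (Const 0) ?m))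
        (?m(val (Const 0) ?m := val (Const 0) ?m))"
      unfolding main_prog_def by (rule exec.IfTrue[OF _ exec.Assign]) (use test True in simp)
    moreover have "cost (Const 0) ?m = 1" by (simp add: bit_length_def floorlog_def)
    then have "cost (Mem base_expr) ?m + (cost (Const 0) ?m + cost (Const 0) ?m) \<le> b * expr_cost (Mem base_expr) + b * 2"
      using test_cost b1 by linarith
    then have "real (cost (Mem base_expr) ?m + (cost (Const 0) ?m + cost (Const 0) ?m)) \<le>
        real b * (expr_cost (Mem base_expr) + 2)"
      unfolding distrib_left[symmetric] by (metis of_nat_le_iff of_nat_mult)
    moreover have "\<dots> \<le> real b * (expr_cost (Mem base_expr) + 2 + overhead_const + steps (u + f + 2 * k + N) (reduction_prog k))"
      by (intro mult_left_mono) auto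
    moreover have "0 \<le> real (b * (2 * overhead_const)) * \<tau> (u + 2 * k) N" using \<tau> by simp
    ultimately have "real (cost (Mem base_expr) ?m + (cost (Const 0) ?m + cost (Const 0) ?m)) \<le>
        real b * (expr_cost (Mem base_expr) + 2 + overhead_const + steps (u + f + 2 * k + N) (reduction_prog k)) +
        real (b * (2 * overhead_const)) * \<tau> (u + 2 * k) N"
      and "(?m(val (Const 0) ?m := val (Const 0) ?m)) 0 = of_bool (set_cover {1..u} (set Fs) t)"
      and "exec (main_prog k P) ?m (cost (Mem base_expr) ?m + (cost (Const 0) ?m + cost (Const 0) ?m))
        (?m(val (Const 0) ?m := val (Const 0) ?m))"
      by (linarith, simp, blast)
    then show ?thesis unfolding answers_def by blast
  next
    case False
    interpret reduction u f ?m T t k b Z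
    proof
      show "?m 0 = u" "?m 1 = f"
        using load_set_cover_input_0 load_set_cover_input_1 by (auto simp: f_def)
      show "T i \<subseteq> {..<u}" if "i < f" for i
      proof
        fix j assume "j \<in> T i"
        moreover have "Fs ! i \<subseteq> {1..u}" by (rule Fs_nth[OF that])
        ultimately show "j \<in> {..<u}" by (auto simp: T_def)
      qed
      show "inj_on T {..<f}"
      proof (rule inj_onI)
        fix i j assume ij: "i \<in> {..<f}" "j \<in> {..<f}" "T i = T j"
        have "Fs ! i = Suc ` T i" if "i < f" for i
        proof -
          have "Fs ! i \<subseteq> {1..u}" by (rule Fs_nth[OF that])
          show ?thesis
          proof (intro equalityI subsetI)
            fix e assume e: "e \<in> Fs ! i"
            then have "e = Suc (e - 1)" using \<open>Fs ! i \<subseteq> {1..u}\<close> by auto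
            then show "e \<in> Suc ` T i" using e unfolding T_def by (metis imageI mem_Collect_eq)
          qed (auto simp: T_def)
        qed
        then have "Fs ! i = Fs ! j" using ij by simp
        then show "i = j" using Fs(2) ij by (simp add: f_def nth_eq_iff_index_eq)
      qed
      show "?m (2 + i * u + j) = of_bool (j \<in> T i)" if "i < f" "j < u" for i j
        using that load_set_cover_input_set by (simp add: f_def T_def)
      show "?m (2 + u * f + i) = of_bool (i < t)" for i
        unfolding f_def by (rule load_set_cover_input_t)
    qed (use False t k bb in \<open>auto simp: Z_def N\<close>)
    \<comment> \<open>The blank store represents the loaded input, all of which lies below
      \<open>base\<close> when t \<le> f.\<close>
    have mem0: "mem (\<lambda>_ _. 0) = ?m"
    proof
      fix a
      have "?m a = 0" if "\<not> a < base"
      proof -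
        have "2 + u * f + t \<le> a" using that False by (simp add: base_def)
        then show ?thesis by (simp add: load_def length_set_cover_input f_def)
      qed
      then show "mem (\<lambda>_ _. 0) a = ?m a" by (simp add: mem_def)
    qed
    have oh: "overhead + 5 \<le> b * overhead_const" by (rule overhead_le[OF bnd bb(1) b1])
    define C where "C = small \<union> large"
    define V where "V i Y = tagged u (2 * k) i (part_weight T f s Y \<le> quota k t i) Y" for i Y
    have "2 * k \<le> 2 ^ b" using bb(2) by simp
    then have "consts_le (2 ^ b) (reduction_prog k)" by (rule consts_le_reduction_prog[OF bb(1)])
    then obtain \<tau>1 \<sigma> X where 1: "exec (reduction_prog k) ?m \<tau>1 (mem \<sigma>)" "\<tau>1 \<le> b * steps Z (reduction_prog k)"
      "bij_betw X {..<N} C"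
      "\<sigma> OvMem = load (ov_input (u + 2 * k) N (map (\<lambda>i. map (\<lambda>c. V i (X c)) [0..<N]) [0..<2 * k]))"
      using reduction_spec bnd b1 unfolding hoare_def wp_def mem0 N C_def V_def holds_output_def by blast
    define As where "As = map (\<lambda>i. map (\<lambda>c. V i (X c)) [0..<N]) [0..<2 * k]"
    have C_sub: "Y \<subseteq> {..<u}" if "Y \<in> C" for Y using that parts_subset by (simp add: C_def)
    have V_inj: "inj_on (V i) C" for i
      unfolding V_def by (intro inj_onI) (rule tagged_inj[OF C_sub C_sub])
    have As: "distinct (As ! i)" "set (As ! i) = V i ` C" if "i < 2 * k" for i
    proof -
      have As_i: "As ! i = map (\<lambda>c. V i (X c)) [0..<N]" using that by (simp add: As_def)
      have X: "inj_on X {0..<N}" "X ` {0..<N} = C"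
        using 1(3) by (auto simp: bij_betw_def lessThan_atLeast0)
      show "set (As ! i) = V i ` C" unfolding As_i X(2)[symmetric] by (simp add: image_image)
      have "inj_on (V i \<circ> X) {0..<N}" using X V_inj by (intro comp_inj_on) auto
      then show "distinct (As ! i)" unfolding As_i by (simp add: distinct_map comp_def)
    qed
    \<comment> \<open>The empty set is always a candidate, so the families of the instance are
      nonempty, as the guarantee for the solver requires.\<close>
    have "{} \<in> C" by (simp add: C_def small_sets_def)
    then have N1: "1 \<le> N" using finite_parts card_gt_0_iff[of C] unfolding N C_def by fastforce
    have "answers P (ov_input (u + 2 * k) N As) (orthogonal_vectors (2 * k) (\<lambda>i. V i ` C)) (\<tau> (u + 2 * k) N)"
    proof (rule P[OF N1])
      show "\<forall>i<2 * k. V i ` C \<subseteq> Pow {1..u + 2 * k} \<and> card (V i ` C) = N"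
        using card_image[OF V_inj] by (auto simp: N C_def V_def tagged_def)
    qed (use As in \<open>auto simp: As_def\<close>)
    moreover have "orthogonal_vectors (2 * k) (\<lambda>i. V i ` C) \<longleftrightarrow> set_cover {1..u} (set Fs) t"
    proof -
      have "orthogonal_vectors (2 * k) (\<lambda>i. V i ` C) \<longleftrightarrow> parts_exist u T f t k"
        using orthogonal_tagged[of "2 * k" u "\<lambda>i Y. part_weight T f s Y \<le> quota k t i" C] k
        unfolding V_def parts_exist_def C_def by simp
      also have "\<dots> \<longleftrightarrow> (\<exists>I \<subseteq> {..<f}. card I \<le> t \<and> {..<u} \<subseteq> \<Union>(T ` I))"
        using cover_if_parts[of k t f u T] parts_if_cover[of k t f T u] k False T_subset by (auto simp: not_less)
      also have "\<dots> \<longleftrightarrow> set_cover {1..u} (set Fs) t"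
        using set_cover_iff[OF Fs, of t] False unfolding T_def f_def by (simp add: not_less)
      finally show ?thesis .
    qed
    ultimately obtain \<tau>2 m2 where 2: "exec P (\<sigma> OvMem) \<tau>2 m2" "real \<tau>2 \<le> \<tau> (u + 2 * k) N"
        "m2 0 = of_bool (set_cover {1..u} (set Fs) t)"
      unfolding answers_def 1(4) As_def by auto
    obtain \<tau>3 where 3: "exec (relocate OvMem P) (mem \<sigma>) \<tau>3 (mem (\<sigma>(OvMem := m2)))"
        "\<tau>3 \<le> 2 * (overhead + 3) * \<tau>2"
      using exec_relocate[OF 2(1), where r = OvMem] by blast
    let ?m3 = "mem (\<sigma>(OvMem := m2))"
    let ?out = "Mem (address OvMem (Const 0))"
    have out: "val ?out ?m3 = m2 0"
      using mem_cell[of "\<sigma>(OvMem := m2)" OvMem 0] by (simp add: val_address)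
    have c0: "cost (Const 0) ?m3 = 1" "bit_length 0 = 1" by (auto simp: bit_length_def floorlog_def)
    have "bit_length (m2 0) = 1" unfolding 2(3) by (simp add: bit_length_def floorlog_def)
    \<comment> \<open>Five units: one for the target address, three for the entry number 0 inside
      the address computation, one for the answer bit.\<close>
    then have "cost (Const 0) ?m3 + cost ?out ?m3 \<le> overhead + 5"
      using cost_address[of OvMem "Const 0" "\<sigma>(OvMem := m2)"] out c0 by simp
    define \<tau>4 where "\<tau>4 = cost (Const 0) ?m3 + cost ?out ?m3"
    have t4: "\<tau>4 \<le> b * overhead_const"
      using \<open>cost (Const 0) ?m3 + cost ?out ?m3 \<le> overhead + 5\<close> oh unfolding \<tau>4_def by linarith
    have ex: "exec (main_prog k P) ?m (cost (Mem base_expr) ?m + (\<tau>1 + (\<tau>3 + \<tau>4)))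
        (?m3(val (Const 0) ?m3 := val ?out ?m3))"
      unfolding main_prog_def \<tau>4_def
      by (rule exec.IfFalse[OF _ exec.Seq[OF 1(1) exec.Seq[OF 3(1) exec.Assign]]]) (use test False in simp)
    have "real \<tau>3 \<le> real (2 * (overhead + 3) * \<tau>2)" using 3(2) of_nat_mono by blast
    also have "\<dots> = real (2 * (overhead + 3)) * real \<tau>2" by simp
    also have "\<dots> \<le> real (b * (2 * overhead_const)) * \<tau> (u + 2 * k) N"
    proof (rule mult_mono)
      have "2 * (overhead + 3) \<le> b * (2 * overhead_const)" using oh by simp
      then show "real (2 * (overhead + 3)) \<le> real (b * (2 * overhead_const))" by (rule of_nat_mono)
    qed (use 2(2) in auto)
    finally have r3: "real \<tau>3 \<le> real (b * (2 * overhead_const)) * \<tau> (u + 2 * k) N" .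
    have "cost (Mem base_expr) ?m + \<tau>1 + \<tau>4 \<le>
        b * (expr_cost (Mem base_expr) + 2 + overhead_const + steps Z (reduction_prog k))"
      using test_cost 1(2) t4 unfolding distrib_left by linarith
    then have "real (cost (Mem base_expr) ?m + \<tau>1 + \<tau>4) \<le>
        real b * (expr_cost (Mem base_expr) + 2 + overhead_const + steps Z (reduction_prog k))"
      by (metis of_nat_le_iff of_nat_mult)
    then have "real (cost (Mem base_expr) ?m + (\<tau>1 + (\<tau>3 + \<tau>4))) \<le>
        real b * (expr_cost (Mem base_expr) + 2 + overhead_const + steps Z (reduction_prog k)) +
        real (b * (2 * overhead_const)) * \<tau> (u + 2 * k) N"
      using r3 unfolding of_nat_add by linarith
    moreover have "(?m3(val (Const 0) ?m3 := val ?out ?m3)) 0 = of_bool (set_cover {1..u} (set Fs) t)"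
      using out 2(3) by simp
    ultimately show ?thesis
      unfolding answers_def Z_def using ex by blast
  qed
qed

section \<open>Asymptotics and the contradiction\<close>

lemma poly_poly_linear_power:
  "poly (poly (smult [:C:] ([:[:1, 1:], 1:] ^ D)) [:x:]) y = C * (1 + x + y) ^ D" for C x y :: real
  by (simp add: poly_power algebra_simps)

lemma answers_mono: "answers P xs v \<beta> \<Longrightarrow> \<beta> \<le> \<beta>' \<Longrightarrow> answers P xs v \<beta>'"
  unfolding answers_def by force

text \<open>With W = 1 + u + f and E = 2 ^ (\<delta> u) there are at most W * E candidates. The
  reduction costs E ^ 3, below the target since 3 * \<delta> \<le> 1 / 2 \<le> 1 - \<epsilon> / 2;
  the solver costs 2 ^ ((1 - \<epsilon>) u) * E ^ c, below it since \<delta> * c \<le> \<epsilon> /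
  2. Powers of W go into the polynomial, and the 2k additional coordinates contribute only a
  constant factor.\<close>

lemma reduction_time_le:
  fixes \<epsilon> \<delta> c K0 :: real
  assumes \<epsilon>: "0 < \<epsilon>" "\<epsilon> \<le> 1" and c: "0 < c" and \<delta>: "0 < \<delta>" "\<delta> * c \<le> \<epsilon> / 2" "3 * \<delta> \<le> 1 / 2"
    and k: "1 \<le> k" and S: "\<And>u. real (S u) \<le> 2 powr (\<delta> * real u)" and K0: "0 \<le> K0"
  shows "\<exists>C D. \<forall>u f N. N \<le> S u + f \<longrightarrow>
    real (bits k u f) * real (A + steps (u + f + 2 * k + N) (reduction_prog k)) +
      real (bits k u f * B) * (K0 * (2 powr ((1 - \<epsilon>) * real (u + 2 * k)) * real N powr c))
    \<le> 2 powr ((1 - \<epsilon> / 2) * real u) * (C * (1 + real u + real f) ^ D)"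
proof -
  define m where "m = nat \<lceil>c\<rceil>"
  \<comment> \<open>One factor W stems from \<open>bits\<close>; the reduction adds W ^ 3, the
    solver at most W ^ m.\<close>
  define D where "D = 4 + m"
  define s1 where "s1 = steps 1 (reduction_prog k)"
  define c1 where "c1 = 4 * real k + 5"
  define c2 where "c2 = c1 * (real A + real s1 * (2 * real k + 3) ^ 3)"
  define c3 where "c3 = c1 * real B * K0 * 2 powr ((1 - \<epsilon>) * real (2 * k))"
  have "real (bits k u f) * real (A + steps (u + f + 2 * k + N) (reduction_prog k)) +
      real (bits k u f * B) * (K0 * (2 powr ((1 - \<epsilon>) * real (u + 2 * k)) * real N powr c))
    \<le> 2 powr ((1 - \<epsilon> / 2) * real u) * ((c2 + c3) * (1 + real u + real f) ^ D)"
    if N: "N \<le> S u + f" for u f N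
  proof -
    define W where "W = 1 + real u + real f"
    define E where "E = 2 powr (\<delta> * real u)"
    define G where "G = 2 powr ((1 - \<epsilon> / 2) * real u)"
    have W1: "1 \<le> W" by (simp add: W_def)
    have E1: "1 \<le> E" using \<delta> by (simp add: E_def ge_one_powr_ge_zero)
    have bits: "real (bits k u f) \<le> c1 * W"
    proof -
      have "real (bits k u f) = 2 * real u + real f + c1" by (simp add: bits_def c1_def)
      also have "\<dots> \<le> c1 * real u + c1 * real f + c1"
        by (intro add_mono mult_right_mono) (auto simp: c1_def mult_right_mono[of 1 _ "real f", simplified])
      finally show ?thesis by (simp add: W_def algebra_simps)
    qed
    have N_le: "real N \<le> W * E"
    proof -
      have "real N \<le> real (S u) + real f" using N of_nat_mono[OF N] by simp
      also have "\<dots> \<le> E + real f * E"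
        using S[of u] mult_left_mono[OF E1, of "real f"] by (simp add: E_def)
      also have "\<dots> \<le> W * E" using E1 by (simp add: W_def algebra_simps)
      finally show ?thesis .
    qed
    have Z_le: "real (u + f + 2 * k + N) \<le> (2 * real k + 3) * (W * E)"
    proof -
      have WE: "W \<le> W * E" using mult_left_mono[OF E1, of W] W1 by simp
      have "real (u + f + 2 * k) \<le> (2 * real k + 2) * W"
        by (simp add: W_def algebra_simps)
      also have "\<dots> \<le> (2 * real k + 2) * (W * E)" using WE by (intro mult_left_mono) auto
      finally show ?thesis using N_le by (simp add: algebra_simps)
    qed
    have EG: "E ^ 3 \<le> G"
    proof -
      have "E ^ 3 = 2 powr (3 * \<delta> * real u)" by (simp add: E_def powr_power mult_ac)
      also have "\<dots> \<le> G" unfolding G_def using \<delta> \<epsilon> by (intro powr_mono mult_right_mono) auto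
      finally show ?thesis .
    qed
    have G1: "1 \<le> G" using \<epsilon> by (simp add: G_def ge_one_powr_ge_zero)
    let ?Z = "u + f + 2 * k + N"
    have "steps ?Z (reduction_prog k) \<le> s1 * ?Z ^ 3"
      unfolding s1_def using k by (intro steps_le loop_depth_reduction_prog) simp
    then have "real (steps ?Z (reduction_prog k)) \<le> real (s1 * ?Z ^ 3)" by (rule of_nat_mono)
    also have "\<dots> = real s1 * real ?Z ^ 3" by simp
    also have "\<dots> \<le> real s1 * ((2 * real k + 3) * (W * E)) ^ 3"
      using Z_le by (intro mult_left_mono power_mono) auto
    also have "\<dots> = real s1 * (2 * real k + 3) ^ 3 * (W ^ 3 * E ^ 3)" by (simp add: power_mult_distrib)
    also have "\<dots> \<le> real s1 * (2 * real k + 3) ^ 3 * (W ^ 3 * G)"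
      using EG W1 by (intro mult_left_mono) auto
    finally have steps: "real (steps ?Z (reduction_prog k)) \<le> real s1 * (2 * real k + 3) ^ 3 * (W ^ 3 * G)" .
    have "1 \<le> W ^ 3 * G" using W1 G1 mult_mono[of 1 "W ^ 3" 1 G] by simp
    then have "real A \<le> real A * (W ^ 3 * G)" using mult_left_mono[of 1 "W ^ 3 * G" "real A"] by simp
    then have "real (A + steps ?Z (reduction_prog k)) \<le> (real A + real s1 * (2 * real k + 3) ^ 3) * (W ^ 3 * G)"
      using steps by (simp add: distrib_right)
    then have "real (bits k u f) * real (A + steps ?Z (reduction_prog k)) \<le>
        (c1 * W) * ((real A + real s1 * (2 * real k + 3) ^ 3) * (W ^ 3 * G))"
      using bits W1 by (intro mult_mono) (auto simp: c1_def)
    also have "\<dots> = c2 * (G * W ^ 4)" by (simp add: c2_def eval_nat_numeral)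
    also have "\<dots> \<le> c2 * (G * W ^ D)"
      using W1 G1 by (intro mult_left_mono power_increasing) (auto simp: D_def c2_def c1_def)
    finally have part1: "real (bits k u f) * real (A + steps ?Z (reduction_prog k)) \<le> c2 * (G * W ^ D)" .
    have "real N powr c \<le> (W * E) powr c" using N_le c by (intro powr_mono2) auto
    also have "\<dots> = W powr c * E powr c" using W1 E1 by (simp add: powr_mult)
    also have "\<dots> \<le> W ^ m * E powr c"
    proof (rule mult_right_mono)
      have "W powr c \<le> W powr real m" using W1 by (intro powr_mono) (auto simp: m_def real_nat_ceiling_ge)
      then show "W powr c \<le> W ^ m" using W1 by (simp add: powr_realpow)
    qed simp
    also have "E powr c = 2 powr (\<delta> * c * real u)" by (simp add: E_def powr_powr mult_ac)
    finally have Nc: "real N powr c \<le> W ^ m * 2 powr (\<delta> * c * real u)" .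
    have "2 powr ((1 - \<epsilon>) * real (u + 2 * k)) * real N powr c \<le>
        2 powr ((1 - \<epsilon>) * real (u + 2 * k)) * (W ^ m * 2 powr (\<delta> * c * real u))"
      using Nc by (intro mult_left_mono) auto
    also have "\<dots> = 2 powr ((1 - \<epsilon>) * real (2 * k)) * W ^ m * 2 powr ((1 - \<epsilon> + \<delta> * c) * real u)"
      by (simp add: algebra_simps flip: powr_add)
    also have "\<dots> \<le> 2 powr ((1 - \<epsilon>) * real (2 * k)) * W ^ m * G"
      unfolding G_def using \<delta> W1 by (intro mult_left_mono powr_mono mult_right_mono) auto
    finally have A1: "K0 * (2 powr ((1 - \<epsilon>) * real (u + 2 * k)) * real N powr c) \<le>
        K0 * (2 powr ((1 - \<epsilon>) * real (2 * k)) * W ^ m * G)"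
      using K0 by (rule mult_left_mono)
    have A2: "real (bits k u f * B) \<le> c1 * W * real B" using bits by (simp add: mult_right_mono)
    have "real (bits k u f * B) * (K0 * (2 powr ((1 - \<epsilon>) * real (u + 2 * k)) * real N powr c)) \<le>
        (c1 * W * real B) * (K0 * (2 powr ((1 - \<epsilon>) * real (2 * k)) * W ^ m * G))"
      by (rule mult_mono[OF A2 A1]) (use K0 W1 in \<open>auto simp: c1_def\<close>)
    also have "\<dots> = c3 * (G * W ^ Suc m)" by (simp add: c3_def)
    also have "\<dots> \<le> c3 * (G * W ^ D)"
      using W1 G1 K0 by (intro mult_left_mono power_increasing) (auto simp: D_def c3_def c1_def)
    finally show ?thesis
      using part1 unfolding W_def[symmetric] G_def[symmetric] by (simp add: algebra_simps)
  qed
  then show ?thesis by blast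
qed

theorem theorem1p5:
  assumes "Set_Cover_Conjecture"
  shows "\<forall>c::real. \<forall>\<epsilon>::real. c > 0 \<longrightarrow> \<epsilon> > 0 \<longrightarrow>
    (\<exists>k::nat. k \<ge> 1 \<and>
      \<not> ov_solvable_in_bigo k (\<lambda>d n. 2 powr ((1 - \<epsilon>) * real d) * real n powr c))"
proof (intro allI impI, rule ccontr)
  fix c \<epsilon> :: real
  assume c: "c > 0" and \<epsilon>: "\<epsilon> > 0"
    and "\<not> (\<exists>k::nat. k \<ge> 1 \<and>
      \<not> ov_solvable_in_bigo k (\<lambda>d n. 2 powr ((1 - \<epsilon>) * real d) * real n powr c))"
  then have solvable: "ov_solvable_in_bigo k (\<lambda>d n. 2 powr ((1 - \<epsilon>) * real d) * real n powr c)"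
    if "1 \<le> k" for k using that by blast
  \<comment> \<open>Lowering \<epsilon> to at most 1 only weakens the time bound, and it ensures 1 -
    \<epsilon>' / 2 \<ge> 1 / 2, which leaves room for the cubic time of the reduction.\<close>
  define \<epsilon>' where "\<epsilon>' = min \<epsilon> 1"
  have \<epsilon>': "0 < \<epsilon>'" "\<epsilon>' \<le> 1" "\<epsilon>' \<le> \<epsilon>" using \<epsilon> by (auto simp: \<epsilon>'_def)
  \<comment> \<open>The value 1 / 6 serves the cubic time of the reduction, the other one the factor
    n ^ c.\<close>
  define \<delta> where "\<delta> = min (1 / 6) (\<epsilon>' / (2 * c))"
  have \<delta>: "0 < \<delta>" "3 * \<delta> \<le> 1 / 2" using c \<epsilon>' by (auto simp: \<delta>_def)
  have "\<delta> * c \<le> \<epsilon>' / (2 * c) * c" using c by (intro mult_right_mono) (auto simp: \<delta>_def)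
  then have \<delta>c: "\<delta> * c \<le> \<epsilon>' / 2" using c by simp
  \<comment> \<open>This k depends on c and \<epsilon> alone; the solver for 2 * k families is
    obtained only afterwards.\<close>
  obtain k where k: "1 \<le> k" "\<And>u. real (card (small_sets u (u div k))) \<le> 2 powr (\<delta> * real u)"
    using card_small_sets_powr[OF \<delta>(1)] by blast
  obtain K where "ov_solvable_in (2 * k) (\<lambda>d n. K * (2 powr ((1 - \<epsilon>) * real d) * real n powr c))"
    using solvable[of "2 * k"] k(1) unfolding ov_solvable_in_bigo_def by auto
  then obtain P where "\<forall>d n A As. n \<ge> 1 \<longrightarrow> (\<forall>i<2 * k. A i \<subseteq> Pow {1..d} \<and> card (A i) = n) \<longrightarrow>
      length As = 2 * k \<longrightarrow> (\<forall>i<2 * k. distinct (As ! i) \<and> set (As ! i) = A i) \<longrightarrow>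
      answers P (ov_input d n As) (orthogonal_vectors (2 * k) A)
        (K * (2 powr ((1 - \<epsilon>) * real d) * real n powr c))"
    unfolding ov_solvable_in_def by blast
  then have P: "answers P (ov_input d n As) (orthogonal_vectors (2 * k) A)
        (K * (2 powr ((1 - \<epsilon>) * real d) * real n powr c))"
    if "1 \<le> n" "\<forall>i<2 * k. A i \<subseteq> Pow {1..d} \<and> card (A i) = n"
      "length As = 2 * k" "\<forall>i<2 * k. distinct (As ! i) \<and> set (As ! i) = A i" for d n A As
    using that by blast
  \<comment> \<open>The constant K of the bound may be negative, whereas the accounting needs
    nonnegative times.\<close>
  define K0 where "K0 = max K 0"
  define \<tau> where "\<tau> d n = K0 * (2 powr ((1 - \<epsilon>') * real d) * real n powr c)" for d n :: nat
  have \<tau>: "0 \<le> \<tau> d n" "K * (2 powr ((1 - \<epsilon>) * real d) * real n powr c) \<le> \<tau> d n" for d n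
  proof -
    show "0 \<le> \<tau> d n" by (simp add: \<tau>_def K0_def)
    have "2 powr ((1 - \<epsilon>) * real d) \<le> 2 powr ((1 - \<epsilon>') * real d)"
      using \<epsilon>'(3) by (intro powr_mono mult_right_mono) auto
    then show "K * (2 powr ((1 - \<epsilon>) * real d) * real n powr c) \<le> \<tau> d n"
      unfolding \<tau>_def by (intro mult_mono mult_right_mono) (auto simp: K0_def)
  qed
  define A where "A = expr_cost (Mem base_expr) + 2 + overhead_const"
  obtain C D where CD: "\<And>u f N. N \<le> card (small_sets u (u div k)) + f \<Longrightarrow>
    real (bits k u f) * real (A + steps (u + f + 2 * k + N) (reduction_prog k)) +
      real (bits k u f * (2 * overhead_const)) * (K0 * (2 powr ((1 - \<epsilon>') * real (u + 2 * k)) * real N powr c))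
    \<le> 2 powr ((1 - \<epsilon>' / 2) * real u) * (C * (1 + real u + real f) ^ D)"
    using reduction_time_le[OF \<epsilon>'(1,2) c \<delta>(1) \<delta>c \<delta>(2) k(1), of "\<lambda>u. card (small_sets u (u div k))" K0 A "2 * overhead_const"]
      k(2) by (auto simp: K0_def)
  \<comment> \<open>The inner list is the polynomial 1 + x + y, whose outer variable stands for |U|
    and whose inner one for |F|.\<close>
  define p where "p = smult [:C:] ([:[:1, 1:], 1:] ^ D)"
  \<comment> \<open>Half of the saving survives. The number k and the solver influence only the
    polynomial factor.\<close>
  have "set_cover_solvable_in (\<lambda>u f. 2 powr ((1 - \<epsilon>' / 2) * real u) * poly (poly p [:real u:]) (real f))"
    unfolding set_cover_solvable_in_def
  proof (intro exI[of _ "main_prog k P"] allI impI)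
    fix u t :: nat and F :: "nat set set" and Fs :: "nat set list"
    assume F: "F \<subseteq> Pow {1..u}" "distinct Fs" "set Fs = F" "1 \<le> t"
    let ?N = "card (small_sets u (u div k) \<union> large_sets (\<lambda>i. {j. Suc j \<in> Fs ! i}) (length Fs) (u div k))"
    have "answers (main_prog k P) (set_cover_input u Fs t) (set_cover {1..u} (set Fs) t)
      (real (bits k u (length Fs)) * real (A + steps (u + length Fs + 2 * k + ?N) (reduction_prog k)) +
       real (bits k u (length Fs) * (2 * overhead_const)) * \<tau> (u + 2 * k) ?N)"
      unfolding A_def
    proof (rule main_prog_answers[OF _ F(2,4) k(1)])
      show "set Fs \<subseteq> Pow {1..u}" using F by simp
      show "answers P (ov_input d n As) (orthogonal_vectors (2 * k) A) (\<tau> d n)"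
        if "1 \<le> n" "\<forall>i<2 * k. A i \<subseteq> Pow {1..d} \<and> card (A i) = n"
          "length As = 2 * k" "\<forall>i<2 * k. distinct (As ! i) \<and> set (As ! i) = A i" for d n A As
        using answers_mono[OF P[OF that] \<tau>(2)] .
    qed (rule \<tau>(1))
    moreover have "card F = length Fs" using F distinct_card by blast
    ultimately show "answers (main_prog k P) (set_cover_input u Fs t) (set_cover {1..u} F t)
        (2 powr ((1 - \<epsilon>' / 2) * real u) * poly (poly p [:real u:]) (real (card F)))"
      using answers_mono[OF _ CD[OF card_parts_le_sum]] F(3)
      unfolding \<tau>_def p_def poly_poly_linear_power by simp
  qed
  moreover have "0 < \<epsilon>' / 2" using \<epsilon>' by simp
  ultimately show False
    using assms unfolding Set_Cover_Conjecture_def by blast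
qed

end
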